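(* Let $V=\{1,\dots,d\}$, $d\in\{1,2,\dots\}$, let $(E_v,\mathcal{E}_v)$, $v\in V$, be Borel spaces with distinguished points $o_v\in E_v$, and let $\Lambda_V^o$ be a measure on the punctured product space $(E_V^o,\mathcal{E}_V^o)$. Assume: (i) each punctured space $E_v^o=E_v\setminus\{o_v\}$ is localized by an increasing sequence $(L_{h,v})_{h\ge1}$ of sets in $\mathcal{E}_v^o$, and for each nonempty $I\subset V$ the punctured product $E_I^o$ is localized by $L_{h,I}=\bigcup_{a\in I}(L_{h,a}\times E_{I\setminus\{a\}})$, $h\ge1$; (ii) $\Lambda_V^o$ is locally finite, i.e. $\Lambda_V^o(L_{h,V})<\infty$ for all $h$; (iii) for all disjoint $I,J\subset V$ with $I\ne\emptyset$, $\Lambda_V^o(y_I\neq o_I,\ y_J=o_J)\in\{0,\infty\}$. Let $A,B,C\subseteq V$ be disjoint sets forming a partition of $V$, with $A\ne\emptyset$ and $B\neq\emptyset$ (if $A=\emptyset$ or $B=\emptyset$, all statements below are understood to hold trivially). The following statements are equivalent: (a) $\Lambda_V^o$ admits the conditional independence relation $A\perp B\mid C$ in the sense defined in the context. (b) The probabilistic conditional independence $Y_A\perp Y_B\mid Y_C$ holds with $Y\sim P_{R_{h,v}}$, for all $v\in V$ and $h\in\{1,2,\dots\}$ with $\Lambda_V^o(R_{h,v})>0$; if $C=\emptyset$ this is understood as unconditional independence. (c) If $C\neq\emptyset$: the probabilistic conditional independence $Y_A\perp Y_B\mid Y_C$ holds with $Y\sim P_{R_{h,c}}$, for all $c\in C$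 and $h\in\{1,2,\dots\}$ with $\Lambda_V^o(R_{h,c})>0$, and additionally $$\Lambda_V^o(y_A\neq o_A,\ y_B\neq o_B,\ y_C=o_C)=0.\qquad( * )$$ If $C=\emptyset$: $$\Lambda_V^o(y_A\neq o_A,\ y_B\neq o_B)=0.\qquad( ** )$$ (d) If $C\neq\emptyset$: for $\Lambda_C^o$-a.e. $y_C\in E_C^o$, $$\Lambda_{AB\mid C^o}(\cdot\mid y_C)=\Lambda_{A\mid C^o}(\cdot\mid y_C)\otimes\Lambda_{B\mid C^o}(\cdot\mid y_C),$$ and additionally $( * )$ holds. If $C=\emptyset$: $( ** )$ holds. (e) For a Poisson point process $\xi_V^o$ on $(E_V^o,\mathcal{E}_V^o)$ with mean measure $\Lambda_V^o$, and $\xi_I(\cdot)=\xi_V^o(y_I\in\cdot)$ on $(E_I,\mathcal{E}_I)$ for $I\subset V$, the probabilistic conditional independence $\xi_A\perp\xi_B\mid\xi_C$ holds (unconditional independence $\xi_A\perp\xi_B$ if $C=\emptyset$).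
   Context: A Borel space is a measurable space that is isomorphic, via a bijection measurable in both directions, to a Borel subset of $[0,1]$. A measurable space $(E,\mathcal{E})$ is localized by $(L_h)_{h\ge1}$ if $L_h\in\mathcal{E}$, $L_h\subset L_{h+1}$ and $\bigcup_hL_h=E$; a set in $\mathcal{E}$ is bounded if contained in some $L_h$, and a measure is locally finite if it is finite on bounded sets. For $I\subset V$: $E_I=\prod_{v\in I}E_v$ with product $\sigma$-field $\mathcal{E}_I$, $o_I=(o_v)_{v\in I}$, $E_I^o=E_I\setminus\{o_I\}$, $\mathcal{E}_I^o=\{G\cap E_I^o:G\in\mathcal{E}_I\}$, and $y_I=(y_v)_{v\in I}$. Expressions such as $\Lambda_V^o(y_I\ne o_I,\dots)$ denote the measure of the set of $y\in E_V^o$ satisfying the stated conditions; conditions $y_\emptyset=o_\emptyset$ are vacuous. Test sets: $\mathcal{R}(\Lambda_V^o)=\{R=\prod_{v\in V}R_v: R_v\in\mathcal{E}_v,\ \Lambda_V^o(R)>0,\ R\subset L_{h,V}\text{ for some }h\}$. For a measurable $R\subset E_V^o$ with $0<\Lambda_V^o(R)<\infty$, $P_R(G)=\Lambda_V^o(G)/\Lambda_V^o(R)$ for $G\in\mathcal{E}_V$, $G\subseteq R$. For a partition $A,B,C$ of $V$, $\Lambda_V^o$ admits $A\perp B\mid C$ if for every $R\in\mathcal{R}(\Lambda_V^o)$ the classical conditional independence $Y_A\perp Y_B\mid Y_C$ holds, where $Y=(Y_v)_{v\in V}$ is $R$-valued with law $P_R$ (unconditional independence $Y_A\perp Y_B$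 if $C=\emptyset$). For $v\in V$, $h\ge1$: $R_{h,v}=\{y\in E_V: y_v\in L_{h,v}\}=L_{h,v}\times E_{V\setminus\{v\}}$. Kernels: for $C\ne\emptyset$, $\Lambda_C^o(H)=\Lambda_V^o(y_C\in H)$ for $H\in\mathcal{E}_C^o$ (a locally finite, hence $\sigma$-finite, measure). $\Lambda_{AB\mid C^o}:\mathcal{E}_{A\cup B}\times E_C^o\to[0,1]$ is a probability kernel disintegrating the restriction of $\Lambda_V^o$ to $E_A\times E_B\times E_C^o$, i.e. $\Lambda_V^o(G)=\int\int\mathbf{1}_G(y_A,y_B,y_C)\,\Lambda_{AB\mid C^o}(dy_A\,dy_B\mid y_C)\,\Lambda_C^o(dy_C)$ for measurable $G\subset E_A\times E_B\times E_C^o$; $\Lambda_{A\mid C^o}(\cdot\mid y_C)=\Lambda_{AB\mid C^o}(\cdot\times E_B\mid y_C)$ and $\Lambda_{B\mid C^o}(\cdot\mid y_C)=\Lambda_{AB\mid C^o}(E_A\times\cdot\mid y_C)$ are its marginal kernels. Point processes: an $s$-finite measure is a countable sum of finite measures. $\mathcal{N}(E)$ is the space of $s$-finite $\{0,1,\dots,\infty\}$-valued measures on $(E,\mathcal{E})$, with the smallest $\sigma$-field making all evaluations $\mu\mapsto\mu(G)$ measurable. A Poisson point process with $s$-finite mean measure $\Lambda$ is a random element $\xi$ of $\mathcal{N}(E)$ such that $\xi(G)$ is Poisson with mean $\Lambda(G)$ for each $G\in\mathcal{E}$ (a.s. $0$, resp. $\infty$, if $\Lambda(G)=0$, resp. $\infty$)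 and $\xi(G_1),\dots,\xi(G_m)$ are independent for disjoint $G_1,\dots,G_m$. Each $\xi_I$ is a random element of $\mathcal{N}(E_I)$. *)

theory Defs
  imports "HOL-Probability.Probability"
begin

text \<open>
  The spaces \<open>E_v\<close> are given by measures \<open>M v\<close>, of which only the carrier and the \<open>\<sigma>\<close>-field
  matter; \<open>E_I\<close> is \<open>PiM I M\<close> and \<open>y_I\<close> is \<open>restrict y I\<close>. The distinguished points are
  \<open>pt v\<close>, and the localizing sets \<open>L h v\<close> are used for \<open>h \<ge> 1\<close> only.
\<close>

definition borel_isomorphic :: "'a measure \<Rightarrow> bool" where
  "borel_isomorphic N \<longleftrightarrow>
    (\<exists>S f g. S \<in> sets borel \<and> S \<subseteq> {0..1::real} \<and>
      f \<in> N \<rightarrow>\<^sub>M restrict_space borel S \<and> g \<in> restrict_space borel S \<rightarrow>\<^sub>M N \<and>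
      bij_betw f (space N) S \<and> (\<forall>x\<in>space N. g (f x) = x))"

definition localized :: "'a measure \<Rightarrow> (nat \<Rightarrow> 'a set) \<Rightarrow> bool" where
  "localized N K \<longleftrightarrow>
    (\<forall>h\<ge>1. K h \<in> sets N) \<and> (\<forall>h\<ge>1. K h \<subseteq> K (h + 1)) \<and> (\<Union>h\<in>{1..}. K h) = space N"

definition punctured :: "(nat \<Rightarrow> 'a measure) \<Rightarrow> (nat \<Rightarrow> 'a) \<Rightarrow> nat set \<Rightarrow> (nat \<Rightarrow> 'a) measure" where
  "punctured M pt I = restrict_space (PiM I M) (space (PiM I M) - {restrict pt I})"

text \<open>\<open>cyl M L I h a\<close> is \<open>L_{h,a} \<times> E_{I - {a}}\<close>; in particular \<open>cyl M L V h v\<close> is \<open>R_{h,v}\<close>.\<close>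

definition cyl ::
  "(nat \<Rightarrow> 'a measure) \<Rightarrow> (nat \<Rightarrow> nat \<Rightarrow> 'a set) \<Rightarrow> nat set \<Rightarrow> nat \<Rightarrow> nat \<Rightarrow> (nat \<Rightarrow> 'a) set" where
  "cyl M L I h a = {y \<in> space (PiM I M). y a \<in> L h a}"

definition prod_loc ::
  "(nat \<Rightarrow> 'a measure) \<Rightarrow> (nat \<Rightarrow> nat \<Rightarrow> 'a set) \<Rightarrow> nat set \<Rightarrow> nat \<Rightarrow> (nat \<Rightarrow> 'a) set" where
  "prod_loc M L I h = (\<Union>a\<in>I. cyl M L I h a)"

definition test_sets ::
  "(nat \<Rightarrow> 'a measure) \<Rightarrow> (nat \<Rightarrow> nat \<Rightarrow> 'a set) \<Rightarrow> nat set \<Rightarrow> (nat \<Rightarrow> 'a) measure \<Rightarrow>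
    (nat \<Rightarrow> 'a) set set" where
  "test_sets M L V \<Lambda> =
    {PiE V R | R. (\<forall>v\<in>V. R v \<in> sets (M v)) \<and> emeasure \<Lambda> (PiE V R) > 0 \<and>
      (\<exists>h\<ge>1. PiE V R \<subseteq> prod_loc M L V h)}"

text \<open>A probability measure with carrier \<open>R\<close>, provided \<open>R\<close> is measurable with positive finite measure.\<close>

definition cond_law :: "'a measure \<Rightarrow> 'a set \<Rightarrow> 'a measure" where
  "cond_law \<Lambda> R = uniform_measure (restrict_space \<Lambda> R) R"

text \<open>
  \<open>X\<close> and \<open>Y\<close> are conditionally independent given \<open>Z\<close>: the conditional probabilities given the
  \<open>\<sigma>\<close>-field generated by \<open>Z\<close> factorize almost surely.
\<close>

definition cond_indep_var ::
  "'w measure \<Rightarrow> 'b measure \<Rightarrow> ('w \<Rightarrow> 'b) \<Rightarrow> 'c measure \<Rightarrow> ('w \<Rightarrow> 'c) \<Rightarrow>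
    'd measure \<Rightarrow> ('w \<Rightarrow> 'd) \<Rightarrow> bool" where
  "cond_indep_var P MX X MY Y MZ Z \<longleftrightarrow>
    X \<in> P \<rightarrow>\<^sub>M MX \<and> Y \<in> P \<rightarrow>\<^sub>M MY \<and> Z \<in> P \<rightarrow>\<^sub>M MZ \<and>
    (\<forall>F\<in>sets MX. \<forall>G\<in>sets MY. AE w in P.
      real_cond_exp P (vimage_algebra (space P) Z MZ) (\<lambda>w. indicator F (X w) * indicator G (Y w)) w =
      real_cond_exp P (vimage_algebra (space P) Z MZ) (\<lambda>w. indicator F (X w)) w *
      real_cond_exp P (vimage_algebra (space P) Z MZ) (\<lambda>w. indicator G (Y w)) w)"

text \<open>
  The relation \<open>Y_A \<bottom> Y_B | Y_C\<close> for \<open>Y\<close> with law \<open>Q\<close>, where \<open>Y\<close> is realized as the identity on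
  the carrier of \<open>Q\<close>.
\<close>

definition coord_cond_indep ::
  "(nat \<Rightarrow> 'a measure) \<Rightarrow> nat set \<Rightarrow> nat set \<Rightarrow> nat set \<Rightarrow> (nat \<Rightarrow> 'a) measure \<Rightarrow> bool" where
  "coord_cond_indep M A B C Q \<longleftrightarrow>
    (if C = {} then
      prob_space.indep_var Q (PiM A M) (\<lambda>y. restrict y A) (PiM B M) (\<lambda>y. restrict y B)
     else
      cond_indep_var Q (PiM A M) (\<lambda>y. restrict y A) (PiM B M) (\<lambda>y. restrict y B)
        (PiM C M) (\<lambda>y. restrict y C))"

definition admits_cond_indep ::
  "(nat \<Rightarrow> 'a measure) \<Rightarrow> (nat \<Rightarrow> nat \<Rightarrow> 'a set) \<Rightarrow> nat set \<Rightarrow> (nat \<Rightarrow> 'a) measure \<Rightarrow>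
    nat set \<Rightarrow> nat set \<Rightarrow> nat set \<Rightarrow> bool" where
  "admits_cond_indep M L V \<Lambda> A B C \<longleftrightarrow>
    (\<forall>R\<in>test_sets M L V \<Lambda>. coord_cond_indep M A B C (cond_law \<Lambda> R))"

text \<open>The measure \<open>\<Lambda>_C\<^sup>o\<close> on the punctured product over \<open>C\<close>.\<close>

definition punctured_marginal ::
  "(nat \<Rightarrow> 'a measure) \<Rightarrow> (nat \<Rightarrow> 'a) \<Rightarrow> (nat \<Rightarrow> 'a) measure \<Rightarrow> nat set \<Rightarrow> (nat \<Rightarrow> 'a) measure" where
  "punctured_marginal M pt \<Lambda> C =
    distr (restrict_space \<Lambda> {y \<in> space \<Lambda>. restrict y C \<noteq> restrict pt C})
      (punctured M pt C) (\<lambda>y. restrict y C)"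

text \<open>\<open>K\<close> is a version of the probability kernel \<open>\<Lambda>_{AB|C\<^sup>o}\<close>.\<close>

definition disintegrating_kernel ::
  "(nat \<Rightarrow> 'a measure) \<Rightarrow> (nat \<Rightarrow> 'a) \<Rightarrow> (nat \<Rightarrow> 'a) measure \<Rightarrow>
    nat set \<Rightarrow> nat set \<Rightarrow> nat set \<Rightarrow> ((nat \<Rightarrow> 'a) \<Rightarrow> (nat \<Rightarrow> 'a) measure) \<Rightarrow> bool" where
  "disintegrating_kernel M pt \<Lambda> A B C K \<longleftrightarrow>
    K \<in> punctured M pt C \<rightarrow>\<^sub>M prob_algebra (PiM (A \<union> B) M) \<and>
    (\<forall>G\<in>sets \<Lambda>. G \<subseteq> {y. restrict y C \<noteq> restrict pt C} \<longrightarrow>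
      emeasure \<Lambda> G =
        (\<integral>\<^sup>+ yC. (\<integral>\<^sup>+ yAB. indicator G (merge (A \<union> B) C (yAB, yC)) \<partial>K yC)
          \<partial>punctured_marginal M pt \<Lambda> C))"

definition marginal_kernel ::
  "(nat \<Rightarrow> 'a measure) \<Rightarrow> nat set \<Rightarrow> ((nat \<Rightarrow> 'a) \<Rightarrow> (nat \<Rightarrow> 'a) measure) \<Rightarrow>
    (nat \<Rightarrow> 'a) \<Rightarrow> (nat \<Rightarrow> 'a) measure" where
  "marginal_kernel M I K yC = distr (K yC) (PiM I M) (\<lambda>y. restrict y I)"

definition s_finite :: "'a measure \<Rightarrow> bool" where
  "s_finite N \<longleftrightarrow>
    (\<exists>\<mu>::nat \<Rightarrow> 'a measure. (\<forall>n. sets (\<mu> n) = sets N \<and> finite_measure (\<mu> n)) \<and>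
      (\<forall>G\<in>sets N. emeasure N G = (\<Sum>n. emeasure (\<mu> n) G)))"

definition point_measures :: "'a measure \<Rightarrow> 'a measure set" where
  "point_measures N =
    {\<mu>. sets \<mu> = sets N \<and> s_finite \<mu> \<and> (\<forall>G\<in>sets N. emeasure \<mu> G \<in> range ennreal_of_enat)}"

text \<open>Carries the smallest \<open>\<sigma>\<close>-field making all evaluations measurable, cf. \<open>subprob_algebra\<close>.\<close>

definition point_measure_algebra :: "'a measure \<Rightarrow> 'a measure measure" where
  "point_measure_algebra N =
    (SUP G\<in>sets N. vimage_algebra (point_measures N) (\<lambda>\<mu>. emeasure \<mu> G) borel)"

definition poisson_process :: "'w measure \<Rightarrow> 'a measure \<Rightarrow> ('w \<Rightarrow> 'a measure) \<Rightarrow> bool" where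
  "poisson_process P \<Lambda> \<xi> \<longleftrightarrow>
    prob_space P \<and> s_finite \<Lambda> \<and> \<xi> \<in> P \<rightarrow>\<^sub>M point_measure_algebra \<Lambda> \<and>
    (\<forall>G\<in>sets \<Lambda>.
      (emeasure \<Lambda> G = 0 \<longrightarrow> (AE w in P. emeasure (\<xi> w) G = 0)) \<and>
      (emeasure \<Lambda> G = \<infinity> \<longrightarrow> (AE w in P. emeasure (\<xi> w) G = \<infinity>)) \<and>
      (0 < emeasure \<Lambda> G \<and> emeasure \<Lambda> G < \<infinity> \<longrightarrow>
        (\<forall>k::nat. measure P {w \<in> space P. emeasure (\<xi> w) G = of_nat k} =
          pmf (poisson_pmf (measure \<Lambda> G)) k))) \<and>
    (\<forall>(m::nat) G. (\<forall>i\<in>{1..m}. G i \<in> sets \<Lambda>) \<and> disjoint_family_on G {1..m} \<longrightarrow>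
      prob_space.indep_vars P (\<lambda>_. borel) (\<lambda>i w. emeasure (\<xi> w) (G i)) {1..m})"

text \<open>The process \<open>\<xi>_I\<close> on \<open>E_I\<close>; its points may include \<open>o_I\<close>, and infinitely often so.\<close>

definition proj_process ::
  "(nat \<Rightarrow> 'a measure) \<Rightarrow> ('w \<Rightarrow> (nat \<Rightarrow> 'a) measure) \<Rightarrow> nat set \<Rightarrow> 'w \<Rightarrow> (nat \<Rightarrow> 'a) measure" where
  "proj_process M \<xi> I w = distr (\<xi> w) (PiM I M) (\<lambda>y. restrict y I)"

definition process_cond_indep ::
  "(nat \<Rightarrow> 'a measure) \<Rightarrow> nat set \<Rightarrow> nat set \<Rightarrow> nat set \<Rightarrow>
    'w measure \<Rightarrow> ('w \<Rightarrow> (nat \<Rightarrow> 'a) measure) \<Rightarrow> bool" where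
  "process_cond_indep M A B C P \<xi> \<longleftrightarrow>
    (if C = {} then
      prob_space.indep_var P (point_measure_algebra (PiM A M)) (proj_process M \<xi> A)
        (point_measure_algebra (PiM B M)) (proj_process M \<xi> B)
     else
      cond_indep_var P (point_measure_algebra (PiM A M)) (proj_process M \<xi> A)
        (point_measure_algebra (PiM B M)) (proj_process M \<xi> B)
        (point_measure_algebra (PiM C M)) (proj_process M \<xi> C))"

end

theory Submission
  imports Defs
begin

text \<open>
  All five statements are compared with one pair of conditions: on \<open>{y_C \<noteq> o_C}\<close> the measure
  \<open>\<Lambda>\<close> satisfies a one-sided form of conditional independence, which passes to product subsets and
  can be glued along sets depending on \<open>y_C\<close> only, and on \<open>{y_C = o_C}\<close> the blocks \<open>A\<close> and \<open>B\<close> are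
  never both different from \<open>o\<close>, up to a null set. If the second condition failed, conditional independence
  on the sets \<open>y_b \<in> L_{h,b}\<close> would bound \<open>\<Lambda>(y_b \<noteq> o_b, y_C = o_C)\<close>, which then vanishes by the
  zero-infinity hypothesis.

  For the Poisson process \<open>\<xi>\<close>, the conditional expectation of \<open>\<Prod> v(y_B)\<close> (over the points of \<open>\<xi>\<close>) given
  \<open>\<xi>_C\<close> is \<open>exp (-\<integral>(1 - v) d\<Lambda>)\<close>, integrated over \<open>{y_C = o_C}\<close>, times the product of the conditional
  expectations of \<open>v\<close> given \<open>y_C \<noteq> o_C\<close>. Comparing Laplace functionals reduces the conditional
  independence of the processes to an identity between integrals with respect to \<open>\<Lambda>\<close>.
\<close>

subsection \<open>Conditional independence through test functions\<close>

text \<open>The zero-infinity hypothesis acts twice. Besides excluding that the blocks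
  \<open>A\<close> and \<open>B\<close> both move while \<open>y_C\<close> stays at its
  distinguished point, it carries the Poisson side: on a set of measure 0 or \<infinity> and for a
  constant \<open>c \<le> 1\<close>, the integral of \<open>1 - c * q\<close> is the sum of the
  integrals of \<open>1 - c\<close> and \<open>1 - q\<close>, so a Laplace exponent separates into a
  constant and a part seen by fewer blocks. The obstacle is infinite mass near the distinguished
  points: exponents may be infinite and then cannot be cancelled. The way back from the processes to
  \<Lambda> therefore uses test functions that differ from 1 only on bounded sets, cancels finite
  exponents there, and exhausts the space afterwards. The case \<open>C = {}\<close> is absorbed.
  The product over the empty set is a single point, so \<open>y_C \<noteq> o_C\<close> never occurs
  and the first of the two conditions is void; independence is conditional independence given a
  variable all of whose events have probability 0 or 1.\<close>

text \<open>The Doob-Dynkin factorization, by induction on the build-up of nonnegative measurable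
  functions. It turns conditional expectations into functions on the value space of
  \<open>Z\<close>, where they can be restricted, pasted and compared.\<close>

lemma factor_through:
  fixes f :: "'a \<Rightarrow> ennreal"
  assumes "f \<in> borel_measurable (vimage_algebra \<Omega> Z MZ)" and Z: "Z \<in> \<Omega> \<rightarrow> space MZ"
  shows "\<exists>g\<in>borel_measurable MZ. \<forall>x\<in>\<Omega>. f x = g (Z x)"
  using assms(1)
proof induct
  case (cong f g)
  then show ?case by simp
next
  case (set A)
  then obtain H where H: "H \<in> sets MZ" "A = Z -` H \<inter> \<Omega>"
    by (auto simp: sets_vimage_algebra2[OF Z])
  then show ?case
    by (intro bexI[of _ "indicator H"]) (auto simp: indicator_def)
next
  case (mult u c)
  then obtain g where "g \<in> borel_measurable MZ" "\<forall>x\<in>\<Omega>. u x = g (Z x)" by blast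
  then show ?case by (intro bexI[of _ "\<lambda>z. c * g z"]) simp_all
next
  case (add u v)
  then obtain g g' where "g \<in> borel_measurable MZ" "\<forall>x\<in>\<Omega>. u x = g (Z x)"
    "g' \<in> borel_measurable MZ" "\<forall>x\<in>\<Omega>. v x = g' (Z x)" by blast
  then show ?case by (intro bexI[of _ "\<lambda>z. g' z + g z"]) simp_all
next
  case (seq U)
  then obtain g where g: "\<And>i. g i \<in> borel_measurable MZ" "\<And>i x. x \<in> \<Omega> \<Longrightarrow> U i x = g i (Z x)"
    by metis
  then show ?case
    by (intro bexI[of _ "\<lambda>z. SUP i. g i z"]) (simp_all add: image_comp)
qed

text \<open>Both sides integrate \<open>w\<close> against the image under \<open>Z\<close> of the
  measure with density \<phi>, respectively \<psi>, and the hypothesis says that the two images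
  agree on every measurable set. Since no generator is involved, the measures may be arbitrarily
  infinite.\<close>

lemma nn_integral_eq_comp:
  fixes \<phi> \<psi> :: "'w \<Rightarrow> ennreal"
  assumes [measurable]: "\<phi> \<in> borel_measurable P" "\<psi> \<in> borel_measurable P" "Z \<in> P \<rightarrow>\<^sub>M MZ"
    "w \<in> borel_measurable MZ"
    and eq: "\<And>H. H \<in> sets MZ \<Longrightarrow>
      (\<integral>\<^sup>+x. \<phi> x * indicator H (Z x) \<partial>P) = (\<integral>\<^sup>+x. \<psi> x * indicator H (Z x) \<partial>P)"
  shows "(\<integral>\<^sup>+x. \<phi> x * w (Z x) \<partial>P) = (\<integral>\<^sup>+x. \<psi> x * w (Z x) \<partial>P)"
proof -
  have em: "emeasure (distr (density P \<rho>) MZ Z) H = (\<integral>\<^sup>+x. \<rho> x * indicator H (Z x) \<partial>P)"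
    if [measurable]: "H \<in> sets MZ" "\<rho> \<in> borel_measurable P" for H \<rho>
    by (subst emeasure_distr, simp, simp, subst emeasure_density)
      (auto intro!: nn_integral_cong simp: indicator_def)
  have "distr (density P \<phi>) MZ Z = distr (density P \<psi>) MZ Z"
    by (rule measure_eqI) (auto simp: em eq)
  then have "(\<integral>\<^sup>+z. w z \<partial>distr (density P \<phi>) MZ Z) = (\<integral>\<^sup>+z. w z \<partial>distr (density P \<psi>) MZ Z)"
    by simp
  then show ?thesis
    by (simp add: nn_integral_distr nn_integral_density)
qed

text \<open>
  Conditional independence of \<open>X\<close> and \<open>Y\<close> given \<open>Z\<close>, in the form \<open>E[1_F(X) | Y, Z] = f(Z)\<close>.
  Requiring finite \<open>f\<close>, rather than \<open>f \<le> 1\<close>, makes the passage to product subsets work for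
  measures that are not \<open>\<sigma>\<close>-finite on the events generated by \<open>Z\<close>.
\<close>

definition ci ::
  "'w measure \<Rightarrow> 'b measure \<Rightarrow> ('w \<Rightarrow> 'b) \<Rightarrow> 'c measure \<Rightarrow> ('w \<Rightarrow> 'c) \<Rightarrow>
    'd measure \<Rightarrow> ('w \<Rightarrow> 'd) \<Rightarrow> bool" where
  "ci P MX X MY Y MZ Z \<longleftrightarrow>
    (\<forall>F\<in>sets MX. \<exists>f\<in>borel_measurable MZ. (\<forall>z. f z < (top::ennreal)) \<and>
      (\<forall>G\<in>sets MY. \<forall>w\<in>borel_measurable MZ.
        (\<integral>\<^sup>+x. indicator F (X x) * indicator G (Y x) * w (Z x) \<partial>P) =
        (\<integral>\<^sup>+x. f (Z x) * indicator G (Y x) * w (Z x) \<partial>P)))"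

text \<open>By \<open>nn_integral_eq_comp\<close>, indicators of sets in \<open>MZ\<close> suffice
  as weights \<open>w\<close>.\<close>

lemma ciI:
  assumes [measurable]: "X \<in> P \<rightarrow>\<^sub>M MX" "Y \<in> P \<rightarrow>\<^sub>M MY" "Z \<in> P \<rightarrow>\<^sub>M MZ"
    and "\<And>F. F \<in> sets MX \<Longrightarrow> \<exists>f\<in>borel_measurable MZ. (\<forall>z. f z < (top::ennreal)) \<and>
      (\<forall>G\<in>sets MY. \<forall>H\<in>sets MZ.
        (\<integral>\<^sup>+x. indicator F (X x) * indicator G (Y x) * indicator H (Z x) \<partial>P) =
        (\<integral>\<^sup>+x. f (Z x) * indicator G (Y x) * indicator H (Z x) \<partial>P))"
  shows "ci P MX X MY Y MZ Z"
  unfolding ci_def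
proof
  fix F assume F[measurable]: "F \<in> sets MX"
  from assms(4)[OF F] obtain f where [measurable]: "f \<in> borel_measurable MZ" and
    f: "\<And>z. f z < (top::ennreal)" and eq: "\<And>G H. G \<in> sets MY \<Longrightarrow> H \<in> sets MZ \<Longrightarrow>
        (\<integral>\<^sup>+x. indicator F (X x) * indicator G (Y x) * indicator H (Z x) \<partial>P) =
        (\<integral>\<^sup>+x. f (Z x) * indicator G (Y x) * indicator H (Z x) \<partial>P)"
    by blast
  show "\<exists>f\<in>borel_measurable MZ. (\<forall>z. f z < (top::ennreal)) \<and>
      (\<forall>G\<in>sets MY. \<forall>w\<in>borel_measurable MZ.
        (\<integral>\<^sup>+x. indicator F (X x) * indicator G (Y x) * w (Z x) \<partial>P) =
        (\<integral>\<^sup>+x. f (Z x) * indicator G (Y x) * w (Z x) \<partial>P))"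
  proof (intro bexI[of _ f] conjI allI ballI)
    fix G and w :: "_ \<Rightarrow> ennreal" assume G[measurable]: "G \<in> sets MY" and [measurable]: "w \<in> borel_measurable MZ"
    show "(\<integral>\<^sup>+x. indicator F (X x) * indicator G (Y x) * w (Z x) \<partial>P) =
        (\<integral>\<^sup>+x. f (Z x) * indicator G (Y x) * w (Z x) \<partial>P)"
      by (rule nn_integral_eq_comp[where MZ=MZ, OF _ _ _ _ eq[OF G]]) measurable
  qed (simp_all add: f)
qed

text \<open>The conditional expectation of \<open>\<phi>\<close> given \<open>Z\<close>, for a measure that need not be finite.\<close>

definition version :: "'w measure \<Rightarrow> 'd measure \<Rightarrow> ('w \<Rightarrow> 'd) \<Rightarrow> ('w \<Rightarrow> ennreal) \<Rightarrow> ('d \<Rightarrow> ennreal) \<Rightarrow> bool" where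
  "version P MZ Z \<phi> f \<longleftrightarrow> f \<in> borel_measurable MZ \<and>
    (\<forall>w\<in>borel_measurable MZ. (\<integral>\<^sup>+x. \<phi> x * w (Z x) \<partial>P) = (\<integral>\<^sup>+x. f (Z x) * w (Z x) \<partial>P))"

lemma versionI:
  assumes "\<phi> \<in> borel_measurable P" "f \<in> borel_measurable MZ" "Z \<in> P \<rightarrow>\<^sub>M MZ"
    and "\<And>H. H \<in> sets MZ \<Longrightarrow>
      (\<integral>\<^sup>+x. \<phi> x * indicator H (Z x) \<partial>P) = (\<integral>\<^sup>+x. f (Z x) * indicator H (Z x) \<partial>P)"
  shows "version P MZ Z \<phi> f"
  unfolding version_def using assms(2) nn_integral_eq_comp[OF assms(1) _ assms(3) _ assms(4)]
    measurable_compose[OF assms(3,2)] by blast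

lemma versionD:
  "version P MZ Z \<phi> f \<Longrightarrow> w \<in> borel_measurable MZ \<Longrightarrow>
    (\<integral>\<^sup>+x. \<phi> x * w (Z x) \<partial>P) = (\<integral>\<^sup>+x. f (Z x) * w (Z x) \<partial>P)"
  unfolding version_def by blast

lemma version_measurable: "version P MZ Z \<phi> f \<Longrightarrow> f \<in> borel_measurable MZ"
  unfolding version_def by blast

text \<open>For \<open>u = indicator F\<close>, first \<open>F\<close> is exchanged for its function
  \<open>f\<close> of \<open>Z\<close>. Then \<open>v (Y x)\<close> meets only functions of
  \<open>Z\<close> and may be exchanged for its version, and afterwards \<open>f\<close> is turned
  back into \<open>F\<close>. The factor \<open>u\<close> itself never has to possess a version, so
  it may be unbounded and \<open>P\<close> infinite.\<close>

lemma ci_half: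
  assumes ci: "ci P MX X MY Y MZ Z"
    and [measurable]: "X \<in> P \<rightarrow>\<^sub>M MX" "Y \<in> P \<rightarrow>\<^sub>M MY" "Z \<in> P \<rightarrow>\<^sub>M MZ"
      "u \<in> borel_measurable MX" "v \<in> borel_measurable MY" "w \<in> borel_measurable MZ"
    and v: "version P MZ Z (\<lambda>x. v (Y x)) v'"
  shows "(\<integral>\<^sup>+x. u (X x) * v (Y x) * w (Z x) \<partial>P) = (\<integral>\<^sup>+x. u (X x) * v' (Z x) * w (Z x) \<partial>P)"
proof -
  have [measurable]: "v' \<in> borel_measurable MZ" using v by (rule version_measurable)
  have "(\<integral>\<^sup>+x. (v (Y x) * w (Z x)) * u (X x) \<partial>P) = (\<integral>\<^sup>+x. (v' (Z x) * w (Z x)) * u (X x) \<partial>P)"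
  proof (rule nn_integral_eq_comp[where MZ=MX])
    fix F assume F[measurable]: "F \<in> sets MX"
    from ci F obtain f where [measurable]: "f \<in> borel_measurable MZ" and
      eq: "\<And>G w. G \<in> sets MY \<Longrightarrow> w \<in> borel_measurable MZ \<Longrightarrow>
        (\<integral>\<^sup>+x. indicator F (X x) * indicator G (Y x) * w (Z x) \<partial>P) =
        (\<integral>\<^sup>+x. f (Z x) * indicator G (Y x) * w (Z x) \<partial>P)"
      unfolding ci_def by blast
    \<comment> \<open>The choice \<open>G = space MY\<close> shows that \<open>f\<close> is a
      version of the indicator of \<open>F\<close>.\<close>
    have top: "(\<integral>\<^sup>+x. indicator F (X x) * w (Z x) \<partial>P) = (\<integral>\<^sup>+x. f (Z x) * w (Z x) \<partial>P)"
      if [measurable]: "w \<in> borel_measurable MZ" for w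
    proof -
      have "Y x \<in> space MY" if "x \<in> space P" for x using that by (rule measurable_space[rotated]) simp
      then show ?thesis
        using eq[OF sets.top that] by (simp cong: nn_integral_cong)
    qed
    have "(\<integral>\<^sup>+x. v (Y x) * w (Z x) * indicator F (X x) \<partial>P) =
        (\<integral>\<^sup>+x. (indicator F (X x) * w (Z x)) * v (Y x) \<partial>P)"
      by (simp add: mult_ac)
    also have "\<dots> = (\<integral>\<^sup>+x. (f (Z x) * w (Z x)) * v (Y x) \<partial>P)"
    proof (rule nn_integral_eq_comp[where MZ=MY])
      fix G assume G: "G \<in> sets MY"
      show "(\<integral>\<^sup>+x. indicator F (X x) * w (Z x) * indicator G (Y x) \<partial>P) =
         (\<integral>\<^sup>+x. f (Z x) * w (Z x) * indicator G (Y x) \<partial>P)"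
        using eq[OF G \<open>w \<in> borel_measurable MZ\<close>] by (simp add: mult_ac)
    qed measurable
    also have "\<dots> = (\<integral>\<^sup>+x. v (Y x) * (f (Z x) * w (Z x)) \<partial>P)"
      by (simp add: mult_ac)
    also have "\<dots> = (\<integral>\<^sup>+x. v' (Z x) * (f (Z x) * w (Z x)) \<partial>P)"
      by (rule versionD[OF v, where w="\<lambda>z. f z * w z"]) measurable
    also have "\<dots> = (\<integral>\<^sup>+x. f (Z x) * (v' (Z x) * w (Z x)) \<partial>P)"
      by (simp add: mult_ac)
    also have "\<dots> = (\<integral>\<^sup>+x. indicator F (X x) * (v' (Z x) * w (Z x)) \<partial>P)"
      by (rule top[where w="\<lambda>z. v' z * w z", symmetric]) measurable
    finally show "(\<integral>\<^sup>+x. v (Y x) * w (Z x) * indicator F (X x) \<partial>P) =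
      (\<integral>\<^sup>+x. v' (Z x) * w (Z x) * indicator F (X x) \<partial>P)"
      by (simp add: mult_ac)
  qed measurable
  then show ?thesis by (simp add: mult_ac)
qed

lemma ci_product:
  assumes ci: "ci P MX X MY Y MZ Z"
    and [measurable]: "X \<in> P \<rightarrow>\<^sub>M MX" "Y \<in> P \<rightarrow>\<^sub>M MY" "Z \<in> P \<rightarrow>\<^sub>M MZ"
      "u \<in> borel_measurable MX" "v \<in> borel_measurable MY" "w \<in> borel_measurable MZ"
    and u: "version P MZ Z (\<lambda>x. u (X x)) u'" and v: "version P MZ Z (\<lambda>x. v (Y x)) v'"
  shows "(\<integral>\<^sup>+x. u (X x) * v (Y x) * w (Z x) \<partial>P) = (\<integral>\<^sup>+x. u' (Z x) * v' (Z x) * w (Z x) \<partial>P)"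
proof -
  have [measurable]: "v' \<in> borel_measurable MZ" using v by (rule version_measurable)
  show ?thesis
    unfolding ci_half[OF assms(1-7) v]
    using versionD[OF u, of "\<lambda>z. v' z * w z"] by (simp add: mult_ac)
qed

text \<open>The sets \<open>K n\<close> make \<open>P\<close> sigma-finite on the sigma-field
  generated by \<open>Z\<close>, which is what the existence of a conditional expectation requires;
  it is then factored through \<open>Z\<close>.\<close>

lemma version_exists:
  assumes [measurable]: "Z \<in> P \<rightarrow>\<^sub>M MZ" "\<phi> \<in> borel_measurable P"
    and le: "\<And>x. \<phi> x \<le> 1"
    and K: "\<And>n::nat. K n \<in> sets MZ" "(\<Union>n. K n) = space MZ"
      "\<And>n. emeasure P (Z -` K n \<inter> space P) < \<infinity>"
  shows "\<exists>f. version P MZ Z \<phi> f \<and> (\<forall>z. f z \<le> 1)"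
proof -
  define W where "W = vimage_algebra (space P) Z MZ"
  have ZW: "Z \<in> space P \<rightarrow> space MZ" using measurable_space[OF \<open>Z \<in> P \<rightarrow>\<^sub>M MZ\<close>] by auto
  have sub: "subalgebra P W"
    using measurable_sets[OF \<open>Z \<in> P \<rightarrow>\<^sub>M MZ\<close>]
    by (auto simp: subalgebra_def W_def sets_vimage_algebra2[OF ZW])
  have KW: "Z -` K n \<inter> space P \<in> sets W" for n
    using K(1) by (auto simp: W_def sets_vimage_algebra2[OF ZW])
  interpret sigma_finite_subalgebra P W
  proof (unfold_locales, rule sub)
    let ?A = "range (\<lambda>n. Z -` K n \<inter> space P)"
    have "\<Union>?A = space P" using ZW K(2)[symmetric] by fastforce
    then show "\<exists>A. countable A \<and> A \<subseteq> sets (restr_to_subalg P W) \<and> \<Union> A = space (restr_to_subalg P W) \<and>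
      (\<forall>a\<in>A. emeasure (restr_to_subalg P W) a \<noteq> \<infinity>)"
      using K(3)[THEN less_imp_neq] KW
      by (intro exI[of _ ?A])
        (auto simp: sets_restr_to_subalg[OF sub] space_restr_to_subalg emeasure_restr_to_subalg[OF sub])
  qed
  \<comment> \<open>Truncation changes the conditional expectation only on a null set and makes the
    bound by 1 hold everywhere.\<close>
  define e where "e x = min 1 (nn_cond_exp P W \<phi> x)" for x
  have "AE x in P. nn_cond_exp P W \<phi> x \<le> nn_cond_exp P W (\<lambda>_. 1) x"
    using le by (intro nn_cond_exp_mono) auto
  moreover have "AE x in P. nn_cond_exp P W (\<lambda>_. 1) x = 1"
    by (rule AE_symmetric, rule nn_cond_exp_F_meas) simp
  ultimately have ae: "AE x in P. nn_cond_exp P W \<phi> x = e x"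
    by eventually_elim (auto simp: e_def min_def)
  have "e \<in> borel_measurable W" unfolding e_def by measurable
  from factor_through[OF this[unfolded W_def] ZW]
  obtain g where g[measurable]: "g \<in> borel_measurable MZ" "\<And>x. x \<in> space P \<Longrightarrow> e x = g (Z x)" by blast
  have Zm: "Z \<in> W \<rightarrow>\<^sub>M MZ" unfolding W_def by (rule measurable_vimage_algebra1[OF ZW])
  show ?thesis
  proof (intro exI[of _ "\<lambda>z. min 1 (g z)"] conjI versionI allI)
    fix H assume [measurable]: "H \<in> sets MZ"
    have "(\<integral>\<^sup>+x. \<phi> x * indicator H (Z x) \<partial>P) = (\<integral>\<^sup>+x. indicator H (Z x) * \<phi> x \<partial>P)"
      by (simp add: mult.commute)
    also have "\<dots> = (\<integral>\<^sup>+x. indicator H (Z x) * nn_cond_exp P W \<phi> x \<partial>P)"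
      by (rule nn_cond_exp_intg[symmetric]) (use Zm in measurable)
    also have "\<dots> = (\<integral>\<^sup>+x. min 1 (g (Z x)) * indicator H (Z x) \<partial>P)"
    proof (rule nn_integral_cong_AE)
      show "AE x in P. indicator H (Z x) * nn_cond_exp P W \<phi> x = min 1 (g (Z x)) * indicator H (Z x)"
        using ae AE_space by eventually_elim (auto simp: g(2)[symmetric] e_def mult.commute)
    qed
    finally show "(\<integral>\<^sup>+x. \<phi> x * indicator H (Z x) \<partial>P) = (\<integral>\<^sup>+x. min 1 (g (Z x)) * indicator H (Z x) \<partial>P)" .
  qed auto
qed

lemma (in prob_space) version_exists_prob:
  assumes Z: "Z \<in> M \<rightarrow>\<^sub>M MZ" and "\<phi> \<in> borel_measurable M" and "\<And>x. \<phi> x \<le> 1"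
  shows "\<exists>f. version M MZ Z \<phi> f \<and> (\<forall>z. f z \<le> 1)"
  using assms by (intro version_exists[where K="\<lambda>_. space MZ"]) (auto simp: less_top[symmetric])

text \<open>The bridge between \<open>version\<close>, which is \<open>ennreal\<close>-valued, and
  the real conditional expectations in the definition of \<open>cond_indep_var\<close>. The bounds
  by 1 give integrability and make \<open>enn2real\<close> lossless.\<close>

lemma (in prob_space) real_cond_exp_version:
  assumes Z[measurable]: "Z \<in> M \<rightarrow>\<^sub>M MZ" and [measurable]: "\<phi> \<in> borel_measurable M"
    and bounds: "\<And>x. 0 \<le> \<phi> x" "\<And>x. \<phi> x \<le> 1" "\<And>z. f z \<le> 1"
    and v: "version M MZ Z (\<lambda>x. ennreal (\<phi> x)) f"
  shows "AE x in M. real_cond_exp M (vimage_algebra (space M) Z MZ) \<phi> x = enn2real (f (Z x))"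
proof -
  have [measurable]: "f \<in> borel_measurable MZ" using v by (rule version_measurable)
  define W where "W = vimage_algebra (space M) Z MZ"
  have ZW: "Z \<in> space M \<rightarrow> space MZ" using measurable_space[OF Z] by auto
  have Zm[measurable]: "Z \<in> W \<rightarrow>\<^sub>M MZ" unfolding W_def by (rule measurable_vimage_algebra1[OF ZW])
  have sub: "subalgebra M W"
    using measurable_sets[OF Z] by (auto simp: subalgebra_def W_def sets_vimage_algebra2[OF ZW])
  interpret W: finite_measure_subalgebra M W by unfold_locales (rule sub)
  have f1: "enn2real (f z) \<le> 1" for z using bounds(3)[of z] by (simp add: enn2real_leI)
  have fe: "ennreal (enn2real (f z)) = f z" for z
    using bounds(3)[of z] by (intro ennreal_enn2real) (auto simp: less_top[symmetric] top_unique)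
  have "AE x in M. real_cond_exp M W \<phi> x = enn2real (f (Z x))"
  proof (rule W.real_cond_exp_charact)
    fix A assume "A \<in> sets W"
    then obtain H where H[measurable]: "H \<in> sets MZ" and A: "A = Z -` H \<inter> space M"
      by (auto simp: W_def sets_vimage_algebra2[OF ZW])
    have [measurable]: "A \<in> sets M" unfolding A by measurable
    have "(\<integral>x\<in>A. \<phi> x \<partial>M) = enn2real (\<integral>\<^sup>+x. ennreal (indicator A x * \<phi> x) \<partial>M)"
      unfolding set_lebesgue_integral_def real_scaleR_def
      by (rule integral_eq_nn_integral) (use bounds in auto)
    also have "(\<integral>\<^sup>+x. ennreal (indicator A x * \<phi> x) \<partial>M) = (\<integral>\<^sup>+x. ennreal (\<phi> x) * indicator H (Z x) \<partial>M)"
      by (intro nn_integral_cong) (auto simp: A indicator_def)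
    also have "\<dots> = (\<integral>\<^sup>+x. f (Z x) * indicator H (Z x) \<partial>M)"
      by (rule versionD[OF v]) simp
    also have "\<dots> = (\<integral>\<^sup>+x. ennreal (indicator A x * enn2real (f (Z x))) \<partial>M)"
      by (intro nn_integral_cong) (auto simp: A indicator_def fe)
    also have "enn2real \<dots> = (\<integral>x\<in>A. enn2real (f (Z x)) \<partial>M)"
      unfolding set_lebesgue_integral_def real_scaleR_def
      by (rule integral_eq_nn_integral[symmetric]) auto
    finally show "(\<integral>x\<in>A. \<phi> x \<partial>M) = (\<integral>x\<in>A. enn2real (f (Z x)) \<partial>M)" .
  next
    show "integrable M \<phi>" by (rule integrable_const_bound[of _ 1]) (use bounds in auto)
    show "integrable M (\<lambda>x. enn2real (f (Z x)))"
      by (rule integrable_const_bound[of _ 1]) (use f1 in auto)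
  qed measurable
  then show ?thesis by (simp add: W_def)
qed

text \<open>From left to right, the version of the joint indicator is almost surely
  \<open>f * e\<close>, and \<open>e\<close> is turned back into the indicator of \<open>G\<close>
  by testing against \<open>f * w\<close>. From right to left, \<open>ci_product\<close> says that
  \<open>f * e\<close> is a version of the joint indicator.\<close>

lemma (in prob_space) cond_indep_var_iff_ci:
  assumes [measurable]: "X \<in> M \<rightarrow>\<^sub>M MX" "Y \<in> M \<rightarrow>\<^sub>M MY" "Z \<in> M \<rightarrow>\<^sub>M MZ"
  shows "cond_indep_var M MX X MY Y MZ Z \<longleftrightarrow> ci M MX X MY Y MZ Z"
proof
  assume L: "cond_indep_var M MX X MY Y MZ Z"
  let ?W = "vimage_algebra (space M) Z MZ"
  show "ci M MX X MY Y MZ Z"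
    unfolding ci_def
  proof
    fix F assume F[measurable]: "F \<in> sets MX"
    obtain f where f: "version M MZ Z (\<lambda>x. ennreal (indicator F (X x))) f" "\<And>z. f z \<le> 1"
      using version_exists_prob[of Z MZ "\<lambda>x. ennreal (indicator F (X x))"] by (auto simp: indicator_def)
    have [measurable]: "f \<in> borel_measurable MZ" using f(1) by (rule version_measurable)
    have ftop: "f z < top" for z using f(2)[of z] by (auto intro: le_less_trans)
    show "\<exists>f\<in>borel_measurable MZ. (\<forall>z. f z < top) \<and>
      (\<forall>G\<in>sets MY. \<forall>w\<in>borel_measurable MZ.
        (\<integral>\<^sup>+x. indicator F (X x) * indicator G (Y x) * w (Z x) \<partial>M) =
        (\<integral>\<^sup>+x. f (Z x) * indicator G (Y x) * w (Z x) \<partial>M))"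
    proof (intro bexI[of _ f] conjI allI ballI ftop)
      fix G and w :: "_ \<Rightarrow> ennreal" assume G[measurable]: "G \<in> sets MY" "w \<in> borel_measurable MZ"
      obtain e where e: "version M MZ Z (\<lambda>x. ennreal (indicator G (Y x))) e" "\<And>z. e z \<le> 1"
        using version_exists_prob[of Z MZ "\<lambda>x. ennreal (indicator G (Y x))"] by (auto simp: indicator_def)
      have le1: "ennreal (indicator F (X x) * indicator G (Y x)) \<le> 1" for x
        by (auto simp: indicator_def)
      obtain h where h: "version M MZ Z (\<lambda>x. ennreal (indicator F (X x) * indicator G (Y x))) h" "\<And>z. h z \<le> 1"
        using version_exists_prob[of Z MZ "\<lambda>x. ennreal (indicator F (X x) * indicator G (Y x))", OF _ _ le1]
        by (auto simp del: ennreal_le_1)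
      have [measurable]: "h \<in> borel_measurable MZ" "e \<in> borel_measurable MZ"
        using h(1) e(1) by (auto intro: version_measurable)
      have fin: "f z < top" "e z < top" "h z < top" for z
        using f(2)[of z] e(2)[of z] h(2)[of z] by (auto intro: le_less_trans)
      have *: "AE x in M. real_cond_exp M ?W (\<lambda>x. indicator F (X x) * indicator G (Y x)) x =
          real_cond_exp M ?W (\<lambda>x. indicator F (X x)) x * real_cond_exp M ?W (\<lambda>x. indicator G (Y x)) x"
        using L F G by (auto simp: cond_indep_var_def)
      have F': "AE x in M. real_cond_exp M ?W (\<lambda>x. indicator F (X x)) x = enn2real (f (Z x))"
        by (rule real_cond_exp_version[OF _ _ _ _ f(2) f(1)]) auto
      have G': "AE x in M. real_cond_exp M ?W (\<lambda>x. indicator G (Y x)) x = enn2real (e (Z x))"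
        by (rule real_cond_exp_version[OF _ _ _ _ e(2) e(1)]) auto
      have FG: "AE x in M. real_cond_exp M ?W (\<lambda>x. indicator F (X x) * indicator G (Y x)) x = enn2real (h (Z x))"
        by (rule real_cond_exp_version[OF _ _ _ _ h(2) h(1)]) (auto simp: indicator_def)
      have ae: "AE x in M. h (Z x) = f (Z x) * e (Z x)"
        using * F' G' FG
      proof eventually_elim
        case (elim x)
        then have "ennreal (enn2real (h (Z x))) = ennreal (enn2real (f (Z x))) * ennreal (enn2real (e (Z x)))"
          by (simp add: ennreal_mult)
        then show ?case using fin by simp
      qed
      have "(\<integral>\<^sup>+x. indicator F (X x) * indicator G (Y x) * w (Z x) \<partial>M) =
          (\<integral>\<^sup>+x. ennreal (indicator F (X x) * indicator G (Y x)) * w (Z x) \<partial>M)"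
        by (intro nn_integral_cong) (auto simp: indicator_def)
      also have "\<dots> = (\<integral>\<^sup>+x. h (Z x) * w (Z x) \<partial>M)" by (rule versionD[OF h(1)]) simp
      also have "\<dots> = (\<integral>\<^sup>+x. e (Z x) * (f (Z x) * w (Z x)) \<partial>M)"
        by (rule nn_integral_cong_AE) (use ae in \<open>eventually_elim, simp add: mult_ac\<close>)
      also have "\<dots> = (\<integral>\<^sup>+x. ennreal (indicator G (Y x)) * (f (Z x) * w (Z x)) \<partial>M)"
        by (rule versionD[OF e(1), of "\<lambda>z. f z * w z", symmetric]) simp
      also have "\<dots> = (\<integral>\<^sup>+x. f (Z x) * indicator G (Y x) * w (Z x) \<partial>M)"
        by (intro nn_integral_cong) (auto simp: indicator_def)
      finally show "(\<integral>\<^sup>+x. indicator F (X x) * indicator G (Y x) * w (Z x) \<partial>M) =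
        (\<integral>\<^sup>+x. f (Z x) * indicator G (Y x) * w (Z x) \<partial>M)" .
    qed simp
  qed
next
  assume R: "ci M MX X MY Y MZ Z"
  let ?W = "vimage_algebra (space M) Z MZ"
  have "AE x in M. real_cond_exp M ?W (\<lambda>x. indicator F (X x) * indicator G (Y x)) x =
          real_cond_exp M ?W (\<lambda>x. indicator F (X x)) x * real_cond_exp M ?W (\<lambda>x. indicator G (Y x)) x"
    if F[measurable]: "F \<in> sets MX" and G[measurable]: "G \<in> sets MY" for F G
  proof -
    obtain f where f: "version M MZ Z (\<lambda>x. ennreal (indicator F (X x))) f" "\<And>z. f z \<le> 1"
      using version_exists_prob[of Z MZ "\<lambda>x. ennreal (indicator F (X x))"] by (auto simp: indicator_def)
    obtain e where e: "version M MZ Z (\<lambda>x. ennreal (indicator G (Y x))) e" "\<And>z. e z \<le> 1"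
      using version_exists_prob[of Z MZ "\<lambda>x. ennreal (indicator G (Y x))"] by (auto simp: indicator_def)
    have [measurable]: "f \<in> borel_measurable MZ" "e \<in> borel_measurable MZ"
      using f(1) e(1) by (auto intro: version_measurable)
    have fe: "version M MZ Z (\<lambda>x. ennreal (indicator F (X x) * indicator G (Y x))) (\<lambda>z. f z * e z)"
    proof (rule versionI)
      fix H assume H[measurable]: "H \<in> sets MZ"
      have "(\<integral>\<^sup>+x. ennreal (indicator F (X x) * indicator G (Y x)) * indicator H (Z x) \<partial>M) =
        (\<integral>\<^sup>+x. ennreal (indicator F (X x)) * ennreal (indicator G (Y x)) * indicator H (Z x) \<partial>M)"
        by (intro nn_integral_cong) (auto simp: indicator_def)
      also have "\<dots> = (\<integral>\<^sup>+x. f (Z x) * e (Z x) * indicator H (Z x) \<partial>M)"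
        by (rule ci_product[OF R _ _ _ _ _ _ f(1) e(1)]) measurable
      finally show "(\<integral>\<^sup>+x. ennreal (indicator F (X x) * indicator G (Y x)) * indicator H (Z x) \<partial>M) =
        (\<integral>\<^sup>+x. f (Z x) * e (Z x) * indicator H (Z x) \<partial>M)" .
    qed measurable
    have le: "f z * e z \<le> 1" for z using mult_mono[OF f(2)[of z] e(2)[of z]] by simp
    have F': "AE x in M. real_cond_exp M ?W (\<lambda>x. indicator F (X x)) x = enn2real (f (Z x))"
      by (rule real_cond_exp_version[OF _ _ _ _ f(2) f(1)]) auto
    have G': "AE x in M. real_cond_exp M ?W (\<lambda>x. indicator G (Y x)) x = enn2real (e (Z x))"
      by (rule real_cond_exp_version[OF _ _ _ _ e(2) e(1)]) auto
    have FG: "AE x in M. real_cond_exp M ?W (\<lambda>x. indicator F (X x) * indicator G (Y x)) x = enn2real (f (Z x) * e (Z x))"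
      by (rule real_cond_exp_version[OF _ _ _ _ le fe]) (auto simp: indicator_def)
    show ?thesis using F' G' FG by eventually_elim (simp add: enn2real_mult)
  qed
  then show "cond_indep_var M MX X MY Y MZ Z"
    by (simp add: cond_indep_var_def)
qed

lemma (in prob_space) indep_var_iff_prod:
  assumes [measurable]: "X \<in> M \<rightarrow>\<^sub>M MX" "Y \<in> M \<rightarrow>\<^sub>M MY"
  shows "indep_var MX X MY Y \<longleftrightarrow> (\<forall>F\<in>sets MX. \<forall>G\<in>sets MY.
    (\<integral>\<^sup>+x. indicator F (X x) * indicator G (Y x) \<partial>M) =
    (\<integral>\<^sup>+x. indicator F (X x) \<partial>M) * (\<integral>\<^sup>+x. indicator G (Y x) \<partial>M))" (is "_ \<longleftrightarrow> ?R")
proof -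
  interpret X: prob_space "distr M MX X" by (rule prob_space_distr) simp
  interpret Y: prob_space "distr M MY Y" by (rule prob_space_distr) simp
  let ?D = "distr M (MX \<Otimes>\<^sub>M MY) (\<lambda>x. (X x, Y x))"
  have 1: "emeasure ?D (F \<times> G) = (\<integral>\<^sup>+x. indicator F (X x) * indicator G (Y x) \<partial>M)"
    if [measurable]: "F \<in> sets MX" "G \<in> sets MY" for F G
  proof -
    have "emeasure ?D (F \<times> G) = (\<integral>\<^sup>+x. indicator (F \<times> G) x \<partial>?D)" by simp
    also have "\<dots> = (\<integral>\<^sup>+x. indicator (F \<times> G) (X x, Y x) \<partial>M)" by (subst nn_integral_distr) auto
    finally show ?thesis by (simp add: indicator_times)
  qed
  have 2: "emeasure (distr M N f) F = (\<integral>\<^sup>+x. indicator F (f x) \<partial>M)"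
    if [measurable]: "F \<in> sets N" "f \<in> M \<rightarrow>\<^sub>M N" for N :: "'z measure" and f F
  proof -
    have "emeasure (distr M N f) F = (\<integral>\<^sup>+x. indicator F x \<partial>distr M N f)" by simp
    also have "\<dots> = (\<integral>\<^sup>+x. indicator F (f x) \<partial>M)" by (subst nn_integral_distr) auto
    finally show ?thesis .
  qed
  show ?thesis
  proof
    assume "indep_var MX X MY Y"
    then have eq: "distr M MX X \<Otimes>\<^sub>M distr M MY Y = ?D" by (simp add: indep_var_distribution_eq)
    have *: "emeasure (distr M MX X \<Otimes>\<^sub>M distr M MY Y) (F \<times> G) = emeasure (distr M MX X) F * emeasure (distr M MY Y) G"
      if "F \<in> sets MX" "G \<in> sets MY" for F G
      using that by (intro Y.emeasure_pair_measure_Times) auto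
    show ?R
    proof (intro ballI)
      fix F G assume "F \<in> sets MX" "G \<in> sets MY"
      from *[OF this] 1[OF this] 2[OF this(1), of X] 2[OF this(2), of Y]
      show "(\<integral>\<^sup>+x. indicator F (X x) * indicator G (Y x) \<partial>M) =
        (\<integral>\<^sup>+x. indicator F (X x) \<partial>M) * (\<integral>\<^sup>+x. indicator G (Y x) \<partial>M)"
        by (simp add: eq)
    qed
  next
    assume R: ?R
    have "distr M MX X \<Otimes>\<^sub>M distr M MY Y = ?D"
    proof (rule pair_measure_eqI)
      fix F G assume "F \<in> sets (distr M MX X)" "G \<in> sets (distr M MY Y)"
      then have "F \<in> sets MX" "G \<in> sets MY" by auto
      with 1[OF this] 2[OF this(1), of X] 2[OF this(2), of Y] R
      show "emeasure (distr M MX X) F * emeasure (distr M MY Y) G = emeasure ?D (F \<times> G)" by simp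
    qed (auto simp: X.sigma_finite_measure_axioms Y.sigma_finite_measure_axioms cong: sets_pair_measure_cong)
    then show "indep_var MX X MY Y" by (simp add: indep_var_distribution_eq)
  qed
qed

lemma (in prob_space) indep_var_iff_ci:
  assumes [measurable]: "X \<in> M \<rightarrow>\<^sub>M MX" "Y \<in> M \<rightarrow>\<^sub>M MY" "Z \<in> M \<rightarrow>\<^sub>M MZ"
    and triv: "\<And>H. H \<in> sets MZ \<Longrightarrow> (AE x in M. Z x \<in> H) \<or> (AE x in M. Z x \<notin> H)"
  shows "indep_var MX X MY Y \<longleftrightarrow> ci M MX X MY Y MZ Z"
proof -
  have const: "version M MZ Z \<phi> (\<lambda>_. \<integral>\<^sup>+x. \<phi> x \<partial>M)" if [measurable]: "\<phi> \<in> borel_measurable M" for \<phi>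
  proof (rule versionI)
    fix H assume H: "H \<in> sets MZ"
    from triv[OF this] show "(\<integral>\<^sup>+x. \<phi> x * indicator H (Z x) \<partial>M) =
      (\<integral>\<^sup>+x. (\<integral>\<^sup>+x. \<phi> x \<partial>M) * indicator H (Z x) \<partial>M)"
    proof
      assume ae: "AE x in M. Z x \<in> H"
      have "(\<integral>\<^sup>+x. \<phi> x * indicator H (Z x) \<partial>M) = (\<integral>\<^sup>+x. \<phi> x \<partial>M)"
        by (rule nn_integral_cong_AE) (use ae in \<open>eventually_elim, simp\<close>)
      moreover have "(\<integral>\<^sup>+x. (\<integral>\<^sup>+x. \<phi> x \<partial>M) * indicator H (Z x) \<partial>M) = (\<integral>\<^sup>+x. (\<integral>\<^sup>+x. \<phi> x \<partial>M) \<partial>M)"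
        by (rule nn_integral_cong_AE) (use ae in \<open>eventually_elim, simp\<close>)
      ultimately show ?thesis by (simp add: emeasure_space_1)
    next
      assume ae: "AE x in M. Z x \<notin> H"
      have "(\<integral>\<^sup>+x. \<psi> x * indicator H (Z x) \<partial>M) = (\<integral>\<^sup>+x. 0 \<partial>M)" for \<psi>
        by (rule nn_integral_cong_AE) (use ae in \<open>eventually_elim, simp\<close>)
      then show ?thesis by simp
    qed
  qed measurable
  show ?thesis
  proof
    assume "indep_var MX X MY Y"
    then have R: "(\<integral>\<^sup>+x. indicator F (X x) * indicator G (Y x) \<partial>M) =
        (\<integral>\<^sup>+x. indicator F (X x) \<partial>M) * (\<integral>\<^sup>+x. indicator G (Y x) \<partial>M)"
      if "F \<in> sets MX" "G \<in> sets MY" for F G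
      using that by (simp add: indep_var_iff_prod)
    show "ci M MX X MY Y MZ Z"
      unfolding ci_def
    proof
      fix F assume F[measurable]: "F \<in> sets MX"
      let ?p = "\<integral>\<^sup>+x. indicator F (X x) \<partial>M"
      have "?p \<le> (\<integral>\<^sup>+x. 1 \<partial>M)" by (rule nn_integral_mono) (auto simp: indicator_def)
      then have "?p < top" by (simp add: emeasure_space_1 order_le_less_trans[OF _ ennreal_one_less_top])
      moreover have "(\<integral>\<^sup>+x. indicator F (X x) * indicator G (Y x) * w (Z x) \<partial>M) =
          (\<integral>\<^sup>+x. ?p * indicator G (Y x) * w (Z x) \<partial>M)"
        if G[measurable]: "G \<in> sets MY" "w \<in> borel_measurable MZ" for G w
      proof -
        have "(\<integral>\<^sup>+x. indicator F (X x) * indicator G (Y x) * w (Z x) \<partial>M) =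
            (\<integral>\<^sup>+x. (\<integral>\<^sup>+x. indicator F (X x) * indicator G (Y x) \<partial>M) * w (Z x) \<partial>M)"
          by (rule versionD[OF const]) measurable
        also have "\<dots> = ?p * (\<integral>\<^sup>+x. (\<integral>\<^sup>+x. indicator G (Y x) \<partial>M) * w (Z x) \<partial>M)"
          by (simp add: R[OF F G(1)] mult.assoc nn_integral_cmult)
        also have "(\<integral>\<^sup>+x. (\<integral>\<^sup>+x. indicator G (Y x) \<partial>M) * w (Z x) \<partial>M) = (\<integral>\<^sup>+x. indicator G (Y x) * w (Z x) \<partial>M)"
          by (rule versionD[OF const, symmetric]) measurable
        finally show ?thesis by (simp add: mult.assoc nn_integral_cmult)
      qed
      ultimately show "\<exists>f\<in>borel_measurable MZ. (\<forall>z. f z < (top::ennreal)) \<and>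
        (\<forall>G\<in>sets MY. \<forall>w\<in>borel_measurable MZ.
        (\<integral>\<^sup>+x. indicator F (X x) * indicator G (Y x) * w (Z x) \<partial>M) =
        (\<integral>\<^sup>+x. f (Z x) * indicator G (Y x) * w (Z x) \<partial>M))"
        by (intro bexI[of _ "\<lambda>_. ?p"]) auto
    qed
  next
    assume ci: "ci M MX X MY Y MZ Z"
    have "(\<integral>\<^sup>+x. indicator F (X x) * indicator G (Y x) \<partial>M) =
        (\<integral>\<^sup>+x. indicator F (X x) \<partial>M) * (\<integral>\<^sup>+x. indicator G (Y x) \<partial>M)"
      if [measurable]: "F \<in> sets MX" "G \<in> sets MY" for F G
      using ci_product[OF ci _ _ _ _ _ _ const const, of "indicator F" "indicator G" "\<lambda>_. 1"]
      by (simp add: emeasure_space_1)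
    then show "indep_var MX X MY Y" by (simp add: indep_var_iff_prod)
  qed
qed

text \<open>Both sides of the defining identity carry the same factor. This passes between the
  normalized conditional laws and restrictions of \<Lambda>.\<close>

lemma ci_scale:
  assumes [measurable]: "X \<in> P \<rightarrow>\<^sub>M MX" "Y \<in> P \<rightarrow>\<^sub>M MY" "Z \<in> P \<rightarrow>\<^sub>M MZ"
    and eq: "\<And>g. g \<in> borel_measurable P \<Longrightarrow> (\<integral>\<^sup>+x. g x \<partial>Q) = c * (\<integral>\<^sup>+x. g x \<partial>P)"
    and ci: "ci P MX X MY Y MZ Z"
  shows "ci Q MX X MY Y MZ Z"
  unfolding ci_def
proof
  fix F assume F[measurable]: "F \<in> sets MX"
  from ci F obtain f where f[measurable]: "f \<in> borel_measurable MZ" "\<And>z. f z < top" and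
    eq': "\<And>G w. G \<in> sets MY \<Longrightarrow> w \<in> borel_measurable MZ \<Longrightarrow>
        (\<integral>\<^sup>+x. indicator F (X x) * indicator G (Y x) * w (Z x) \<partial>P) =
        (\<integral>\<^sup>+x. f (Z x) * indicator G (Y x) * w (Z x) \<partial>P)"
    unfolding ci_def by blast
  show "\<exists>f\<in>borel_measurable MZ. (\<forall>z. f z < (top::ennreal)) \<and>
      (\<forall>G\<in>sets MY. \<forall>w\<in>borel_measurable MZ.
        (\<integral>\<^sup>+x. indicator F (X x) * indicator G (Y x) * w (Z x) \<partial>Q) =
        (\<integral>\<^sup>+x. f (Z x) * indicator G (Y x) * w (Z x) \<partial>Q))"
  proof (intro bexI[of _ f] conjI allI ballI f)
    fix G and w :: "_ \<Rightarrow> ennreal" assume [measurable]: "G \<in> sets MY" "w \<in> borel_measurable MZ"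
    show "(\<integral>\<^sup>+x. indicator F (X x) * indicator G (Y x) * w (Z x) \<partial>Q) =
        (\<integral>\<^sup>+x. f (Z x) * indicator G (Y x) * w (Z x) \<partial>Q)"
      by (simp add: eq eq')
  qed
qed

text \<open>Bayes' formula: inside \<open>FA\<close> the conditional probability of \<open>F\<close>
  is \<open>f / e\<close>, where \<open>f\<close> belongs to \<open>F \<inter> FA\<close> and
  \<open>e\<close> to \<open>FA\<close>. The restrictions on \<open>Y\<close> and \<open>Z\<close>
  are simply absorbed into the test set \<open>G\<close> and the weight \<open>w\<close>.\<close>

lemma ci_restrict:
  assumes [measurable]: "X \<in> P \<rightarrow>\<^sub>M MX" "Y \<in> P \<rightarrow>\<^sub>M MY" "Z \<in> P \<rightarrow>\<^sub>M MZ"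
    "FA \<in> sets MX" "GB \<in> sets MY" "HC \<in> sets MZ"
    and ci: "ci P MX X MY Y MZ Z"
  shows "ci (density P (\<lambda>x. indicator FA (X x) * indicator GB (Y x) * indicator HC (Z x))) MX X MY Y MZ Z"
    (is "ci ?Q _ _ _ _ _ _")
  unfolding ci_def
proof
  have ciE: "\<exists>f\<in>borel_measurable MZ. (\<forall>z. f z < top) \<and> (\<forall>G w. G \<in> sets MY \<longrightarrow> w \<in> borel_measurable MZ \<longrightarrow>
        (\<integral>\<^sup>+x. indicator F (X x) * indicator G (Y x) * w (Z x) \<partial>P) =
        (\<integral>\<^sup>+x. f (Z x) * indicator G (Y x) * w (Z x) \<partial>P))" if "F \<in> sets MX" for F
    using ci that unfolding ci_def by blast
  fix F assume F[measurable]: "F \<in> sets MX"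
  from ciE[of "F \<inter> FA"] obtain f where f[measurable]: "f \<in> borel_measurable MZ" "\<And>z. f z < top" and
    eqf: "\<And>G w. G \<in> sets MY \<Longrightarrow> w \<in> borel_measurable MZ \<Longrightarrow>
        (\<integral>\<^sup>+x. indicator (F \<inter> FA) (X x) * indicator G (Y x) * w (Z x) \<partial>P) =
        (\<integral>\<^sup>+x. f (Z x) * indicator G (Y x) * w (Z x) \<partial>P)"
    by auto
  from ciE[of FA] obtain e where e[measurable]: "e \<in> borel_measurable MZ" "\<And>z. e z < top" and
    eqe: "\<And>G w. G \<in> sets MY \<Longrightarrow> w \<in> borel_measurable MZ \<Longrightarrow>
        (\<integral>\<^sup>+x. indicator FA (X x) * indicator G (Y x) * w (Z x) \<partial>P) =
        (\<integral>\<^sup>+x. e (Z x) * indicator G (Y x) * w (Z x) \<partial>P)"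
    by auto
  define q where "q z = (if e z = 0 then 0 else f z / e z)" for z
  have [measurable]: "q \<in> borel_measurable MZ" unfolding q_def by measurable
  have Ysp: "Y x \<in> space MY" if "x \<in> space P" for x using that by (rule measurable_space[rotated]) simp
  \<comment> \<open>This comparison holds only under the integral. Without sigma-finiteness it does
    not yield \<open>f \<le> e\<close> almost everywhere (on an atom of infinite mass all positive
    constants look alike), so \<open>q\<close> is kept finite but need not be bounded by 1.\<close>
  have "(\<integral>\<^sup>+x. f (Z x) * w (Z x) \<partial>P) \<le> (\<integral>\<^sup>+x. e (Z x) * w (Z x) \<partial>P)"
    if [measurable]: "w \<in> borel_measurable MZ" for w
  proof -
    have "(\<integral>\<^sup>+x. f (Z x) * w (Z x) \<partial>P) = (\<integral>\<^sup>+x. indicator (F \<inter> FA) (X x) * w (Z x) \<partial>P)"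
      using eqf[OF sets.top that] Ysp by (simp cong: nn_integral_cong)
    also have "\<dots> \<le> (\<integral>\<^sup>+x. indicator FA (X x) * w (Z x) \<partial>P)"
      by (rule nn_integral_mono) (auto simp: indicator_def)
    also have "\<dots> = (\<integral>\<^sup>+x. e (Z x) * w (Z x) \<partial>P)"
      using eqe[OF sets.top that] Ysp by (simp cong: nn_integral_cong)
    finally show ?thesis .
  qed
  note le = this
  show "\<exists>q\<in>borel_measurable MZ. (\<forall>z. q z < (top::ennreal)) \<and>
      (\<forall>G\<in>sets MY. \<forall>w\<in>borel_measurable MZ.
        (\<integral>\<^sup>+x. indicator F (X x) * indicator G (Y x) * w (Z x) \<partial>?Q) =
        (\<integral>\<^sup>+x. q (Z x) * indicator G (Y x) * w (Z x) \<partial>?Q))"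
  proof (intro bexI[of _ q] conjI allI ballI)
    fix G and w :: "_ \<Rightarrow> ennreal" assume [measurable]: "G \<in> sets MY" "w \<in> borel_measurable MZ"
    have "(\<integral>\<^sup>+x. indicator F (X x) * indicator G (Y x) * w (Z x) \<partial>?Q) =
      (\<integral>\<^sup>+x. indicator (F \<inter> FA) (X x) * indicator (G \<inter> GB) (Y x) * (w (Z x) * indicator HC (Z x)) \<partial>P)"
      by (subst nn_integral_density) (auto intro!: nn_integral_cong simp: indicator_def)
    also have "\<dots> = (\<integral>\<^sup>+x. f (Z x) * indicator (G \<inter> GB) (Y x) * (w (Z x) * indicator HC (Z x)) \<partial>P)"
      by (rule eqf[where w="\<lambda>z. w z * indicator HC z"]) measurable
    also have "\<dots> = (\<integral>\<^sup>+x. (e (Z x) * q (Z x)) * indicator (G \<inter> GB) (Y x) * (w (Z x) * indicator HC (Z x)) \<partial>P)"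
    proof (rule nn_integral_cong_AE)
      \<comment> \<open>Where \<open>e\<close> vanishes the comparison does give
        \<open>f = 0\<close> almost everywhere, and this is all that \<open>f = e * q\<close> needs;
        elsewhere \<open>e\<close> is positive and finite and the quotient is exact.\<close>
      have "(\<integral>\<^sup>+x. f (Z x) * indicator {z\<in>space MZ. e z = 0} (Z x) \<partial>P) \<le>
          (\<integral>\<^sup>+x. e (Z x) * indicator {z\<in>space MZ. e z = 0} (Z x) \<partial>P)"
        by (rule le) measurable
      also have "\<dots> = (\<integral>\<^sup>+x. 0 \<partial>P)"
        by (rule nn_integral_cong) (auto simp: indicator_def)
      finally have "AE x in P. f (Z x) * indicator {z\<in>space MZ. e z = 0} (Z x) = 0"
        by (simp add: nn_integral_0_iff_AE)
      then have ae: "AE x in P. f (Z x) = e (Z x) * q (Z x)"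
        using AE_space
      proof eventually_elim
        case (elim x)
        have "Z x \<in> space MZ" using elim(2) by (rule measurable_space[rotated]) simp
        with elim(1) show ?case
          using e(2)[of "Z x"]
          by (auto simp: q_def ennreal_times_divide ennreal_mult_divide_eq mult.commute[of "e (Z x)"]
            ennreal_divide_times indicator_def less_top[symmetric])
      qed
      show "AE x in P. f (Z x) * indicator (G \<inter> GB) (Y x) * (w (Z x) * indicator HC (Z x)) =
        e (Z x) * q (Z x) * indicator (G \<inter> GB) (Y x) * (w (Z x) * indicator HC (Z x))"
        using ae by eventually_elim simp
    qed
    also have "\<dots> = (\<integral>\<^sup>+x. e (Z x) * indicator (G \<inter> GB) (Y x) * (q (Z x) * w (Z x) * indicator HC (Z x)) \<partial>P)"
      by (simp add: mult_ac)
    also have "\<dots> = (\<integral>\<^sup>+x. indicator FA (X x) * indicator (G \<inter> GB) (Y x) * (q (Z x) * w (Z x) * indicator HC (Z x)) \<partial>P)"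
      by (rule eqe[where w="\<lambda>z. q z * w z * indicator HC z", symmetric]) measurable
    also have "\<dots> = (\<integral>\<^sup>+x. q (Z x) * indicator G (Y x) * w (Z x) \<partial>?Q)"
      by (subst nn_integral_density) (auto intro!: nn_integral_cong simp: indicator_def)
    finally show "(\<integral>\<^sup>+x. indicator F (X x) * indicator G (Y x) * w (Z x) \<partial>?Q) =
      (\<integral>\<^sup>+x. q (Z x) * indicator G (Y x) * w (Z x) \<partial>?Q)" .
  qed (auto simp: q_def f ennreal_divide_eq_top_iff less_top[symmetric] f(2)[THEN less_imp_neq])
qed

text \<open>The witnesses are functions of \<open>z\<close>, so witnesses on disjoint sets of values
  of \<open>Z\<close> can be pasted into one, and both integrals are sums over the pieces.\<close>

lemma ci_glue:
  assumes [measurable]: "X \<in> P \<rightarrow>\<^sub>M MX" "Y \<in> P \<rightarrow>\<^sub>M MY" "Z \<in> P \<rightarrow>\<^sub>M MZ"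
    and D[measurable]: "\<And>n::nat. D n \<in> sets MZ" and disj: "disjoint_family D"
    and cover: "AE x in P. Z x \<in> (\<Union>n. D n)"
    and ci: "\<And>n. ci (density P (\<lambda>x. indicator (D n) (Z x))) MX X MY Y MZ Z"
  shows "ci P MX X MY Y MZ Z"
  unfolding ci_def
proof
  fix F assume F[measurable]: "F \<in> sets MX"
  have "\<forall>n. \<exists>f. f \<in> borel_measurable MZ \<and> (\<forall>z. f z < (top::ennreal)) \<and>
      (\<forall>G\<in>sets MY. \<forall>w\<in>borel_measurable MZ.
        (\<integral>\<^sup>+x. indicator F (X x) * indicator G (Y x) * w (Z x) \<partial>density P (\<lambda>x. indicator (D n) (Z x))) =
        (\<integral>\<^sup>+x. f (Z x) * indicator G (Y x) * w (Z x) \<partial>density P (\<lambda>x. indicator (D n) (Z x))))"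
    using ci F unfolding ci_def by blast
  from choice[OF this] obtain f where "\<forall>n. f n \<in> borel_measurable MZ \<and> (\<forall>z. f n z < (top::ennreal)) \<and>
      (\<forall>G\<in>sets MY. \<forall>w\<in>borel_measurable MZ.
        (\<integral>\<^sup>+x. indicator F (X x) * indicator G (Y x) * w (Z x) \<partial>density P (\<lambda>x. indicator (D n) (Z x))) =
        (\<integral>\<^sup>+x. f n (Z x) * indicator G (Y x) * w (Z x) \<partial>density P (\<lambda>x. indicator (D n) (Z x))))" ..
  then have f[measurable]: "\<And>n. f n \<in> borel_measurable MZ" "\<And>n z. f n z < top" and
    eqf: "\<And>n G w. G \<in> sets MY \<Longrightarrow> w \<in> borel_measurable MZ \<Longrightarrow>
        (\<integral>\<^sup>+x. indicator F (X x) * indicator G (Y x) * w (Z x) \<partial>density P (\<lambda>x. indicator (D n) (Z x))) =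
        (\<integral>\<^sup>+x. f n (Z x) * indicator G (Y x) * w (Z x) \<partial>density P (\<lambda>x. indicator (D n) (Z x)))"
    by blast+
  define g where "g z = (\<Sum>n. f n z * indicator (D n) z)" for z
  have [measurable]: "g \<in> borel_measurable MZ" unfolding g_def by measurable
  have gn: "g z = f n z" if "z \<in> D n" for z n
  proof -
    have "f m z * indicator (D m) z = 0" if "m \<noteq> n" for m
      using disj \<open>z \<in> D n\<close> that by (auto simp: disjoint_family_on_def indicator_def)
    then have "g z = (\<Sum>m\<in>{n}. f m z * indicator (D m) z)"
      unfolding g_def by (intro suminf_finite) auto
    with that show ?thesis by simp
  qed
  have g0: "g z = 0" if "z \<notin> (\<Union>n. D n)" for z
    using that by (simp add: g_def)
  have split: "(\<integral>\<^sup>+x. \<phi> x \<partial>P) = (\<Sum>n. \<integral>\<^sup>+x. \<phi> x \<partial>density P (\<lambda>x. indicator (D n) (Z x)))"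
    if [measurable]: "\<phi> \<in> borel_measurable P" for \<phi>
  proof -
    have one: "(\<Sum>n. indicator (D n) z :: ennreal) = 1" if "z \<in> (\<Union>n. D n)" for z
    proof -
      from that obtain n where n: "z \<in> D n" by auto
      have "(indicator (D m) z :: ennreal) = 0" if "m \<noteq> n" for m
        using disj n that by (auto simp: disjoint_family_on_def indicator_def)
      then have "(\<Sum>n. indicator (D n) z :: ennreal) = (\<Sum>m\<in>{n}. indicator (D m) z)"
        by (intro suminf_finite) auto
      with n show ?thesis by simp
    qed
    have "(\<integral>\<^sup>+x. \<phi> x \<partial>P) = (\<integral>\<^sup>+x. (\<Sum>n. indicator (D n) (Z x) * \<phi> x) \<partial>P)"
      by (rule nn_integral_cong_AE) (use cover in \<open>eventually_elim, simp add: ennreal_suminf_multc one\<close>)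
    also have "\<dots> = (\<Sum>n. \<integral>\<^sup>+x. indicator (D n) (Z x) * \<phi> x \<partial>P)"
      by (rule nn_integral_suminf) measurable
    finally show ?thesis by (simp add: nn_integral_density)
  qed
  show "\<exists>f\<in>borel_measurable MZ. (\<forall>z. f z < (top::ennreal)) \<and>
      (\<forall>G\<in>sets MY. \<forall>w\<in>borel_measurable MZ.
        (\<integral>\<^sup>+x. indicator F (X x) * indicator G (Y x) * w (Z x) \<partial>P) =
        (\<integral>\<^sup>+x. f (Z x) * indicator G (Y x) * w (Z x) \<partial>P))"
  proof (intro bexI[of _ g] conjI allI ballI)
    show "g z < top" for z using gn[of z] g0[of z] f(2)[of _ z] by (cases "z \<in> (\<Union>n. D n)") auto
    fix G and w :: "_ \<Rightarrow> ennreal" assume [measurable]: "G \<in> sets MY" "w \<in> borel_measurable MZ"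
    have "(\<integral>\<^sup>+x. g (Z x) * indicator G (Y x) * w (Z x) \<partial>density P (\<lambda>x. indicator (D n) (Z x))) =
        (\<integral>\<^sup>+x. f n (Z x) * indicator G (Y x) * w (Z x) \<partial>density P (\<lambda>x. indicator (D n) (Z x)))" for n
      by (auto simp: nn_integral_density indicator_def gn intro!: nn_integral_cong)
    then show "(\<integral>\<^sup>+x. indicator F (X x) * indicator G (Y x) * w (Z x) \<partial>P) =
        (\<integral>\<^sup>+x. g (Z x) * indicator G (Y x) * w (Z x) \<partial>P)"
      by (simp add: split eqf)
  qed measurable
qed

subsection \<open>Laplace functionals of point measures\<close>

text \<open>The function exp(-x) on \<open>[0, \<infinity>]\<close>, with value 0 at \<infinity>, so
  that Laplace functionals exist for all nonnegative test functions.\<close>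

definition nexp :: "ennreal \<Rightarrow> ennreal" where
  "nexp x = (if x = top then 0 else ennreal (exp (- enn2real x)))"

text \<open>The inverse of \<open>nexp\<close> on the unit interval, with \<infinity> assigned to 0.
  Thus every function with values in the unit interval is \<open>nexp\<close> of a test function,
  even where it vanishes.\<close>

definition nlog :: "ennreal \<Rightarrow> ennreal" where
  "nlog c = (if c = 0 then top else ennreal (- ln (enn2real c)))"

lemma nexp_measurable[measurable]: "nexp \<in> borel_measurable borel"
  unfolding nexp_def by measurable

lemma nlog_measurable[measurable]: "nlog \<in> borel_measurable borel"
  unfolding nlog_def by measurable

lemma nexp_0[simp]: "nexp 0 = 1" and nexp_top[simp]: "nexp top = 0"
  by (auto simp: nexp_def)

lemma nexp_ennreal: "0 \<le> x \<Longrightarrow> nexp (ennreal x) = ennreal (exp (- x))"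
  by (simp add: nexp_def)

lemma nexp_le_1[simp]: "nexp x \<le> 1"
  by (simp add: nexp_def ennreal_le_1)

lemma nexp_less_top[simp]: "nexp x < top"
  by (simp add: nexp_def)

lemma nexp_add: "nexp (x + y) = nexp x * nexp y"
  by (cases x; cases y) (auto simp: nexp_ennreal ennreal_mult[symmetric] exp_add[symmetric] add.commute simp flip: ennreal_plus)

lemma nexp_sum: "finite I \<Longrightarrow> nexp (\<Sum>i\<in>I. f i) = (\<Prod>i\<in>I. nexp (f i))"
  by (induction I rule: finite_induct) (auto simp: nexp_add)

lemma nexp_of_nat_mult: "nexp (t * of_nat k) = nexp t ^ k"
  by (induction k) (auto simp: nexp_add distrib_left)

lemma nexp_inject: "nexp x = nexp y \<longleftrightarrow> x = y"
  by (cases x; cases y) (auto simp: nexp_ennreal)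

text \<open>An order-reversing Galois connection. Antitonicity and the exchange of
  \<open>SUP\<close> and \<open>INF\<close> follow from it by order theory alone.\<close>

lemma le_nexp_iff: assumes "c \<le> 1" shows "c \<le> nexp x \<longleftrightarrow> x \<le> nlog c"
proof (cases "c = 0 \<or> x = top")
  case True
  then show ?thesis using assms by (auto simp: nlog_def top_unique)
next
  case False
  then obtain r s where r: "c = ennreal r" "0 < r" "r \<le> 1" and s: "x = ennreal s" "0 \<le> s"
    using assms by (cases c; cases x) (auto simp: top_unique order_less_le)
  have "r \<le> exp (- s) \<longleftrightarrow> s \<le> - ln r"
    using r by (metis exp_ln exp_le_cancel_iff minus_le_iff minus_minus neg_le_iff_le)
  then show ?thesis using r s by (auto simp: nexp_ennreal nlog_def ennreal_le_iff2)
qed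

lemma nexp_nlog: "c \<le> 1 \<Longrightarrow> nexp (nlog c) = c"
  by (cases c) (auto simp: nlog_def nexp_def top_unique)

lemma nexp_antimono: "x \<le> y \<Longrightarrow> nexp y \<le> nexp x"
  by (metis le_nexp_iff nexp_le_1 order.refl order_trans)

lemma nexp_SUP: "I \<noteq> {} \<Longrightarrow> nexp (SUP i\<in>I. x i) = (INF i\<in>I. nexp (x i))"
proof (rule antisym)
  assume I: "I \<noteq> {}"
  let ?c = "INF i\<in>I. nexp (x i)"
  have c: "?c \<le> 1" using I by (meson INF_lower2 ex_in_conv nexp_le_1)
  have "x i \<le> nlog ?c" if "i \<in> I" for i
    using that by (subst le_nexp_iff[OF c, symmetric]) (rule INF_lower)
  then show "?c \<le> nexp (SUP i\<in>I. x i)"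
    by (subst le_nexp_iff[OF c]) (rule SUP_least)
qed (auto intro!: INF_greatest nexp_antimono SUP_upper)

text \<open>Strong induction: once the coefficients below \<open>k\<close> vanish, the series may be
  divided by \<open>s ^ k\<close>, and its limit at 0 is \<open>d k\<close>.\<close>

lemma power_series_unique:
  fixes d :: "nat \<Rightarrow> real"
  assumes bound: "\<And>k. \<bar>d k\<bar> \<le> C"
    and zero: "\<And>s. 0 < s \<Longrightarrow> s < 1 \<Longrightarrow> (\<Sum>k. d k * s ^ k) = 0"
  shows "d k = 0"
proof (induction k rule: less_induct)
  case (less k)
  define e where "e j = d (j + k)" for j
  have summ: "summable (\<lambda>j. d (j + i) * x ^ j)" if "norm x < 1" for x i
  proof (rule summable_comparison_test')
    show "summable (\<lambda>j. C * norm x ^ j)" using that by (intro summable_mult summable_geometric) auto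
    show "norm (d (j + i) * x ^ j) \<le> C * norm x ^ j" if "j \<ge> 0" for j
      using bound[of "j + i"] by (auto simp: abs_mult power_abs intro!: mult_right_mono)
  qed
  have "((\<lambda>x. \<Sum>j. e j * x ^ j) \<longlongrightarrow> e 0) (at 0)"
    by (rule powser_limit_0[of 1]) (use summ in \<open>auto simp: e_def intro!: summable_sums\<close>)
  \<comment> \<open>Only positive arguments are covered by the hypothesis, hence the one-sided
    limit.\<close>
  then have 1: "((\<lambda>x. \<Sum>j. e j * x ^ j) \<longlongrightarrow> e 0) (at_right 0)"
    by (rule tendsto_mono[rotated]) (simp add: at_within_le_at)
  have "(\<Sum>j. e j * x ^ j) = 0" if x: "0 < x" "x < 1" for x
  proof -
    have "(\<Sum>j. d j * x ^ j) = (\<Sum>j. d (j + k) * x ^ (j + k)) + (\<Sum>j<k. d j * x ^ j)"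
      by (rule suminf_split_initial_segment) (use summ[of x 0] x in simp)
    also have "(\<Sum>j<k. d j * x ^ j) = 0" using less by simp
    also have "(\<Sum>j. d (j + k) * x ^ (j + k)) = (\<Sum>j. x ^ k * (e j * x ^ j))"
      by (simp add: e_def power_add mult_ac)
    also have "\<dots> = x ^ k * (\<Sum>j. e j * x ^ j)"
      by (rule suminf_mult) (use summ[of x k] x in \<open>simp add: e_def\<close>)
    finally show ?thesis using zero[of x] x by simp
  qed
  then have "\<forall>\<^sub>F x in at_right 0. (\<Sum>j. e j * x ^ j) = 0"
    by (intro eventually_at_rightI[of 0 1]) auto
  then have 2: "((\<lambda>x. \<Sum>j. e j * x ^ j) \<longlongrightarrow> 0) (at_right (0::real))"
    by (rule tendsto_eventually)
  have "e 0 = 0" by (rule tendsto_unique[OF _ 1 2]) simp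
  then show ?case by (simp add: e_def)
qed

lemma ennreal_power_series_unique:
  fixes a b :: "nat \<Rightarrow> ennreal"
  assumes bound: "\<And>k. a k \<le> ennreal C" "\<And>k. b k \<le> ennreal C"
    and eq: "\<And>s. 0 < s \<Longrightarrow> s < 1 \<Longrightarrow> (\<Sum>k. ennreal (s ^ k) * a k) = (\<Sum>k. ennreal (s ^ k) * b k)"
  shows "a k = b k"
proof -
  \<comment> \<open>A negative \<open>C\<close> is read as 0 by \<open>ennreal\<close>, which the
    passage to real bounds has to respect.\<close>
  define C' where "C' = max C 0"
  have C': "ennreal C \<le> ennreal C'" "0 \<le> C'" by (auto simp: C'_def ennreal_leI)
  define f g where "f k = enn2real (a k)" and "g k = enn2real (b k)" for k
  have fa: "a k = ennreal (f k)" "b k = ennreal (g k)" for k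
    using bound[of k] by (auto simp: f_def g_def ennreal_enn2real_if top_unique)
  have fg: "0 \<le> f k" "0 \<le> g k" for k by (auto simp: f_def g_def)
  have fC: "f k \<le> C'" "g k \<le> C'" for k
    using order_trans[OF bound(1)[of k] C'(1)] order_trans[OF bound(2)[of k] C'(1)] C'(2)
    by (auto simp: fa ennreal_le_iff)
  have summ: "summable (\<lambda>j. h j * s ^ j)" if "0 < s" "s < 1" "\<And>k. 0 \<le> h k" "\<And>k. h k \<le> C'" for s h
  proof (rule summable_comparison_test')
    show "summable (\<lambda>j. C' * s ^ j)" using that by (intro summable_mult summable_geometric) auto
    show "norm (h j * s ^ j) \<le> C' * s ^ j" if "j \<ge> 0" for j
      using \<open>0 < s\<close> \<open>\<And>k. 0 \<le> h k\<close>[of j] \<open>\<And>k. h k \<le> C'\<close>[of j]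
      by (auto simp: abs_mult power_abs intro!: mult_right_mono)
  qed
  have "f k - g k = 0"
  proof (rule power_series_unique)
    show "\<bar>f k - g k\<bar> \<le> C'" for k using fg[of k] fC[of k] by auto
    fix s :: real assume s: "0 < s" "s < 1"
    have sf: "summable (\<lambda>j. f j * s ^ j)" and sg: "summable (\<lambda>j. g j * s ^ j)"
      using summ[OF s] fg fC by auto
    have "ennreal (\<Sum>j. f j * s ^ j) = (\<Sum>j. ennreal (s ^ j) * a j)"
      using sf s fg by (subst suminf_ennreal2[symmetric]) (auto simp: fa ennreal_mult mult.commute)
    also have "\<dots> = (\<Sum>j. ennreal (s ^ j) * b j)" by (rule eq[OF s])
    also have "\<dots> = ennreal (\<Sum>j. g j * s ^ j)"
      using sg s fg by (subst suminf_ennreal2[symmetric]) (auto simp: fa ennreal_mult mult.commute)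
    finally have "(\<Sum>j. f j * s ^ j) = (\<Sum>j. g j * s ^ j)"
      using s fg sf sg by (subst (asm) ennreal_inj) (auto intro!: suminf_nonneg)
    then show "(\<Sum>j. (f j - g j) * s ^ j) = 0"
      using suminf_diff[OF sf sg] by (simp add: left_diff_distrib)
  qed
  then show ?thesis by (simp add: fa)
qed

section \<open>Measurable structure of the point measures and uniqueness by Laplace
  functionals\<close>

lemma space_point_measure_algebra: "space (point_measure_algebra N) = point_measures N"
  by (auto simp: point_measure_algebra_def space_Sup_eq_UN)

lemma sets_point_measure: "m \<in> space (point_measure_algebra N) \<Longrightarrow> sets m = sets N"
  by (simp add: space_point_measure_algebra point_measures_def)

lemma point_measure_cases:
  assumes "m \<in> space (point_measure_algebra N)" "G \<in> sets N"
  obtains k where "emeasure m G = of_nat k" | "emeasure m G = top"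
proof -
  from assms obtain x where "emeasure m G = ennreal_of_enat x"
    by (auto simp: space_point_measure_algebra point_measures_def)
  then show thesis using that by (cases x) auto
qed

lemma emeasure_point_measurable[measurable]:
  "G \<in> sets N \<Longrightarrow> (\<lambda>m. emeasure m G) \<in> borel_measurable (point_measure_algebra N)"
  unfolding point_measure_algebra_def
  by (rule measurable_SUP1) (auto intro: measurable_vimage_algebra1)

lemma measurable_point_measure_algebra:
  assumes "\<And>x. x \<in> space P \<Longrightarrow> \<xi> x \<in> point_measures N"
    and "\<And>G. G \<in> sets N \<Longrightarrow> (\<lambda>x. emeasure (\<xi> x) G) \<in> borel_measurable P"
  shows "\<xi> \<in> P \<rightarrow>\<^sub>M point_measure_algebra N"
  using assms unfolding point_measure_algebra_def
  by (auto intro!: measurable_Sup2 measurable_vimage_algebra2)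

lemma nn_integral_point_measurable:
  assumes "f \<in> borel_measurable N"
  shows "(\<lambda>m. \<integral>\<^sup>+x. f x \<partial>m) \<in> borel_measurable (point_measure_algebra N)" (is "_ \<in> ?B")
  using assms
proof induct
  case (cong f g)
  have "(\<integral>\<^sup>+x. f x \<partial>m) = (\<integral>\<^sup>+x. g x \<partial>m)" if "m \<in> space (point_measure_algebra N)" for m
    using sets_eq_imp_space_eq[OF sets_point_measure[OF that]] cong(3) by (intro nn_integral_cong) auto
  from measurable_cong[THEN iffD2, OF this cong(4)] show ?case .
next
  case (set A)
  have "(\<integral>\<^sup>+x. indicator A x \<partial>m) = emeasure m A" if "m \<in> space (point_measure_algebra N)" for m
    using sets_point_measure[OF that] set by simp
  from measurable_cong[THEN iffD2, OF this emeasure_point_measurable[OF set]] show ?case .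
next
  case (mult u c)
  have "(\<integral>\<^sup>+x. c * u x \<partial>m) = c * (\<integral>\<^sup>+x. u x \<partial>m)" if "m \<in> space (point_measure_algebra N)" for m
    using measurable_cong_sets[OF sets_point_measure[OF that] refl] mult(2) by (intro nn_integral_cmult) blast
  moreover have "(\<lambda>m. c * (\<integral>\<^sup>+x. u x \<partial>m)) \<in> ?B" using mult(4) by measurable
  ultimately show ?case by (rule measurable_cong[THEN iffD2])
next
  case (add u v)
  have "(\<integral>\<^sup>+x. v x + u x \<partial>m) = (\<integral>\<^sup>+x. v x \<partial>m) + (\<integral>\<^sup>+x. u x \<partial>m)"
    if "m \<in> space (point_measure_algebra N)" for m
    using measurable_cong_sets[OF sets_point_measure[OF that] refl] add(1,4) by (intro nn_integral_add) blast+
  moreover have "(\<lambda>m. (\<integral>\<^sup>+x. v x \<partial>m) + (\<integral>\<^sup>+x. u x \<partial>m)) \<in> ?B" using add(3,7) by measurable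
  ultimately show ?case by (rule measurable_cong[THEN iffD2])
next
  case (seq U)
  have "(\<integral>\<^sup>+x. (SUP i. U i) x \<partial>m) = (SUP i. \<integral>\<^sup>+x. U i x \<partial>m)"
    if "m \<in> space (point_measure_algebra N)" for m
    using measurable_cong_sets[OF sets_point_measure[OF that] refl] seq(1,4) unfolding SUP_apply
    by (intro nn_integral_monotone_convergence_SUP) blast+
  moreover have "(\<lambda>m. SUP i. \<integral>\<^sup>+x. U i x \<partial>m) \<in> ?B" using seq(3) by measurable
  ultimately show ?case by (rule measurable_cong[THEN iffD2])
qed

lemma measurable_nexp_integral[measurable]:
  "f \<in> borel_measurable N \<Longrightarrow> (\<lambda>m. nexp (\<integral>\<^sup>+x. f x \<partial>m)) \<in> borel_measurable (point_measure_algebra N)"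
  using nn_integral_point_measurable by measurable

text \<open>Evaluations take values in the naturals and \<infinity>, so the events of prescribed
  finite counts generate: an infinite count is the complement of all finite ones. Lists of
  constraints make intersection stability plain, since appending two lists intersects the
  events.\<close>

lemma point_measure_algebra_generator:
  fixes N :: "'a measure"
  defines "E \<equiv> \<lambda>l :: ('a set \<times> nat) list. {m \<in> point_measures N. \<forall>(G, k)\<in>set l. emeasure m G = of_nat k}"
  shows "sets (point_measure_algebra N) = sigma_sets (point_measures N) {E l | l. fst ` set l \<subseteq> sets N}"
    (is "_ = sigma_sets ?\<Omega> ?E")
proof
  have E_sets: "E l \<in> sets (point_measure_algebra N)" if "fst ` set l \<subseteq> sets N" for l
  proof -
    have "E l = {m \<in> space (point_measure_algebra N). \<forall>p\<in>set l. emeasure m (fst p) = of_nat (snd p)}"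
      by (auto simp: E_def space_point_measure_algebra)
    also have "\<dots> \<in> sets (point_measure_algebra N)"
    proof (rule sets.sets_Collect_finite_All)
      fix p assume "p \<in> set l"
      then have [measurable]: "fst p \<in> sets N" using that by auto
      show "{m \<in> space (point_measure_algebra N). emeasure m (fst p) = of_nat (snd p)} \<in> sets (point_measure_algebra N)"
        by measurable
    qed simp
    finally show ?thesis .
  qed
  show "sigma_sets ?\<Omega> ?E \<subseteq> sets (point_measure_algebra N)"
    using E_sets by (auto simp: space_point_measure_algebra[symmetric] intro!: sets.sigma_sets_subset)
  interpret S: sigma_algebra ?\<Omega> "sigma_sets ?\<Omega> ?E"
    by (rule sigma_algebra_sigma_sets) (auto simp: E_def)
  have meas: "(\<lambda>m. emeasure m G) -` B \<inter> ?\<Omega> \<in> sigma_sets ?\<Omega> ?E" if G: "G \<in> sets N" for G B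
  proof -
    have E1: "E [(G, k)] \<in> sigma_sets ?\<Omega> ?E" for k
      using G by (intro sigma_sets.Basic) (auto intro!: exI[of _ "[(G, k)]"])
    have 1: "(\<Union>k\<in>{k. of_nat k \<in> B}. E [(G, k)]) \<in> sigma_sets ?\<Omega> ?E"
      using E1 by (intro S.countable_UN) auto
    have 2: "?\<Omega> - (\<Union>k. E [(G, k)]) \<in> sigma_sets ?\<Omega> ?E"
      using E1 by (intro S.Diff S.top S.countable_UN) auto
    have val: "(\<exists>k. emeasure m G = of_nat k) \<or> emeasure m G = top" if "m \<in> ?\<Omega>" for m
      using that G by (auto simp: space_point_measure_algebra[symmetric] elim: point_measure_cases)
    have "(\<lambda>m. emeasure m G) -` B \<inter> ?\<Omega> = (\<Union>k\<in>{k. of_nat k \<in> B}. E [(G, k)]) \<union>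
        (if top \<in> B then ?\<Omega> - (\<Union>k. E [(G, k)]) else {})"
      using val by (auto simp: E_def) metis+
    with 1 2 show ?thesis by auto
  qed
  have "sets (point_measure_algebra N) =
      sigma_sets ?\<Omega> (\<Union>M\<in>(\<lambda>G. vimage_algebra ?\<Omega> (\<lambda>m. emeasure m G) borel) ` sets N. sets M)"
    unfolding point_measure_algebra_def by (rule sets_Sup_eq) auto
  also have "\<dots> \<subseteq> sigma_sets ?\<Omega> ?E"
    using meas by (intro sigma_sets_mono) (auto simp: sets_vimage_algebra2)
  finally show "sets (point_measure_algebra N) \<subseteq> sigma_sets ?\<Omega> ?E" .
qed

text \<open>With the parameter \<open>- ln s\<close>, the Laplace factor is \<open>s\<close> to the
  power of the count. An infinite count gives 0 on both sides, which is why only finite counts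
  appear in the series.\<close>

lemma nexp_point_series:
  assumes "m \<in> space (point_measure_algebra N)" "G \<in> sets N" "0 < s" "s < 1"
  shows "nexp (ennreal (- ln s) * emeasure m G) =
    (\<Sum>k. ennreal (s ^ k) * indicator {m. emeasure m G = of_nat k} m)"
  using assms(1,2)
proof (cases rule: point_measure_cases)
  case (1 k)
  have "(\<Sum>j. ennreal (s ^ j) * indicator {m. emeasure m G = of_nat j} m) =
      (\<Sum>j\<in>{k}. ennreal (s ^ j) * indicator {m. emeasure m G = of_nat j} m)"
    using 1 by (intro suminf_finite) auto
  also have "\<dots> = ennreal s ^ k" using 1 assms by (simp add: ennreal_power)
  also have "ennreal s = nexp (ennreal (- ln s))"
    using assms by (simp add: nexp_ennreal)
  finally show ?thesis using 1 by (simp add: nexp_of_nat_mult)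
next
  case 2
  then show ?thesis using assms by (simp add: ennreal_mult_top)
qed

text \<open>Laplace functionals determine finite measures on the point measures. The auxiliary claim
  mixes count constraints with one Laplace factor and is proved by induction on the constraints:
  adding a multiple of \<open>indicator G\<close> to the test function produces a power series in
  \<open>s\<close> whose coefficients are the integrals with one more constraint on
  \<open>G\<close>, and equal series have equal coefficients. Finally, the constraint events form a
  generator.\<close>

lemma point_measure_eqI:
  assumes fin: "finite_measure \<mu>" "finite_measure \<nu>"
    and sets[measurable_cong]: "sets \<mu> = sets (point_measure_algebra N)" "sets \<nu> = sets (point_measure_algebra N)"
    and eq: "\<And>f. f \<in> borel_measurable N \<Longrightarrow>
      (\<integral>\<^sup>+m. nexp (\<integral>\<^sup>+x. f x \<partial>m) \<partial>\<mu>) = (\<integral>\<^sup>+m. nexp (\<integral>\<^sup>+x. f x \<partial>m) \<partial>\<nu>)"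
  shows "\<mu> = \<nu>"
proof -
  define E where "E = (\<lambda>l. {m \<in> point_measures N. \<forall>(G, k)\<in>set l. emeasure m G = of_nat k})"
  have sp: "space \<mu> = point_measures N" "space \<nu> = point_measures N"
    using sets[THEN sets_eq_imp_space_eq] by (auto simp: space_point_measure_algebra)
  interpret \<mu>: finite_measure \<mu> by fact
  interpret \<nu>: finite_measure \<nu> by fact
  define C where "C = max (measure \<mu> (space \<mu>)) (measure \<nu> (space \<nu>))"
  have E_sets[measurable]: "E l \<in> sets (point_measure_algebra N)" if "fst ` set l \<subseteq> sets N" for l
    using that unfolding point_measure_algebra_generator E_def by (intro sigma_sets.Basic) blast
  have *: "(\<integral>\<^sup>+m. indicator (E l) m * nexp (\<integral>\<^sup>+x. f x \<partial>m) \<partial>\<mu>) =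
      (\<integral>\<^sup>+m. indicator (E l) m * nexp (\<integral>\<^sup>+x. f x \<partial>m) \<partial>\<nu>)"
    if "fst ` set l \<subseteq> sets N" "f \<in> borel_measurable N" for l f
    using that
  proof (induction l arbitrary: f)
    case Nil
    have "indicator (E []) m = (1::ennreal)" if "m \<in> space \<mu> \<or> m \<in> space \<nu>" for m
      using that by (auto simp: E_def sp)
    then show ?case using eq[OF Nil(2)] by (simp cong: nn_integral_cong)
  next
    case (Cons p l)
    obtain G k where p: "p = (G, k)" by force
    have G[measurable]: "G \<in> sets N" and l: "fst ` set l \<subseteq> sets N" using Cons p by auto
    have [measurable]: "f \<in> borel_measurable N" "E l \<in> sets (point_measure_algebra N)"
      using Cons E_sets l by auto
    let ?A = "\<lambda>k. {m \<in> space (point_measure_algebra N). emeasure m G = of_nat k}"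
    let ?h = "\<lambda>k m. indicator (?A k) m * (indicator (E l) m * nexp (\<integral>\<^sup>+x. f x \<partial>m))"
    have h1: "?h k m \<le> 1" for k m by (auto simp: indicator_def)
    have ser: "(\<Sum>k. ennreal (s ^ k) * (\<integral>\<^sup>+m. ?h k m \<partial>M)) =
        (\<integral>\<^sup>+m. indicator (E l) m * nexp (\<integral>\<^sup>+x. f x + ennreal (- ln s) * indicator G x \<partial>m) \<partial>M)"
      if M[measurable_cong]: "sets M = sets (point_measure_algebra N)" and s: "0 < s" "s < 1" for M s
    proof -
      have "(\<Sum>k. ennreal (s ^ k) * (\<integral>\<^sup>+m. ?h k m \<partial>M)) = (\<Sum>k. \<integral>\<^sup>+m. ennreal (s ^ k) * ?h k m \<partial>M)"
        by (subst nn_integral_cmult) measurable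
      also have "\<dots> = (\<integral>\<^sup>+m. (\<Sum>k. ennreal (s ^ k) * ?h k m) \<partial>M)"
        by (rule nn_integral_suminf[symmetric]) measurable
      also have "\<dots> = (\<integral>\<^sup>+m. indicator (E l) m * nexp (\<integral>\<^sup>+x. f x + ennreal (- ln s) * indicator G x \<partial>m) \<partial>M)"
      proof (rule nn_integral_cong)
        fix m assume "m \<in> space M"
        then have m: "m \<in> space (point_measure_algebra N)" using sets_eq_imp_space_eq[OF M] by simp
        have [measurable_cong]: "sets m = sets N" by (rule sets_point_measure[OF m])
        have "(\<Sum>k. ennreal (s ^ k) * ?h k m) =
            (\<Sum>k. ennreal (s ^ k) * indicator {m. emeasure m G = of_nat k} m * (indicator (E l) m * nexp (\<integral>\<^sup>+x. f x \<partial>m)))"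
          using m by (simp add: indicator_def mult_ac)
        also have "\<dots> = (\<Sum>k. ennreal (s ^ k) * indicator {m. emeasure m G = of_nat k} m) * (indicator (E l) m * nexp (\<integral>\<^sup>+x. f x \<partial>m))"
          by (rule ennreal_suminf_multc)
        also have "\<dots> = indicator (E l) m * (nexp (\<integral>\<^sup>+x. f x \<partial>m) * nexp (ennreal (- ln s) * emeasure m G))"
          by (subst nexp_point_series[OF m G s]) (simp add: mult_ac)
        also have "nexp (\<integral>\<^sup>+x. f x \<partial>m) * nexp (ennreal (- ln s) * emeasure m G) =
            nexp (\<integral>\<^sup>+x. f x + ennreal (- ln s) * indicator G x \<partial>m)"
          by (subst nn_integral_add) (auto simp: nexp_add nn_integral_cmult)
        finally show "(\<Sum>k. ennreal (s ^ k) * ?h k m) =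
          indicator (E l) m * nexp (\<integral>\<^sup>+x. f x + ennreal (- ln s) * indicator G x \<partial>m)" .
      qed
      finally show ?thesis .
    qed
    have "(\<integral>\<^sup>+m. ?h k m \<partial>\<mu>) = (\<integral>\<^sup>+m. ?h k m \<partial>\<nu>)"
    proof (rule ennreal_power_series_unique[where C=C])
      show "(\<integral>\<^sup>+m. ?h k m \<partial>\<mu>) \<le> ennreal C" for k
      proof -
        have "(\<integral>\<^sup>+m. ?h k m \<partial>\<mu>) \<le> (\<integral>\<^sup>+m. 1 \<partial>\<mu>)" by (rule nn_integral_mono) (rule h1)
        also have "\<dots> \<le> ennreal C" by (simp add: \<mu>.emeasure_eq_measure C_def ennreal_leI)
        finally show ?thesis .
      qed
      show "(\<integral>\<^sup>+m. ?h k m \<partial>\<nu>) \<le> ennreal C" for k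
      proof -
        have "(\<integral>\<^sup>+m. ?h k m \<partial>\<nu>) \<le> (\<integral>\<^sup>+m. 1 \<partial>\<nu>)" by (rule nn_integral_mono) (rule h1)
        also have "\<dots> \<le> ennreal C" by (simp add: \<nu>.emeasure_eq_measure C_def ennreal_leI)
        finally show ?thesis .
      qed
      fix s :: real assume s: "0 < s" "s < 1"
      show "(\<Sum>k. ennreal (s ^ k) * (\<integral>\<^sup>+m. ?h k m \<partial>\<mu>)) = (\<Sum>k. ennreal (s ^ k) * (\<integral>\<^sup>+m. ?h k m \<partial>\<nu>))"
        unfolding ser[OF sets(1) s] ser[OF sets(2) s]
        by (rule Cons.IH) (use l in auto)
    qed
    moreover have "?h k m = indicator (E (p # l)) m * nexp (\<integral>\<^sup>+x. f x \<partial>m)" for m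
      by (auto simp: indicator_def E_def p space_point_measure_algebra)
    ultimately show ?case by simp
  qed
  have E_eq: "emeasure \<mu> (E l) = emeasure \<nu> (E l)" if l: "fst ` set l \<subseteq> sets N" for l
    using *[OF l, of "\<lambda>_. 0"] E_sets[OF l] sets by (simp add: nn_integral_indicator)
  have E_Int: "E l \<inter> E l' = E (l @ l')" for l l' by (auto simp: E_def)
  show ?thesis
  proof (rule measure_eqI_generator_eq[where E="{E l | l. fst ` set l \<subseteq> sets N}" and \<Omega>="point_measures N" and A="\<lambda>_. E []"])
    show "Int_stable {E l | l. fst ` set l \<subseteq> sets N}"
      by (auto simp: Int_stable_def E_Int) (metis Un_subset_iff image_Un set_append)
    show "sets \<mu> = sigma_sets (point_measures N) {E l | l. fst ` set l \<subseteq> sets N}"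
      "sets \<nu> = sigma_sets (point_measures N) {E l | l. fst ` set l \<subseteq> sets N}"
      unfolding sets point_measure_algebra_generator E_def by auto
    show "emeasure \<mu> X = emeasure \<nu> X" if "X \<in> {E l | l. fst ` set l \<subseteq> sets N}" for X
      using that E_eq by auto
  qed (auto simp: E_def intro!: exI[of _ "[]"])
qed

section \<open>The Laplace functional of a Poisson process\<close>

lemma poisson_process_prob: "poisson_process P \<Lambda> \<xi> \<Longrightarrow> prob_space P"
  by (simp add: poisson_process_def)

lemma poisson_process_measurable: "poisson_process P \<Lambda> \<xi> \<Longrightarrow> \<xi> \<in> P \<rightarrow>\<^sub>M point_measure_algebra \<Lambda>"
  by (simp add: poisson_process_def)

text \<open>For a finite positive mean this is the generating function of the Poisson distribution
  at \<open>nexp t\<close>. For mean \<infinity> both sides are 0 unless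
  \<open>t = 0\<close>.\<close>

lemma poisson_laplace_set:
  assumes pp: "poisson_process P \<Lambda> \<xi>" and G[measurable]: "G \<in> sets \<Lambda>"
  shows "(\<integral>\<^sup>+w. nexp (t * emeasure (\<xi> w) G) \<partial>P) = nexp ((1 - nexp t) * emeasure \<Lambda> G)"
proof -
  interpret prob_space P using pp by (rule poisson_process_prob)
  have [measurable]: "\<xi> \<in> P \<rightarrow>\<^sub>M point_measure_algebra \<Lambda>" using pp by (rule poisson_process_measurable)
  consider "emeasure \<Lambda> G = 0" | "emeasure \<Lambda> G = top" | "0 < emeasure \<Lambda> G" "emeasure \<Lambda> G < top"
    by (metis not_gr_zero top.not_eq_extremum)
  then show ?thesis
  proof cases
    case 1
    then have "AE w in P. emeasure (\<xi> w) G = 0" using pp G by (simp add: poisson_process_def)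
    then have "(\<integral>\<^sup>+w. nexp (t * emeasure (\<xi> w) G) \<partial>P) = (\<integral>\<^sup>+w. 1 \<partial>P)"
      by (intro nn_integral_cong_AE) (auto elim!: eventually_mono)
    then show ?thesis using 1 by (simp add: emeasure_space_1)
  next
    case 2
    then have "AE w in P. emeasure (\<xi> w) G = top" using pp G by (simp add: poisson_process_def)
    then have *: "(\<integral>\<^sup>+w. nexp (t * emeasure (\<xi> w) G) \<partial>P) = (\<integral>\<^sup>+w. nexp (t * top) \<partial>P)"
      by (intro nn_integral_cong_AE) (auto elim!: eventually_mono)
    show ?thesis
    proof (cases "t = 0")
      case True
      then show ?thesis by (simp add: emeasure_space_1)
    next
      case False
      then have "nexp t \<noteq> 1" using nexp_inject[of t 0] by simp
      then have "1 - nexp t \<noteq> 0" using nexp_le_1[of t] by (auto simp: diff_eq_0_iff_ennreal dest: antisym)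
      then show ?thesis using False * 2 by (simp add: ennreal_mult_top)
    qed
  next
    case 3
    define r where "r = measure \<Lambda> G"
    have r1: "emeasure \<Lambda> G = ennreal r"
      unfolding r_def using 3(2) by (intro emeasure_eq_ennreal_measure) simp
    have r: "emeasure \<Lambda> G = ennreal r" "0 < r"
      using 3(1) by (simp_all add: r1)
    let ?A = "\<lambda>k. {w \<in> space P. emeasure (\<xi> w) G = of_nat k}"
    have Ak: "emeasure P (?A k) = ennreal (r ^ k / fact k * exp (- r))" for k
      using pp G 3 r(2) by (simp add: poisson_process_def emeasure_eq_measure r_def)
    have exp_sums: "(\<lambda>k. ennreal (x ^ k / fact k)) sums ennreal (exp x)" if "0 \<le> x" for x
    proof -
      have "(\<lambda>k. x ^ k / fact k) sums exp x"
        using exp_converges[of x] by (simp add: divide_inverse mult.commute)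
      then show ?thesis using that by (simp add: sums_ennreal)
    qed
    have sum: "(\<Sum>k. ennreal (x ^ k / fact k * exp (- r))) = ennreal (exp (x - r))" if "0 \<le> x" for x
    proof -
      have "(\<Sum>k. ennreal (x ^ k / fact k * exp (- r))) = (\<Sum>k. ennreal (x ^ k / fact k)) * ennreal (exp (- r))"
      proof -
        have "ennreal (x ^ k / fact k * exp (- r)) = ennreal (x ^ k / fact k) * ennreal (exp (- r))" for k
          using that by (intro ennreal_mult) auto
        then show ?thesis by (simp only: ennreal_suminf_multc)
      qed
      also have "(\<Sum>k. ennreal (x ^ k / fact k)) = ennreal (exp x)"
        using exp_sums[OF that] by (rule sums_unique[symmetric])
      finally show ?thesis by (simp add: ennreal_mult[symmetric] exp_add[symmetric])
    qed
    have disj: "disjoint_family ?A" by (auto simp: disjoint_family_on_def)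
    have Am[measurable]: "?A k \<in> sets P" for k by measurable
    \<comment> \<open>The definition of the process does not state outright that a count with finite
      mean is almost surely finite; it follows because the Poisson probabilities already add up to
      1.\<close>
    have "emeasure P (\<Union>k. ?A k) = (\<Sum>k. emeasure P (?A k))"
      by (rule suminf_emeasure[symmetric]) (use disj in auto)
    also have "\<dots> = 1" unfolding Ak sum[OF less_imp_le[OF r(2)]] by simp
    finally have "AE w in P. w \<in> (\<Union>k. ?A k)"
      by (intro AE_prob_1) (simp add: measure_def)
    then have "AE w in P. nexp (t * emeasure (\<xi> w) G) = (\<Sum>k. nexp t ^ k * indicator (?A k) w)"
    proof eventually_elim
      case (elim w)
      then obtain k where k: "w \<in> space P" "emeasure (\<xi> w) G = of_nat k" by auto
      have "(\<Sum>j. nexp t ^ j * indicator (?A j) w) = (\<Sum>j\<in>{k}. nexp t ^ j * indicator (?A j) w)"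
        using k(2) by (intro suminf_finite) auto
      then show ?case using k by (simp add: nexp_of_nat_mult)
    qed
    then have "(\<integral>\<^sup>+w. nexp (t * emeasure (\<xi> w) G) \<partial>P) = (\<integral>\<^sup>+w. (\<Sum>k. nexp t ^ k * indicator (?A k) w) \<partial>P)"
      by (rule nn_integral_cong_AE)
    also have "\<dots> = (\<Sum>k. \<integral>\<^sup>+w. nexp t ^ k * indicator (?A k) w \<partial>P)"
      by (rule nn_integral_suminf) measurable
    also have "\<dots> = (\<Sum>k. nexp t ^ k * ennreal (r ^ k / fact k * exp (- r)))"
      by (simp add: nn_integral_cmult_indicator Ak)
    also have "\<dots> = nexp ((1 - nexp t) * emeasure \<Lambda> G)"
    proof -
      obtain s where s: "nexp t = ennreal s" "0 \<le> s" "s \<le> 1"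
        using nexp_le_1[of t] by (cases "nexp t") (auto simp: top_unique)
      have "(\<Sum>k. nexp t ^ k * ennreal (r ^ k / fact k * exp (- r))) = (\<Sum>k. ennreal ((s * r) ^ k / fact k * exp (- r)))"
        using s r by (simp add: ennreal_power ennreal_mult[symmetric] power_mult_distrib mult_ac)
      also have "\<dots> = ennreal (exp (s * r - r))" using s r by (intro sum) auto
      also have "\<dots> = nexp (ennreal ((1 - s) * r))"
        using s r by (simp add: nexp_ennreal algebra_simps)
      also have "ennreal ((1 - s) * r) = (1 - nexp t) * emeasure \<Lambda> G"
        using s r by (simp add: ennreal_mult ennreal_minus flip: ennreal_1)
      finally show ?thesis .
    qed
    finally show ?thesis .
  qed
qed

text \<open>For simple functions the counts on the level sets are independent and the integral
  factorizes. In general, increasing simple functions give decreasing Laplace functionals, whose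
  integrals are finite, so decreasing monotone convergence applies on the left and the increasing
  one on the right.\<close>

theorem poisson_laplace:
  assumes pp: "poisson_process P \<Lambda> \<xi>" and f[measurable]: "f \<in> borel_measurable \<Lambda>"
  shows "(\<integral>\<^sup>+w. nexp (\<integral>\<^sup>+y. f y \<partial>\<xi> w) \<partial>P) = nexp (\<integral>\<^sup>+y. 1 - nexp (f y) \<partial>\<Lambda>)"
proof -
  interpret prob_space P using pp by (rule poisson_process_prob)
  have \<xi>[measurable]: "\<xi> \<in> P \<rightarrow>\<^sub>M point_measure_algebra \<Lambda>" using pp by (rule poisson_process_measurable)
  have sets_\<xi>: "sets (\<xi> w) = sets \<Lambda>" "space (\<xi> w) = space \<Lambda>" if "w \<in> space P" for w
    using sets_point_measure[OF measurable_space[OF \<xi> that]] by (auto dest: sets_eq_imp_space_eq)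
  have simple: "(\<integral>\<^sup>+w. nexp (\<integral>\<^sup>+y. s y \<partial>\<xi> w) \<partial>P) = nexp (\<integral>\<^sup>+y. 1 - nexp (s y) \<partial>\<Lambda>)"
    if s: "simple_function \<Lambda> s" for s
  proof -
    have fin: "finite (s ` space \<Lambda>)" using s by (auto simp: simple_function_def)
    \<comment> \<open>The values are enumerated from 1 because the definition of the process speaks
      of families indexed by \<open>{1..m}\<close>.\<close>
    obtain c where c: "bij_betw c {1..card (s ` space \<Lambda>)} (s ` space \<Lambda>)"
      using ex_bij_betw_nat_finite_1[OF fin] by blast
    let ?m = "card (s ` space \<Lambda>)"
    define G where "G i = s -` {c i} \<inter> space \<Lambda>" for i
    have G[measurable]: "G i \<in> sets \<Lambda>" for i
      using s unfolding G_def by (rule simple_functionD)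
    have inj: "c i = c j \<longleftrightarrow> i = j" if "i \<in> {1..?m}" "j \<in> {1..?m}" for i j
      using inj_on_eq_iff[OF bij_betw_imp_inj_on[OF c] that] .
    have disj: "disjoint_family_on G {1..?m}"
      unfolding disjoint_family_on_def
    proof (intro ballI impI)
      fix i j assume "i \<in> {1..?m}" "j \<in> {1..?m}" "i \<noteq> j"
      with inj have "c i \<noteq> c j" by blast
      then show "G i \<inter> G j = {}" by (auto simp: G_def)
    qed
    have int: "(\<integral>\<^sup>+y. g (s y) \<partial>M) = (\<Sum>i\<in>{1..?m}. g (c i) * emeasure M (G i))"
      if M: "sets M = sets \<Lambda>" for M and g :: "ennreal \<Rightarrow> ennreal"
    proof -
      have sp: "space M = space \<Lambda>" using M by (rule sets_eq_imp_space_eq)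
      have "(\<integral>\<^sup>+y. g (s y) \<partial>M) = (\<integral>\<^sup>+y. (\<Sum>i\<in>{1..?m}. g (c i) * indicator (G i) y) \<partial>M)"
      proof (rule nn_integral_cong)
        fix y assume "y \<in> space M"
        then have y: "y \<in> space \<Lambda>" "s y \<in> s ` space \<Lambda>" by (auto simp: sp)
        then obtain j where j: "j \<in> {1..?m}" "c j = s y"
          using bij_betw_imp_surj_on[OF c] by (metis imageE)
        have "g (c i) * indicator (G i) y = (if i = j then g (c j) else 0)" if "i \<in> {1..?m}" for i
          using inj[OF that j(1)] j(2) y(1) by (auto simp: G_def indicator_def)
        then have "(\<Sum>i\<in>{1..?m}. g (c i) * indicator (G i) y) = (\<Sum>i\<in>{1..?m}. if i = j then g (c j) else 0)"
          by (rule sum.cong[OF refl])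
        also have "\<dots> = g (s y)" using j by simp
        finally show "g (s y) = (\<Sum>i\<in>{1..?m}. g (c i) * indicator (G i) y)" by simp
      qed
      also have "\<dots> = (\<Sum>i\<in>{1..?m}. \<integral>\<^sup>+y. g (c i) * indicator (G i) y \<partial>M)"
        using M G by (intro nn_integral_sum) (auto intro!: borel_measurable_indicator)
      finally show ?thesis using M by (simp add: nn_integral_cmult_indicator)
    qed
    have "(\<integral>\<^sup>+w. nexp (\<integral>\<^sup>+y. s y \<partial>\<xi> w) \<partial>P) = (\<integral>\<^sup>+w. (\<Prod>i\<in>{1..?m}. nexp (c i * emeasure (\<xi> w) (G i))) \<partial>P)"
      using int[of _ "\<lambda>x. x"] sets_\<xi> by (intro nn_integral_cong) (simp add: nexp_sum)
    also have "\<dots> = (\<Prod>i\<in>{1..?m}. \<integral>\<^sup>+w. nexp (c i * emeasure (\<xi> w) (G i)) \<partial>P)"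
    proof (rule indep_vars_nn_integral)
      have "indep_vars (\<lambda>_. borel) (\<lambda>i w. emeasure (\<xi> w) (G i)) {1..?m}"
        using pp disj G by (simp add: poisson_process_def)
      from indep_vars_compose2[OF this, of "\<lambda>i x. nexp (c i * x)" "\<lambda>_. borel"]
      show "indep_vars (\<lambda>_. borel) (\<lambda>i w. nexp (c i * emeasure (\<xi> w) (G i))) {1..?m}" by simp
    qed auto
    also have "\<dots> = (\<Prod>i\<in>{1..?m}. nexp ((1 - nexp (c i)) * emeasure \<Lambda> (G i)))"
      by (simp add: poisson_laplace_set[OF pp])
    also have "\<dots> = nexp (\<integral>\<^sup>+y. 1 - nexp (s y) \<partial>\<Lambda>)"
      using int[OF refl, of "\<lambda>x. 1 - nexp x"] by (simp add: nexp_sum)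
    finally show ?thesis .
  qed
  obtain s where s: "\<And>i. simple_function \<Lambda> (s i)" "incseq s" "\<And>x. (SUP i. s i x) = f x"
    using borel_measurable_implies_simple_function_sequence'[OF f] by metis
  have sm[measurable]: "s i \<in> borel_measurable \<Lambda>" for i using s(1) by (rule borel_measurable_simple_function)
  have sup: "nexp (\<integral>\<^sup>+y. f y \<partial>\<xi> w) = (INF i. nexp (\<integral>\<^sup>+y. s i y \<partial>\<xi> w))" if "w \<in> space P" for w
  proof -
    have "(\<integral>\<^sup>+y. f y \<partial>\<xi> w) = (\<integral>\<^sup>+y. (SUP i. s i y) \<partial>\<xi> w)" by (simp add: s)
    also have "\<dots> = (SUP i. \<integral>\<^sup>+y. s i y \<partial>\<xi> w)"
      using s(2) sm by (intro nn_integral_monotone_convergence_SUP) (auto simp: measurable_cong_sets[OF sets_\<xi>(1)[OF that] refl])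
    finally show ?thesis by (simp add: nexp_SUP)
  qed
  have "(\<integral>\<^sup>+w. nexp (\<integral>\<^sup>+y. f y \<partial>\<xi> w) \<partial>P) = (\<integral>\<^sup>+w. (INF i. nexp (\<integral>\<^sup>+y. s i y \<partial>\<xi> w)) \<partial>P)"
    by (intro nn_integral_cong sup)
  also have "\<dots> = (INF i. \<integral>\<^sup>+w. nexp (\<integral>\<^sup>+y. s i y \<partial>\<xi> w) \<partial>P)"
  proof (rule nn_integral_monotone_convergence_INF_decseq)
    show "decseq (\<lambda>i w. nexp (\<integral>\<^sup>+y. s i y \<partial>\<xi> w))"
      by (intro decseq_SucI le_funI nexp_antimono nn_integral_mono) (use incseq_SucD[OF s(2)] in \<open>auto simp: le_fun_def\<close>)
    show "(\<integral>\<^sup>+w. nexp (\<integral>\<^sup>+y. s 0 y \<partial>\<xi> w) \<partial>P) < \<infinity>" by (simp add: simple[OF s(1)])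
  qed measurable
  also have "\<dots> = (INF i. nexp (\<integral>\<^sup>+y. 1 - nexp (s i y) \<partial>\<Lambda>))" by (simp add: simple[OF s(1)])
  also have "\<dots> = nexp (SUP i. \<integral>\<^sup>+y. 1 - nexp (s i y) \<partial>\<Lambda>)" by (simp add: nexp_SUP)
  also have "(SUP i. \<integral>\<^sup>+y. 1 - nexp (s i y) \<partial>\<Lambda>) = (\<integral>\<^sup>+y. (SUP i. 1 - nexp (s i y)) \<partial>\<Lambda>)"
  proof (rule nn_integral_monotone_convergence_SUP[symmetric])
    show "incseq (\<lambda>i y. 1 - nexp (s i y))"
      by (intro incseq_SucI le_funI ennreal_mono_minus nexp_antimono) (use incseq_SucD[OF s(2)] in \<open>auto simp: le_fun_def\<close>)
  qed measurable
  also have "(\<lambda>y. SUP i. 1 - nexp (s i y)) = (\<lambda>y. 1 - nexp (f y))"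
    by (simp add: ennreal_INF_const_minus nexp_SUP s(3)[symmetric])
  finally show ?thesis .
qed

section \<open>Localization: identities on bounded sets extended to the whole space\<close>

text \<open>Monotone convergence along \<open>K n\<close>. It is used where the identity can be
  proved only on bounded sets, because proving it needs cancellation of finite terms.\<close>

lemma localized_integral_eqI:
  fixes q q' :: "'y \<Rightarrow> ennreal"
  assumes [measurable]: "Z \<in> L \<rightarrow>\<^sub>M MC" "q \<in> borel_measurable L" "q' \<in> borel_measurable L"
    and K[measurable]: "\<And>n::nat. K n \<in> sets MC" and inc: "incseq K"
    and cover: "AE y in L. Z y \<in> (\<Union>n. K n)"
    and eq: "\<And>n H. H \<in> sets MC \<Longrightarrow> H \<subseteq> K n \<Longrightarrow>
      (\<integral>\<^sup>+y. q y * indicator H (Z y) \<partial>L) = (\<integral>\<^sup>+y. q' y * indicator H (Z y) \<partial>L)"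
    and H: "H \<in> sets MC"
  shows "(\<integral>\<^sup>+y. q y * indicator H (Z y) \<partial>L) = (\<integral>\<^sup>+y. q' y * indicator H (Z y) \<partial>L)"
proof -
  have lim: "(\<integral>\<^sup>+y. r y * indicator H (Z y) \<partial>L) = (SUP n. \<integral>\<^sup>+y. r y * indicator (H \<inter> K n) (Z y) \<partial>L)"
    if [measurable]: "r \<in> borel_measurable L" for r
  proof -
    have "(\<integral>\<^sup>+y. r y * indicator H (Z y) \<partial>L) = (\<integral>\<^sup>+y. (SUP n. r y * indicator (H \<inter> K n) (Z y)) \<partial>L)"
    proof (rule nn_integral_cong_AE)
      show "AE y in L. r y * indicator H (Z y) = (SUP n. r y * indicator (H \<inter> K n) (Z y))"
        using cover
      proof eventually_elim
        case (elim y)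
        then obtain n where "Z y \<in> K n" by auto
        then have "r y * indicator H (Z y) \<le> r y * indicator (H \<inter> K n) (Z y)"
          by (auto simp: indicator_def)
        also have "\<dots> \<le> (SUP n. r y * indicator (H \<inter> K n) (Z y))" by (rule SUP_upper) simp
        finally show ?case
          by (intro antisym SUP_least) (auto simp: indicator_def)
      qed
    qed
    also have "\<dots> = (SUP n. \<integral>\<^sup>+y. r y * indicator (H \<inter> K n) (Z y) \<partial>L)"
    proof (rule nn_integral_monotone_convergence_SUP)
      show "incseq (\<lambda>n y. r y * indicator (H \<inter> K n) (Z y))"
      proof (intro incseq_SucI le_funI mult_left_mono)
        show "(indicator (H \<inter> K n) (Z y) :: ennreal) \<le> indicator (H \<inter> K (Suc n)) (Z y)" for n y
          using incseq_SucD[OF inc, of n] by (auto simp: indicator_def)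
      qed simp
    qed (use H in measurable)
    finally show ?thesis .
  qed
  have "(\<integral>\<^sup>+y. q y * indicator (H \<inter> K n) (Z y) \<partial>L) = (\<integral>\<^sup>+y. q' y * indicator (H \<inter> K n) (Z y) \<partial>L)" for n
    using H by (intro eq) auto
  then show ?thesis by (simp add: lim)
qed

text \<open>Passing from \<open>q\<close> to \<open>1 - q\<close> is a subtraction of integrals,
  legitimate only under finite mass. It is carried out for \<open>H\<close> inside some
  \<open>K n\<close>, and the exhaustion restores the general case.\<close>

lemma localized_integral_compl:
  fixes q q' :: "'y \<Rightarrow> ennreal"
  assumes [measurable]: "Z \<in> L \<rightarrow>\<^sub>M MC" "q \<in> borel_measurable L" "q' \<in> borel_measurable L"
    and K[measurable]: "\<And>n::nat. K n \<in> sets MC" and inc: "incseq K"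
    and cover: "AE y in L. Z y \<in> (\<Union>n. K n)"
    and fin: "\<And>n. (\<integral>\<^sup>+y. indicator (K n) (Z y) \<partial>L) < \<infinity>"
    and le: "\<And>y. q y \<le> 1" "\<And>y. q' y \<le> 1"
    and eq: "\<And>H. H \<in> sets MC \<Longrightarrow>
      (\<integral>\<^sup>+y. q y * indicator H (Z y) \<partial>L) = (\<integral>\<^sup>+y. q' y * indicator H (Z y) \<partial>L)"
    and [measurable]: "w \<in> borel_measurable MC"
  shows "(\<integral>\<^sup>+y. (1 - q y) * w (Z y) \<partial>L) = (\<integral>\<^sup>+y. (1 - q' y) * w (Z y) \<partial>L)"
proof (rule nn_integral_eq_comp[where MZ=MC])
  fix H assume H: "H \<in> sets MC"
  show "(\<integral>\<^sup>+y. (1 - q y) * indicator H (Z y) \<partial>L) = (\<integral>\<^sup>+y. (1 - q' y) * indicator H (Z y) \<partial>L)"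
  proof (rule localized_integral_eqI[where K=K and MC=MC])
    fix n H assume H[measurable]: "H \<in> sets MC" and "H \<subseteq> K n"
    have fin': "(\<integral>\<^sup>+y. indicator H (Z y) \<partial>L) < \<infinity>"
      using \<open>H \<subseteq> K n\<close> by (intro le_less_trans[OF nn_integral_mono fin[of n]]) (auto simp: indicator_def)
    have *: "(\<integral>\<^sup>+y. (1 - r y) * indicator H (Z y) \<partial>L) = (\<integral>\<^sup>+y. indicator H (Z y) \<partial>L) - (\<integral>\<^sup>+y. r y * indicator H (Z y) \<partial>L)"
      if [measurable]: "r \<in> borel_measurable L" and r: "\<And>y. r y \<le> 1" for r
    proof -
      have "(\<integral>\<^sup>+y. (1 - r y) * indicator H (Z y) \<partial>L) = (\<integral>\<^sup>+y. indicator H (Z y) - r y * indicator H (Z y) \<partial>L)"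
        by (intro nn_integral_cong) (auto simp: indicator_def)
      also have "\<dots> = (\<integral>\<^sup>+y. indicator H (Z y) \<partial>L) - (\<integral>\<^sup>+y. r y * indicator H (Z y) \<partial>L)"
      proof (rule nn_integral_diff)
        have "(\<integral>\<^sup>+y. r y * indicator H (Z y) \<partial>L) \<le> (\<integral>\<^sup>+y. indicator H (Z y) \<partial>L)"
          using r by (intro nn_integral_mono) (auto simp: indicator_def)
        then show "(\<integral>\<^sup>+y. r y * indicator H (Z y) \<partial>L) \<noteq> \<infinity>" using fin' by auto
      qed (use r in \<open>auto simp: indicator_def\<close>)
      finally show ?thesis .
    qed
    show "(\<integral>\<^sup>+y. (1 - q y) * indicator H (Z y) \<partial>L) = (\<integral>\<^sup>+y. (1 - q' y) * indicator H (Z y) \<partial>L)"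
      using le by (simp add: * eq[OF H])
  qed (use assms(1-3) K inc cover H in measurable)
qed measurable

lemma version_cmult:
  assumes v: "version P MZ Z \<phi> f" and [measurable]: "Z \<in> P \<rightarrow>\<^sub>M MZ" "\<phi> \<in> borel_measurable P"
  shows "version P MZ Z (\<lambda>x. c * \<phi> x) (\<lambda>z. c * f z)"
proof -
  have [measurable]: "f \<in> borel_measurable MZ" using v by (rule version_measurable)
  show ?thesis
    using versionD[OF v] by (intro versionI) (auto simp: mult.assoc nn_integral_cmult)
qed

text \<open>The sets \<open>K n\<close> exhaust everything except \<open>x0\<close>. A set
  containing \<open>x0\<close> is handled through its complement, by subtraction from the common
  finite total mass.\<close>

lemma finite_measure_eqI_localized:
  assumes sets: "sets \<mu> = sets N" "sets \<nu> = sets N"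
    and K: "\<And>n::nat. K n \<in> sets N" "incseq K" "(\<Union>n. K n) = space N - {x0}"
    and fin: "emeasure \<mu> (space N) < \<infinity>"
    and top: "emeasure \<mu> (space N) = emeasure \<nu> (space N)"
    and eq: "\<And>n F. F \<in> sets N \<Longrightarrow> F \<subseteq> K n \<Longrightarrow> emeasure \<mu> F = emeasure \<nu> F"
  shows "\<mu> = \<nu>"
proof (rule measure_eqI)
  have sp: "space \<mu> = space N" "space \<nu> = space N" using sets by (auto dest: sets_eq_imp_space_eq)
  have *: "emeasure \<mu> F = emeasure \<nu> F" if F: "F \<in> sets N" "x0 \<notin> F" for F
  proof -
    have FU: "(\<Union>n. F \<inter> K n) = F" using K(3) F sets.sets_into_space[OF F(1)] by auto
    have inc: "incseq (\<lambda>n. F \<inter> K n)" using K(2) by (auto simp: incseq_def)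
    have "emeasure \<mu> F = (SUP n. emeasure \<mu> (F \<inter> K n))"
      using SUP_emeasure_incseq[of "\<lambda>n. F \<inter> K n" \<mu>, unfolded FU] inc F K sets by (auto simp: image_subset_iff)
    also have "\<dots> = (SUP n. emeasure \<nu> (F \<inter> K n))"
      using F K by (intro SUP_cong refl eq) auto
    also have "\<dots> = emeasure \<nu> F"
      using SUP_emeasure_incseq[of "\<lambda>n. F \<inter> K n" \<nu>, unfolded FU] inc F K sets by (auto simp: image_subset_iff)
    finally show ?thesis .
  qed
  fix F assume "F \<in> sets \<mu>"
  then have F: "F \<in> sets N" by (simp add: sets)
  show "emeasure \<mu> F = emeasure \<nu> F"
  proof (cases "x0 \<in> F")
    case False
    with * F show ?thesis by simp
  next
    case True
    have c: "emeasure \<mu> (space N - F) = emeasure \<nu> (space N - F)"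
      using True F by (intro *) auto
    have 1: "emeasure \<mu> F + emeasure \<mu> (space N - F) = emeasure \<mu> (space N)"
      using F sets sets.sets_into_space[OF F] by (subst plus_emeasure) (auto simp: Un_absorb1)
    have 2: "emeasure \<nu> F + emeasure \<nu> (space N - F) = emeasure \<nu> (space N)"
      using F sets sets.sets_into_space[OF F] by (subst plus_emeasure) (auto simp: Un_absorb1)
    have "emeasure \<mu> (space N - F) \<le> emeasure \<mu> (space N)"
      using F sets by (intro emeasure_mono) auto
    then have "emeasure \<mu> (space N - F) < \<infinity>" using fin by (rule le_less_trans)
    with 1 2 top c show ?thesis
      by (metis add.commute ennreal_add_left_cancel infinity_ennreal_def less_irrefl)
  qed
qed (simp add: sets)

text \<open>With the weights \<open>h\<close> and \<open>h'\<close> as densities, the images under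
  \<eta> are finite measures with equal Laplace functionals, hence equal. Applied to one block at a
  time, it replaces exponential test functions by arbitrary functions of the process.\<close>

lemma laplace_ext:
  assumes "prob_space P" and \<eta>[measurable]: "\<eta> \<in> P \<rightarrow>\<^sub>M point_measure_algebra N"
    and [measurable]: "h \<in> borel_measurable P" "h' \<in> borel_measurable P"
    and le: "\<And>x. x \<in> space P \<Longrightarrow> h x \<le> 1" "\<And>x. x \<in> space P \<Longrightarrow> h' x \<le> 1"
    and eq: "\<And>k. k \<in> borel_measurable N \<Longrightarrow>
      (\<integral>\<^sup>+x. h x * nexp (\<integral>\<^sup>+y. k y \<partial>\<eta> x) \<partial>P) = (\<integral>\<^sup>+x. h' x * nexp (\<integral>\<^sup>+y. k y \<partial>\<eta> x) \<partial>P)"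
    and [measurable]: "W \<in> borel_measurable (point_measure_algebra N)"
  shows "(\<integral>\<^sup>+x. h x * W (\<eta> x) \<partial>P) = (\<integral>\<^sup>+x. h' x * W (\<eta> x) \<partial>P)"
proof -
  interpret prob_space P by fact
  let ?D = "\<lambda>h. distr (density P h) (point_measure_algebra N) \<eta>"
  have int: "(\<integral>\<^sup>+m. W m \<partial>?D h) = (\<integral>\<^sup>+x. h x * W (\<eta> x) \<partial>P)"
    if [measurable]: "W \<in> borel_measurable (point_measure_algebra N)" "h \<in> borel_measurable P" for W h
    by (simp add: nn_integral_distr nn_integral_density)
  have fin: "finite_measure (?D h)"
    if [measurable]: "h \<in> borel_measurable P" and le: "\<And>x. x \<in> space P \<Longrightarrow> h x \<le> 1" for h
  proof (rule finite_measureI)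
    have "emeasure (?D h) (space (?D h)) = (\<integral>\<^sup>+m. 1 \<partial>?D h)" by simp
    also have "\<dots> = (\<integral>\<^sup>+x. h x * 1 \<partial>P)" by (rule int) measurable
    also have "\<dots> \<le> (\<integral>\<^sup>+x. 1 \<partial>P)" by (rule nn_integral_mono) (use le in simp)
    also have "\<dots> < top" by (simp add: emeasure_space_1)
    finally show "emeasure (?D h) (space (?D h)) \<noteq> \<infinity>" by simp
  qed
  have "?D h = ?D h'"
    by (rule point_measure_eqI[where N=N, OF fin fin]) (use le eq in \<open>auto simp: int\<close>)
  then show ?thesis using int[of W h] int[of W h'] by simp
qed

subsection \<open>Three blocks of coordinates\<close>

text \<open>The entry point of the zero-infinity hypothesis into the Poisson part. If
  \<open>S\<close> has infinite mass and \<open>c < 1\<close>, both sides are infinite, since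
  \<open>1 - c * q \<ge> 1 - c\<close>; for \<open>c = 1\<close> the extra term vanishes.\<close>

lemma nn_integral_const_mult_split:
  fixes L :: "'y measure" and q :: "'y \<Rightarrow> ennreal"
  assumes [measurable]: "S \<in> sets L" "q \<in> borel_measurable L" and S: "emeasure L S \<in> {0, \<infinity>}"
    and c: "c \<le> 1" and q: "\<And>y. q y \<le> 1"
  shows "(\<integral>\<^sup>+y. (1 - c * q y) * indicator S y \<partial>L) =
    (\<integral>\<^sup>+y. (1 - c) * indicator S y \<partial>L) + (\<integral>\<^sup>+y. (1 - q y) * indicator S y \<partial>L)"
proof -
  consider "emeasure L S = 0" | "c = 1" | "emeasure L S = \<infinity>" "c < 1" using S c by (auto simp: order_le_less)
  then show ?thesis
  proof cases
    case 1
    then have "AE y in L. y \<notin> S" by (intro AE_not_in) (auto simp: null_sets_def)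
    then have "(\<integral>\<^sup>+y. g y * indicator S y \<partial>L) = (\<integral>\<^sup>+y. 0 \<partial>L)" for g
      by (intro nn_integral_cong_AE) (auto elim!: eventually_mono)
    then show ?thesis by simp
  next
    case 3
    have "1 - c \<noteq> 0" using 3 by (simp add: diff_eq_0_iff_ennreal not_le)
    then have top: "(\<integral>\<^sup>+y. (1 - c) * indicator S y \<partial>L) = top"
      using 3 by (simp add: nn_integral_cmult_indicator ennreal_mult_top)
    have "(\<integral>\<^sup>+y. (1 - c) * indicator S y \<partial>L) \<le> (\<integral>\<^sup>+y. (1 - c * q y) * indicator S y \<partial>L)"
      using mult_left_mono[OF q, of c]
      by (intro nn_integral_mono mult_right_mono ennreal_mono_minus) auto
    with top show ?thesis by (simp add: top_unique)
  qed simp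
qed

text \<open>
  The three coordinate blocks of the punctured product are abstracted to measurable maps
  \<open>X\<close>, \<open>Y\<close>, \<open>Z\<close> with distinguished values \<open>a0\<close>, \<open>b0\<close>, \<open>c0\<close>, which they never attain simultaneously.
\<close>

locale punctured_triple =
  fixes L :: "'y measure"
    and MA :: "'a measure" and X :: "'y \<Rightarrow> 'a" and a0 :: 'a and KA :: "nat \<Rightarrow> 'a set"
    and MB :: "'b measure" and Y :: "'y \<Rightarrow> 'b" and b0 :: 'b and KB :: "nat \<Rightarrow> 'b set"
    and MC :: "'c measure" and Z :: "'y \<Rightarrow> 'c" and c0 :: 'c and KC :: "nat \<Rightarrow> 'c set"
  assumes X[measurable]: "X \<in> L \<rightarrow>\<^sub>M MA" and Y[measurable]: "Y \<in> L \<rightarrow>\<^sub>M MB" and Z[measurable]: "Z \<in> L \<rightarrow>\<^sub>M MC"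
    and KA[measurable]: "\<And>n. KA n \<in> sets MA" and KA_inc: "incseq KA" and KA_UN: "(\<Union>n. KA n) = space MA - {a0}"
    and KB[measurable]: "\<And>n. KB n \<in> sets MB" and KB_inc: "incseq KB" and KB_UN: "(\<Union>n. KB n) = space MB - {b0}"
    and KC[measurable]: "\<And>n. KC n \<in> sets MC" and KC_inc: "incseq KC" and KC_UN: "(\<Union>n. KC n) = space MC - {c0}"
    and a0: "a0 \<in> space MA" and b0: "b0 \<in> space MB" and c0: "c0 \<in> space MC"
    and KA_fin: "\<And>n. (\<integral>\<^sup>+y. indicator (KA n) (X y) \<partial>L) < \<infinity>"
    and KB_fin: "\<And>n. (\<integral>\<^sup>+y. indicator (KB n) (Y y) \<partial>L) < \<infinity>"
    and KC_fin: "\<And>n. (\<integral>\<^sup>+y. indicator (KC n) (Z y) \<partial>L) < \<infinity>"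
    and never: "\<And>y. y \<in> space L \<Longrightarrow> \<not> (X y = a0 \<and> Y y = b0 \<and> Z y = c0)"
    and inf_C: "emeasure L {y \<in> space L. Z y = c0} \<in> {0, \<infinity>}"
    and inf_A: "emeasure L {y \<in> space L. X y \<noteq> a0 \<and> Y y = b0 \<and> Z y = c0} \<in> {0, \<infinity>}"
    and inf_B: "emeasure L {y \<in> space L. X y = a0 \<and> Y y \<noteq> b0 \<and> Z y = c0} \<in> {0, \<infinity>}"
begin

lemma c0_sets[measurable]: "{c0} \<in> sets MC"
proof -
  have "{c0} = space MC - (\<Union>n. KC n)" using KC_UN c0 by auto
  then show ?thesis by simp
qed

lemma a0_sets[measurable]: "{a0} \<in> sets MA"
proof -
  have "{a0} = space MA - (\<Union>n. KA n)" using KA_UN a0 by auto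
  then show ?thesis by simp
qed

lemma b0_sets[measurable]: "{b0} \<in> sets MB"
proof -
  have "{b0} = space MB - (\<Union>n. KB n)" using KB_UN b0 by auto
  then show ?thesis by simp
qed

lemma X_sp: "y \<in> space L \<Longrightarrow> X y \<in> space MA" and Y_sp: "y \<in> space L \<Longrightarrow> Y y \<in> space MB"
  and Z_sp: "y \<in> space L \<Longrightarrow> Z y \<in> space MC"
  using measurable_space[OF X] measurable_space[OF Y] measurable_space[OF Z] by auto

text \<open>The two parts are formed as densities rather than restricted spaces, so they keep the
  measurable sets of \<open>L\<close> and \<open>nn_integral_split\<close> needs no change of
  carrier.\<close>

definition L1 :: "'y measure" where "L1 = density L (\<lambda>y. indicator (space MC - {c0}) (Z y))"
definition L0 :: "'y measure" where "L0 = density L (\<lambda>y. indicator {c0} (Z y))"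

lemma sets_L1[simp, measurable_cong]: "sets L1 = sets L" and space_L1[simp]: "space L1 = space L"
  and sets_L0[simp, measurable_cong]: "sets L0 = sets L" and space_L0[simp]: "space L0 = space L"
  by (simp_all add: L1_def L0_def)

lemma nn_integral_L1: "g \<in> borel_measurable L \<Longrightarrow>
  (\<integral>\<^sup>+y. g y \<partial>L1) = (\<integral>\<^sup>+y. indicator (space MC - {c0}) (Z y) * g y \<partial>L)"
  unfolding L1_def by (rule nn_integral_density) measurable

lemma nn_integral_L0: "g \<in> borel_measurable L \<Longrightarrow>
  (\<integral>\<^sup>+y. g y \<partial>L0) = (\<integral>\<^sup>+y. indicator {c0} (Z y) * g y \<partial>L)"
  unfolding L0_def by (rule nn_integral_density) measurable

lemma nn_integral_split:
  assumes [measurable]: "g \<in> borel_measurable L"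
  shows "(\<integral>\<^sup>+y. g y \<partial>L) = (\<integral>\<^sup>+y. g y \<partial>L0) + (\<integral>\<^sup>+y. g y \<partial>L1)"
proof -
  have "(\<integral>\<^sup>+y. g y \<partial>L) = (\<integral>\<^sup>+y. indicator {c0} (Z y) * g y + indicator (space MC - {c0}) (Z y) * g y \<partial>L)"
    using Z_sp by (intro nn_integral_cong) (auto simp: indicator_def)
  then show ?thesis
    by (simp add: nn_integral_add nn_integral_L1 nn_integral_L0)
qed

lemma AE_L1: "AE y in L1. Z y \<noteq> c0"
  unfolding L1_def by (subst AE_density) (auto simp: indicator_def)

lemma AE_L0: "AE y in L0. Z y = c0"
  unfolding L0_def by (subst AE_density) (auto simp: indicator_def)

lemma L1_cover: "AE y in L1. Z y \<in> (\<Union>n. KC n)"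
  using AE_L1 AE_space by eventually_elim (use Z_sp in \<open>auto simp: KC_UN\<close>)

lemma L1_fin: "(\<integral>\<^sup>+y. indicator (KC n) (Z y) \<partial>L1) < \<infinity>"
proof -
  have "(\<integral>\<^sup>+y. indicator (KC n) (Z y) \<partial>L1) \<le> (\<integral>\<^sup>+y. indicator (KC n) (Z y) \<partial>L)"
    by (subst nn_integral_L1) (auto simp: indicator_def intro!: nn_integral_mono)
  with KC_fin show ?thesis by (rule le_less_trans[rotated])
qed

lemma version_exists_L1:
  assumes [measurable]: "\<phi> \<in> borel_measurable L" and "\<And>y. \<phi> y \<le> 1"
  shows "\<exists>f. version L1 MC Z \<phi> f \<and> (\<forall>z. f z \<le> 1)"
proof (rule version_exists)
  \<comment> \<open>\<open>version_exists\<close> needs a cover of all of \<open>MC\<close>, whereas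
    the sets \<open>KC n\<close> miss \<open>c0\<close>. Adding this point is free, because
    \<open>L1\<close> gives no mass to \<open>Z = c0\<close>.\<close>
  show "(\<Union>n. insert c0 (KC n)) = space MC" using KC_UN c0 by auto
  show ins[measurable]: "insert c0 (KC n) \<in> sets MC" for n using sets.Un[OF c0_sets KC[of n]] by simp
  fix n
  have "emeasure L1 (Z -` insert c0 (KC n) \<inter> space L1) = (\<integral>\<^sup>+y. indicator (Z -` insert c0 (KC n) \<inter> space L1) y \<partial>L1)"
    by (rule nn_integral_indicator[symmetric]) measurable
  also have "\<dots> = (\<integral>\<^sup>+y. indicator (KC n) (Z y) \<partial>L1)"
    by (rule nn_integral_cong_AE) (use AE_L1 AE_space in \<open>eventually_elim, auto simp: indicator_def\<close>)
  finally show "emeasure L1 (Z -` insert c0 (KC n) \<inter> space L1) < \<infinity>"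
    using L1_fin[of n] by simp
qed (use assms in auto)

lemma L1_compl:
  assumes "q \<in> borel_measurable L" "q' \<in> borel_measurable L"
    and "\<And>y. q y \<le> 1" "\<And>y. q' y \<le> 1"
    and "\<And>H. H \<in> sets MC \<Longrightarrow>
      (\<integral>\<^sup>+y. q y * indicator H (Z y) \<partial>L1) = (\<integral>\<^sup>+y. q' y * indicator H (Z y) \<partial>L1)"
    and "w \<in> borel_measurable MC"
  shows "(\<integral>\<^sup>+y. (1 - q y) * w (Z y) \<partial>L1) = (\<integral>\<^sup>+y. (1 - q' y) * w (Z y) \<partial>L1)"
  by (rule localized_integral_compl[where K=KC])
    (use assms KC KC_inc L1_cover L1_fin in \<open>auto cong: measurable_cong_sets\<close>)

lemma version_compl_L1:
  assumes v: "version L1 MC Z \<phi> f" and [measurable]: "\<phi> \<in> borel_measurable L"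
    and le: "\<And>y. \<phi> y \<le> 1" "\<And>z. f z \<le> 1"
  shows "version L1 MC Z (\<lambda>y. 1 - \<phi> y) (\<lambda>z. 1 - f z)"
proof -
  have [measurable]: "f \<in> borel_measurable MC" using v by (rule version_measurable)
  show ?thesis
    by (rule versionI, measurable, rule L1_compl) (use versionD[OF v] le in auto)
qed

definition star :: bool where
  "star \<longleftrightarrow> emeasure L {y \<in> space L. X y \<noteq> a0 \<and> Y y \<noteq> b0 \<and> Z y = c0} = 0"

text \<open>The hub of the equivalences. When the block behind \<open>Z\<close> is empty,
  \<open>L1\<close> is the zero measure and only \<open>star\<close> remains.\<close>

definition block_ci :: bool where
  "block_ci \<longleftrightarrow> ci L1 MA X MB Y MC Z \<and> star"

text \<open>On \<open>Z = c0\<close> the factor \<open>w (Z y)\<close> is the constant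
  \<open>w c0\<close>, and this set has measure 0 or \<infinity>, so
  \<open>nn_integral_const_mult_split\<close> applies with \<open>c = w c0\<close>.\<close>

lemma L0_integral_one:
  fixes T :: "'y \<Rightarrow> 't" and v :: "'t \<Rightarrow> ennreal"
  assumes [measurable]: "T \<in> L \<rightarrow>\<^sub>M MT" "v \<in> borel_measurable MT" "w \<in> borel_measurable MC"
    and le: "\<And>t. v t \<le> 1" "\<And>z. w z \<le> 1"
  shows "(\<integral>\<^sup>+y. 1 - v (T y) * w (Z y) \<partial>L0) = (\<integral>\<^sup>+y. 1 - v (T y) \<partial>L0) + (\<integral>\<^sup>+y. 1 - w (Z y) \<partial>L0)"
proof -
  let ?S = "{y \<in> space L. Z y = c0}"
  have [measurable]: "?S \<in> sets L" by measurable
  have *: "(\<integral>\<^sup>+y. g y \<partial>L0) = (\<integral>\<^sup>+y. g' y * indicator ?S y \<partial>L)"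
    if [measurable]: "g \<in> borel_measurable L" and "\<And>y. y \<in> space L \<Longrightarrow> Z y = c0 \<Longrightarrow> g y = g' y" for g g'
    using that by (subst nn_integral_L0) (auto intro!: nn_integral_cong simp: indicator_def)
  have "(\<integral>\<^sup>+y. 1 - v (T y) * w (Z y) \<partial>L0) = (\<integral>\<^sup>+y. (1 - w c0 * v (T y)) * indicator ?S y \<partial>L)"
    by (rule *) (auto simp: mult.commute)
  also have "\<dots> = (\<integral>\<^sup>+y. (1 - w c0) * indicator ?S y \<partial>L) + (\<integral>\<^sup>+y. (1 - v (T y)) * indicator ?S y \<partial>L)"
    by (rule nn_integral_const_mult_split) (use inf_C le in auto)
  also have "(\<integral>\<^sup>+y. (1 - w c0) * indicator ?S y \<partial>L) = (\<integral>\<^sup>+y. 1 - w (Z y) \<partial>L0)"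
    by (rule *[symmetric]) auto
  also have "(\<integral>\<^sup>+y. (1 - v (T y)) * indicator ?S y \<partial>L) = (\<integral>\<^sup>+y. 1 - v (T y) \<partial>L0)"
    by (rule *[symmetric]) auto
  finally show ?thesis by (simp add: add.commute)
qed

text \<open>By \<open>star\<close> and \<open>never\<close>, almost every point with
  \<open>Z = c0\<close> has exactly one of \<open>X\<close>, \<open>Y\<close> away from its
  distinguished value. On the part \<open>?A\<close> the factor of \<open>Y\<close> is the constant
  \<open>v b0\<close>, on \<open>?B\<close> the factor of \<open>X\<close> is the constant
  \<open>u a0\<close>. Each part has measure 0 or \<infinity>, so the constants split off, and the
  summands recombine into the two integrals claimed.\<close>

lemma L0_integral_star:
  fixes u v w :: "_ \<Rightarrow> ennreal"
  assumes star: star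
    and [measurable]: "u \<in> borel_measurable MA" "v \<in> borel_measurable MB" "w \<in> borel_measurable MC"
    and le: "\<And>t. u t \<le> 1" "\<And>t. v t \<le> 1" "\<And>z. w z \<le> 1"
  shows "(\<integral>\<^sup>+y. 1 - u (X y) * v (Y y) * w (Z y) \<partial>L0) =
    (\<integral>\<^sup>+y. 1 - v (Y y) \<partial>L0) + (\<integral>\<^sup>+y. 1 - u (X y) * w (Z y) \<partial>L0)"
proof -
  let ?A = "{y \<in> space L. X y \<noteq> a0 \<and> Y y = b0 \<and> Z y = c0}"
  let ?B = "{y \<in> space L. X y = a0 \<and> Y y \<noteq> b0 \<and> Z y = c0}"
  have [measurable]: "?A \<in> sets L" "?B \<in> sets L" by measurable
  have ae: "AE y in L. \<not> (X y \<noteq> a0 \<and> Y y \<noteq> b0 \<and> Z y = c0)"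
    using star unfolding star_def by (subst AE_iff_measurable[OF _ refl]) auto
  have *: "(\<integral>\<^sup>+y. g y \<partial>L0) = (\<integral>\<^sup>+y. gA y * indicator ?A y \<partial>L) + (\<integral>\<^sup>+y. gB y * indicator ?B y \<partial>L)"
    if [measurable]: "g \<in> borel_measurable L" "gA \<in> borel_measurable L" "gB \<in> borel_measurable L"
      and A: "\<And>y. y \<in> ?A \<Longrightarrow> g y = gA y" and B: "\<And>y. y \<in> ?B \<Longrightarrow> g y = gB y" for g gA gB
  proof -
    have "(\<integral>\<^sup>+y. g y \<partial>L0) = (\<integral>\<^sup>+y. gA y * indicator ?A y + gB y * indicator ?B y \<partial>L)"
    proof (subst nn_integral_L0, measurable, rule nn_integral_cong_AE)
      show "AE y in L. indicator {c0} (Z y) * g y = gA y * indicator ?A y + gB y * indicator ?B y"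
        using ae AE_space
      proof eventually_elim
        case (elim y)
        then show ?case using A[of y] B[of y] never[of y] by (auto simp: indicator_def)
      qed
    qed
    then show ?thesis by (simp add: nn_integral_add)
  qed
  have le2: "u a * w c \<le> 1" for a c using mult_mono[OF le(1)[of a] le(3)[of c]] by simp
  have "(\<integral>\<^sup>+y. 1 - u (X y) * v (Y y) * w (Z y) \<partial>L0) =
     (\<integral>\<^sup>+y. (1 - v b0 * (u (X y) * w c0)) * indicator ?A y \<partial>L) +
     (\<integral>\<^sup>+y. (1 - (u a0 * w c0) * v (Y y)) * indicator ?B y \<partial>L)"
    by (rule *) (auto simp: mult_ac)
  also have "(\<integral>\<^sup>+y. (1 - v b0 * (u (X y) * w c0)) * indicator ?A y \<partial>L) =
      (\<integral>\<^sup>+y. (1 - v b0) * indicator ?A y \<partial>L) + (\<integral>\<^sup>+y. (1 - u (X y) * w c0) * indicator ?A y \<partial>L)"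
    by (rule nn_integral_const_mult_split) (use inf_A le le2 in auto)
  also have "(\<integral>\<^sup>+y. (1 - (u a0 * w c0) * v (Y y)) * indicator ?B y \<partial>L) =
      (\<integral>\<^sup>+y. (1 - u a0 * w c0) * indicator ?B y \<partial>L) + (\<integral>\<^sup>+y. (1 - v (Y y)) * indicator ?B y \<partial>L)"
    by (rule nn_integral_const_mult_split) (use inf_B le le2 in auto)
  finally have "(\<integral>\<^sup>+y. 1 - u (X y) * v (Y y) * w (Z y) \<partial>L0) =
      ((\<integral>\<^sup>+y. (1 - v b0) * indicator ?A y \<partial>L) + (\<integral>\<^sup>+y. (1 - v (Y y)) * indicator ?B y \<partial>L)) +
      ((\<integral>\<^sup>+y. (1 - u (X y) * w c0) * indicator ?A y \<partial>L) + (\<integral>\<^sup>+y. (1 - u a0 * w c0) * indicator ?B y \<partial>L))"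
    by (simp add: add_ac)
  also have "(\<integral>\<^sup>+y. (1 - v b0) * indicator ?A y \<partial>L) + (\<integral>\<^sup>+y. (1 - v (Y y)) * indicator ?B y \<partial>L) =
      (\<integral>\<^sup>+y. 1 - v (Y y) \<partial>L0)"
    by (rule *[symmetric]) auto
  also have "(\<integral>\<^sup>+y. (1 - u (X y) * w c0) * indicator ?A y \<partial>L) + (\<integral>\<^sup>+y. (1 - u a0 * w c0) * indicator ?B y \<partial>L) =
      (\<integral>\<^sup>+y. 1 - u (X y) * w (Z y) \<partial>L0)"
    by (rule *[symmetric]) auto
  finally show ?thesis .
qed

text \<open>With the value 1 at \<open>c0\<close>, points with \<open>Z = c0\<close> do not contribute to products over the points of a process.\<close>

definition ext1 :: "('c \<Rightarrow> ennreal) \<Rightarrow> 'c \<Rightarrow> ennreal" where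
  "ext1 f z = (if z = c0 then 1 else f z)"

lemma ext1_measurable[measurable]:
  assumes [measurable]: "f \<in> borel_measurable MC"
  shows "ext1 f \<in> borel_measurable MC"
proof -
  have "{z \<in> space MC. z = c0} = {c0}" using c0 by auto
  then have [measurable]: "Measurable.pred MC (\<lambda>z. z = c0)"
    using c0_sets by (simp add: pred_def)
  show ?thesis unfolding ext1_def by measurable
qed

lemma ext1_le: "(\<And>z. f z \<le> 1) \<Longrightarrow> ext1 f z \<le> 1"
  by (simp add: ext1_def)

text \<open>A joint Laplace exponent of the processes of \<open>T\<close> and \<open>Z\<close>
  becomes a constant plus an exponent for \<open>Z\<close> alone, with \<open>ext1 f\<close> joining
  the test function. Off \<open>c0\<close> the function \<open>v\<close> is exchanged for its
  version; on \<open>c0\<close>, \<open>L0_integral_one\<close> separates it. This is the origin of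
  the formula \<open>cexp\<close>.\<close>

lemma exponent_one:
  fixes T :: "'y \<Rightarrow> 't" and v :: "'t \<Rightarrow> ennreal"
  assumes [measurable]: "T \<in> L \<rightarrow>\<^sub>M MT" "v \<in> borel_measurable MT" "w \<in> borel_measurable MC"
    and le: "\<And>t. v t \<le> 1" "\<And>z. w z \<le> 1" "\<And>z. f z \<le> 1"
    and f: "version L1 MC Z (\<lambda>y. v (T y)) f"
  shows "(\<integral>\<^sup>+y. 1 - v (T y) * w (Z y) \<partial>L) = (\<integral>\<^sup>+y. 1 - v (T y) \<partial>L0) + (\<integral>\<^sup>+y. 1 - ext1 f (Z y) * w (Z y) \<partial>L)"
proof -
  have [measurable]: "f \<in> borel_measurable MC" using f by (rule version_measurable)
  have le2: "v t * w c \<le> 1" "f c * w c \<le> 1" for t c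
    using mult_mono[OF le(1)[of t] le(2)[of c]] mult_mono[OF le(3)[of c] le(2)[of c]] by auto
  have "(\<integral>\<^sup>+y. (1 - v (T y) * w (Z y)) * 1 \<partial>L1) = (\<integral>\<^sup>+y. (1 - f (Z y) * w (Z y)) * 1 \<partial>L1)"
  proof (rule L1_compl)
    fix H assume [measurable]: "H \<in> sets MC"
    show "(\<integral>\<^sup>+y. v (T y) * w (Z y) * indicator H (Z y) \<partial>L1) = (\<integral>\<^sup>+y. f (Z y) * w (Z y) * indicator H (Z y) \<partial>L1)"
      using versionD[OF f, of "\<lambda>z. w z * indicator H z"] by (simp add: mult.assoc)
  qed (use le2 in auto)
  also have "\<dots> = (\<integral>\<^sup>+y. 1 - ext1 f (Z y) * w (Z y) \<partial>L1)"
    by (rule nn_integral_cong_AE) (use AE_L1 in \<open>eventually_elim, auto simp: ext1_def\<close>)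
  finally have 1: "(\<integral>\<^sup>+y. 1 - v (T y) * w (Z y) \<partial>L1) = (\<integral>\<^sup>+y. 1 - ext1 f (Z y) * w (Z y) \<partial>L1)" by simp
  have "(\<integral>\<^sup>+y. 1 - v (T y) * w (Z y) \<partial>L0) = (\<integral>\<^sup>+y. 1 - v (T y) \<partial>L0) + (\<integral>\<^sup>+y. 1 - w (Z y) \<partial>L0)"
    by (rule L0_integral_one[where T=T and MT=MT and v=v]) (use le in auto)
  also have "(\<integral>\<^sup>+y. 1 - w (Z y) \<partial>L0) = (\<integral>\<^sup>+y. 1 - ext1 f (Z y) * w (Z y) \<partial>L0)"
    by (rule nn_integral_cong_AE) (use AE_L0 in \<open>eventually_elim, auto simp: ext1_def\<close>)
  finally show ?thesis using 1
    by (subst (1 2) nn_integral_split) (auto simp: add_ac)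
qed

text \<open>The same separation in the presence of a third factor \<open>u (X y)\<close>:
  \<open>ci_half\<close> permits exchanging \<open>v\<close> for its version on \<open>L1\<close>,
  and \<open>star\<close> permits splitting it off on \<open>L0\<close>. That the constant and
  \<open>ext1 f\<close> are those of \<open>exponent_one\<close> expresses that \<open>X\<close>
  adds no information about \<open>Y\<close>.\<close>

lemma exponent_star:
  fixes u v w :: "_ \<Rightarrow> ennreal"
  assumes bc: block_ci
    and [measurable]: "u \<in> borel_measurable MA" "v \<in> borel_measurable MB" "w \<in> borel_measurable MC"
    and le: "\<And>t. u t \<le> 1" "\<And>t. v t \<le> 1" "\<And>z. w z \<le> 1" "\<And>z. f z \<le> 1"
    and f: "version L1 MC Z (\<lambda>y. v (Y y)) f"
  shows "(\<integral>\<^sup>+y. 1 - u (X y) * v (Y y) * w (Z y) \<partial>L) =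
    (\<integral>\<^sup>+y. 1 - v (Y y) \<partial>L0) + (\<integral>\<^sup>+y. 1 - u (X y) * ext1 f (Z y) * w (Z y) \<partial>L)"
proof -
  have ci: "ci L1 MA X MB Y MC Z" and star using bc by (auto simp: block_ci_def)
  have [measurable]: "f \<in> borel_measurable MC" using f by (rule version_measurable)
  have le2: "u t * v s * w c \<le> 1" "u t * f c * w c \<le> 1" for t s c
    using mult_mono[OF mult_mono[OF le(1)[of t] le(2)[of s]] le(3)[of c]]
      mult_mono[OF mult_mono[OF le(1)[of t] le(4)[of c]] le(3)[of c]] by auto
  have "(\<integral>\<^sup>+y. (1 - u (X y) * v (Y y) * w (Z y)) * 1 \<partial>L1) = (\<integral>\<^sup>+y. (1 - u (X y) * f (Z y) * w (Z y)) * 1 \<partial>L1)"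
  proof (rule L1_compl)
    fix H assume [measurable]: "H \<in> sets MC"
    have "(\<integral>\<^sup>+y. u (X y) * v (Y y) * (w (Z y) * indicator H (Z y)) \<partial>L1) =
        (\<integral>\<^sup>+y. u (X y) * f (Z y) * (w (Z y) * indicator H (Z y)) \<partial>L1)"
      by (rule ci_half[OF ci _ _ _ _ _ _ f, where w="\<lambda>z. w z * indicator H z"]) measurable
    then show "(\<integral>\<^sup>+y. u (X y) * v (Y y) * w (Z y) * indicator H (Z y) \<partial>L1) =
        (\<integral>\<^sup>+y. u (X y) * f (Z y) * w (Z y) * indicator H (Z y) \<partial>L1)"
      by (simp add: mult.assoc)
  qed (use le2 in auto)
  also have "\<dots> = (\<integral>\<^sup>+y. 1 - u (X y) * ext1 f (Z y) * w (Z y) \<partial>L1)"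
    by (rule nn_integral_cong_AE) (use AE_L1 in \<open>eventually_elim, auto simp: ext1_def\<close>)
  finally have 1: "(\<integral>\<^sup>+y. 1 - u (X y) * v (Y y) * w (Z y) \<partial>L1) = (\<integral>\<^sup>+y. 1 - u (X y) * ext1 f (Z y) * w (Z y) \<partial>L1)" by simp
  have "(\<integral>\<^sup>+y. 1 - u (X y) * v (Y y) * w (Z y) \<partial>L0) = (\<integral>\<^sup>+y. 1 - v (Y y) \<partial>L0) + (\<integral>\<^sup>+y. 1 - u (X y) * w (Z y) \<partial>L0)"
    by (rule L0_integral_star) (use le \<open>star\<close> in auto)
  also have "(\<integral>\<^sup>+y. 1 - u (X y) * w (Z y) \<partial>L0) = (\<integral>\<^sup>+y. 1 - u (X y) * ext1 f (Z y) * w (Z y) \<partial>L0)"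
    by (rule nn_integral_cong_AE) (use AE_L0 in \<open>eventually_elim, auto simp: ext1_def\<close>)
  finally show ?thesis using 1
    by (subst (1 2) nn_integral_split) (auto simp: add_ac)
qed

end

section \<open>Projected processes and their conditional Laplace functionals\<close>

text \<open>A decomposition into finite measures is mapped to one. Unlike sigma-finiteness,
  s-finiteness thus survives when infinitely many points are projected to one place.\<close>

lemma proj_measurable:
  assumes T[measurable]: "T \<in> N \<rightarrow>\<^sub>M MT" and \<xi>: "\<xi> \<in> P \<rightarrow>\<^sub>M point_measure_algebra N"
  shows "(\<lambda>w. distr (\<xi> w) MT T) \<in> P \<rightarrow>\<^sub>M point_measure_algebra MT"
proof (rule measurable_point_measure_algebra)
  have em: "emeasure (distr (\<xi> w) MT T) G = emeasure (\<xi> w) (T -` G \<inter> space N)"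
    if "w \<in> space P" "G \<in> sets MT" for w G
  proof -
    have s: "sets (\<xi> w) = sets N" by (rule sets_point_measure[OF measurable_space[OF \<xi> that(1)]])
    show ?thesis
      using T that(2) by (subst emeasure_distr) (auto simp: sets_eq_imp_space_eq[OF s] measurable_cong_sets[OF s refl])
  qed
  show "(\<lambda>w. emeasure (distr (\<xi> w) MT T) G) \<in> borel_measurable P" if G: "G \<in> sets MT" for G
  proof -
    have "(\<lambda>w. emeasure (\<xi> w) (T -` G \<inter> space N)) \<in> borel_measurable P"
      using measurable_compose[OF \<xi> emeasure_point_measurable[OF measurable_sets[OF T G]]] .
    then show ?thesis using em G by (subst measurable_cong) auto
  qed
  fix w assume w: "w \<in> space P"
  have m: "\<xi> w \<in> point_measures N" using measurable_space[OF \<xi> w] by (simp add: space_point_measure_algebra)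
  then have sN: "sets (\<xi> w) = sets N" and "s_finite (\<xi> w)" by (auto simp: point_measures_def)
  then obtain \<mu> :: "nat \<Rightarrow> 'a measure" where
    "\<forall>n. sets (\<mu> n) = sets (\<xi> w) \<and> finite_measure (\<mu> n)"
    "\<forall>G\<in>sets (\<xi> w). emeasure (\<xi> w) G = (\<Sum>n. emeasure (\<mu> n) G)"
    unfolding s_finite_def by blast
  then have \<mu>: "\<And>n. sets (\<mu> n) = sets N" "\<And>n. finite_measure (\<mu> n)"
    "\<And>G. G \<in> sets N \<Longrightarrow> emeasure (\<xi> w) G = (\<Sum>n. emeasure (\<mu> n) G)"
    unfolding sN by blast+
  have sp: "space (\<mu> n) = space N" "T \<in> \<mu> n \<rightarrow>\<^sub>M MT" for n
    using \<mu>(1)[of n] T by (auto dest: sets_eq_imp_space_eq cong: measurable_cong_sets)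
  have "s_finite (distr (\<xi> w) MT T)"
    unfolding s_finite_def
  proof (intro exI[of _ "\<lambda>n. distr (\<mu> n) MT T"] conjI allI ballI)
    show "finite_measure (distr (\<mu> n) MT T)" for n
      using \<mu>(2) sp by (intro finite_measure.finite_measure_distr)
    show "emeasure (distr (\<xi> w) MT T) G = (\<Sum>n. emeasure (distr (\<mu> n) MT T) G)"
      if "G \<in> sets (distr (\<xi> w) MT T)" for G
      using that em[OF w, of G] measurable_sets[OF T, of G] sp by (simp add: \<mu>(3) emeasure_distr)
  qed simp
  moreover have "emeasure (distr (\<xi> w) MT T) G \<in> range ennreal_of_enat" if "G \<in> sets MT" for G
    using em[OF w that] m measurable_sets[OF T that] by (simp add: point_measures_def)
  ultimately show "distr (\<xi> w) MT T \<in> point_measures MT"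
    by (simp add: point_measures_def)
qed

lemma nn_integral_proj:
  assumes T[measurable]: "T \<in> N \<rightarrow>\<^sub>M MT" and \<xi>: "\<xi> \<in> P \<rightarrow>\<^sub>M point_measure_algebra N"
    and w: "w \<in> space P" and f[measurable]: "f \<in> borel_measurable MT"
  shows "(\<integral>\<^sup>+t. f t \<partial>distr (\<xi> w) MT T) = (\<integral>\<^sup>+y. f (T y) \<partial>\<xi> w)"
  using sets_point_measure[OF measurable_space[OF \<xi> w]] T f
  by (intro nn_integral_distr) (auto cong: measurable_cong_sets)

lemma mult_le_1_ennreal: "a \<le> 1 \<Longrightarrow> b \<le> 1 \<Longrightarrow> a * b \<le> (1::ennreal)"
  using mult_mono[of a 1 b 1] by simp

lemma nexp_eqD: "nexp a = nexp b \<Longrightarrow> a = b"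
  by (simp add: nexp_inject)

locale punctured_triple_poisson = punctured_triple L MA X a0 KA MB Y b0 KB MC Z c0 KC
  for L :: "'y measure"
    and MA :: "'a measure" and X :: "'y \<Rightarrow> 'a" and a0 :: 'a and KA :: "nat \<Rightarrow> 'a set"
    and MB :: "'b measure" and Y :: "'y \<Rightarrow> 'b" and b0 :: 'b and KB :: "nat \<Rightarrow> 'b set"
    and MC :: "'c measure" and Z :: "'y \<Rightarrow> 'c" and c0 :: 'c and KC :: "nat \<Rightarrow> 'c set" +
  fixes P :: "'w measure" and \<xi> :: "'w \<Rightarrow> 'y measure"
  assumes pp: "poisson_process P L \<xi>"
begin

sublocale P: prob_space P using pp by (rule poisson_process_prob)

lemma \<xi>[measurable]: "\<xi> \<in> P \<rightarrow>\<^sub>M point_measure_algebra L"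
  using pp by (rule poisson_process_measurable)

definition xA where "xA w = distr (\<xi> w) MA X"
definition xB where "xB w = distr (\<xi> w) MB Y"
definition xC where "xC w = distr (\<xi> w) MC Z"

lemma xA[measurable]: "xA \<in> P \<rightarrow>\<^sub>M point_measure_algebra MA"
  and xB[measurable]: "xB \<in> P \<rightarrow>\<^sub>M point_measure_algebra MB"
  and xC[measurable]: "xC \<in> P \<rightarrow>\<^sub>M point_measure_algebra MC"
  unfolding xA_def[abs_def] xB_def[abs_def] xC_def[abs_def]
  by (rule proj_measurable[OF X \<xi>] proj_measurable[OF Y \<xi>] proj_measurable[OF Z \<xi>])+

lemma nexp_integral_add:
  assumes w: "w \<in> space P" and [measurable]: "f \<in> borel_measurable L" "g \<in> borel_measurable L"
  shows "nexp (\<integral>\<^sup>+y. f y + g y \<partial>\<xi> w) = nexp (\<integral>\<^sup>+y. f y \<partial>\<xi> w) * nexp (\<integral>\<^sup>+y. g y \<partial>\<xi> w)"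
proof -
  have [measurable_cong]: "sets (\<xi> w) = sets L" by (rule sets_point_measure[OF measurable_space[OF \<xi> w]])
  show ?thesis by (subst nn_integral_add) (auto simp: nexp_add)
qed

lemma laplace3:
  assumes [measurable]: "f \<in> borel_measurable MA" "g \<in> borel_measurable MB" "k \<in> borel_measurable MC"
  shows "(\<integral>\<^sup>+w. nexp (\<integral>\<^sup>+x. f x \<partial>xA w) * nexp (\<integral>\<^sup>+x. g x \<partial>xB w) * nexp (\<integral>\<^sup>+x. k x \<partial>xC w) \<partial>P) =
    nexp (\<integral>\<^sup>+y. 1 - nexp (f (X y)) * nexp (g (Y y)) * nexp (k (Z y)) \<partial>L)"
proof -
  have "(\<integral>\<^sup>+w. nexp (\<integral>\<^sup>+x. f x \<partial>xA w) * nexp (\<integral>\<^sup>+x. g x \<partial>xB w) * nexp (\<integral>\<^sup>+x. k x \<partial>xC w) \<partial>P) =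
    (\<integral>\<^sup>+w. nexp (\<integral>\<^sup>+y. f (X y) + g (Y y) + k (Z y) \<partial>\<xi> w) \<partial>P)"
  proof (rule nn_integral_cong)
    fix w assume w: "w \<in> space P"
    show "nexp (\<integral>\<^sup>+x. f x \<partial>xA w) * nexp (\<integral>\<^sup>+x. g x \<partial>xB w) * nexp (\<integral>\<^sup>+x. k x \<partial>xC w) =
      nexp (\<integral>\<^sup>+y. f (X y) + g (Y y) + k (Z y) \<partial>\<xi> w)"
      unfolding xA_def xB_def xC_def
      by (simp add: nexp_integral_add[OF w] nn_integral_proj[OF X \<xi> w] nn_integral_proj[OF Y \<xi> w] nn_integral_proj[OF Z \<xi> w])
  qed
  then show ?thesis by (simp add: poisson_laplace[OF pp] nexp_add)
qed

lemma laplace_AC: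
  assumes [measurable]: "f \<in> borel_measurable MA" "k \<in> borel_measurable MC"
  shows "(\<integral>\<^sup>+w. nexp (\<integral>\<^sup>+x. f x \<partial>xA w) * nexp (\<integral>\<^sup>+x. k x \<partial>xC w) \<partial>P) =
    nexp (\<integral>\<^sup>+y. 1 - nexp (f (X y)) * nexp (k (Z y)) \<partial>L)"
  using laplace3[of f "\<lambda>_. 0" k] by simp

lemma laplace_C:
  assumes [measurable]: "k \<in> borel_measurable MC"
  shows "(\<integral>\<^sup>+w. nexp (\<integral>\<^sup>+x. k x \<partial>xC w) \<partial>P) = nexp (\<integral>\<^sup>+y. 1 - nexp (k (Z y)) \<partial>L)"
  using laplace_AC[of "\<lambda>_. 0" k] by simp

text \<open>
  For \<open>v = nexp \<circ> g\<close> and a version \<open>f\<close> of \<open>v\<close> given \<open>Z \<noteq> c0\<close>, the Laplace functional of the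
  projected process at \<open>g\<close> has the following conditional expectation given the process of \<open>Z\<close>.
\<close>

definition cexp :: "('y \<Rightarrow> ennreal) \<Rightarrow> ('c \<Rightarrow> ennreal) \<Rightarrow> 'c measure \<Rightarrow> ennreal" where
  "cexp v f m = nexp (\<integral>\<^sup>+y. 1 - v y \<partial>L0) * nexp (\<integral>\<^sup>+z. nlog (ext1 f z) \<partial>m)"

lemma cexp_measurable[measurable]:
  assumes [measurable]: "f \<in> borel_measurable MC"
  shows "cexp v f \<in> borel_measurable (point_measure_algebra MC)"
  unfolding cexp_def[abs_def] by measurable

lemma cexp_le_1: "cexp v f m \<le> 1"
  unfolding cexp_def using mult_mono[OF nexp_le_1 nexp_le_1] by simp

lemma cexp_mult:
  assumes w: "w \<in> space P" and [measurable]: "f \<in> borel_measurable MC" "k \<in> borel_measurable MC"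
  shows "cexp v f (xC w) * nexp (\<integral>\<^sup>+x. k x \<partial>xC w) =
    nexp (\<integral>\<^sup>+y. 1 - v y \<partial>L0) * nexp (\<integral>\<^sup>+x. nlog (ext1 f x) + k x \<partial>xC w)"
proof -
  have [measurable_cong]: "sets (xC w) = sets MC" by (simp add: xC_def)
  show ?thesis unfolding cexp_def by (subst nn_integral_add) (auto simp: nexp_add mult_ac)
qed

text \<open>By \<open>laplace_ext\<close> it is enough to test against exponentials of the process
  of \<open>Z\<close>. Both sides are then explicit: \<open>exponent_one\<close> splits the exponent
  of the left side, and its second part is read backwards through \<open>laplace_C\<close> as the
  Laplace functional at \<open>nlog (ext1 f x) + k x\<close>.\<close>

lemma version_cexp:
  fixes T :: "'y \<Rightarrow> 't"
  assumes T[measurable]: "T \<in> L \<rightarrow>\<^sub>M MT" and g[measurable]: "g \<in> borel_measurable MT"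
    and f: "version L1 MC Z (\<lambda>y. nexp (g (T y))) f" and le: "\<And>z. f z \<le> 1"
  shows "version P (point_measure_algebra MC) xC (\<lambda>w. nexp (\<integral>\<^sup>+x. g x \<partial>distr (\<xi> w) MT T)) (cexp (\<lambda>y. nexp (g (T y))) f)"
    (is "version _ _ _ ?h ?V")
proof -
  have [measurable]: "f \<in> borel_measurable MC" using f by (rule version_measurable)
  have [measurable]: "(\<lambda>w. distr (\<xi> w) MT T) \<in> P \<rightarrow>\<^sub>M point_measure_algebra MT"
    by (rule proj_measurable[OF T \<xi>])
  have [measurable]: "?h \<in> borel_measurable P"
    using measurable_compose[OF proj_measurable[OF T \<xi>] measurable_nexp_integral[OF g]] .
  show ?thesis
    unfolding version_def
  proof (intro conjI ballI)
    fix W :: "_ \<Rightarrow> ennreal" assume [measurable]: "W \<in> borel_measurable (point_measure_algebra MC)"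
    show "(\<integral>\<^sup>+w. ?h w * W (xC w) \<partial>P) = (\<integral>\<^sup>+w. ?V (xC w) * W (xC w) \<partial>P)"
    proof (rule laplace_ext[where N=MC])
      fix k :: "'c \<Rightarrow> ennreal" assume [measurable]: "k \<in> borel_measurable MC"
      have "(\<integral>\<^sup>+w. ?h w * nexp (\<integral>\<^sup>+x. k x \<partial>xC w) \<partial>P) = (\<integral>\<^sup>+w. nexp (\<integral>\<^sup>+y. g (T y) + k (Z y) \<partial>\<xi> w) \<partial>P)"
        unfolding xC_def
        by (intro nn_integral_cong) (simp add: nexp_integral_add nn_integral_proj[OF T \<xi>] nn_integral_proj[OF Z \<xi>])
      also have "\<dots> = nexp (\<integral>\<^sup>+y. 1 - nexp (g (T y)) * nexp (k (Z y)) \<partial>L)"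
        by (simp add: poisson_laplace[OF pp] nexp_add)
      also have "(\<integral>\<^sup>+y. 1 - nexp (g (T y)) * nexp (k (Z y)) \<partial>L) =
          (\<integral>\<^sup>+y. 1 - nexp (g (T y)) \<partial>L0) + (\<integral>\<^sup>+y. 1 - ext1 f (Z y) * nexp (k (Z y)) \<partial>L)"
        by (rule exponent_one[where T=T and MT=MT and v="\<lambda>t. nexp (g t)" and w="\<lambda>z. nexp (k z)"]) (use f le in auto)
      also have "nexp \<dots> = nexp (\<integral>\<^sup>+y. 1 - nexp (g (T y)) \<partial>L0) * (\<integral>\<^sup>+w. nexp (\<integral>\<^sup>+x. nlog (ext1 f x) + k x \<partial>xC w) \<partial>P)"
        by (subst laplace_C) (auto simp: nexp_add nexp_nlog ext1_le le)
      also have "\<dots> = (\<integral>\<^sup>+w. nexp (\<integral>\<^sup>+y. 1 - nexp (g (T y)) \<partial>L0) * nexp (\<integral>\<^sup>+x. nlog (ext1 f x) + k x \<partial>xC w) \<partial>P)"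
        by (rule nn_integral_cmult[symmetric]) measurable
      also have "\<dots> = (\<integral>\<^sup>+w. ?V (xC w) * nexp (\<integral>\<^sup>+x. k x \<partial>xC w) \<partial>P)"
        by (rule nn_integral_cong) (simp add: cexp_mult)
      finally show "(\<integral>\<^sup>+w. ?h w * nexp (\<integral>\<^sup>+x. k x \<partial>xC w) \<partial>P) = (\<integral>\<^sup>+w. ?V (xC w) * nexp (\<integral>\<^sup>+x. k x \<partial>xC w) \<partial>P)" .
    qed (auto simp: cexp_le_1 P.prob_space_axioms)
  qed measurable
qed

text \<open>A version \<open>f\<close> of the indicator of \<open>F\<close> given \<open>xC\<close>
  exists anyway; it must also serve jointly with \<open>xB\<close>. Nested uses of
  \<open>laplace_ext\<close> reduce \<open>G\<close>, then \<open>H\<close> and \<open>F\<close>, to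
  exponentials. There \<open>exponent_star\<close> shows that the functional of \<open>xB\<close>
  may be replaced by its conditional expectation given \<open>xC\<close> even in the presence of
  \<open>xA\<close>. Exchanging \<open>F\<close> for \<open>f\<close> and undoing the replacement
  finishes the argument.\<close>

lemma block_ci_imp_process:
  assumes bc: block_ci
  shows "ci P (point_measure_algebra MA) xA (point_measure_algebra MB) xB (point_measure_algebra MC) xC"
proof (rule ciI)
  fix F assume F[measurable]: "F \<in> sets (point_measure_algebra MA)"
  have ind1: "(indicator F (xA w) :: ennreal) \<le> 1" for w by (auto simp: indicator_def)
  have m: "(\<lambda>w. indicator F (xA w) :: ennreal) \<in> borel_measurable P" by measurable
  obtain f where f: "version P (point_measure_algebra MC) xC (\<lambda>w. indicator F (xA w)) f" and f1: "\<And>z. f z \<le> 1"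
    using P.version_exists_prob[OF xC m ind1] by blast
  have [measurable]: "f \<in> borel_measurable (point_measure_algebra MC)" using f by (rule version_measurable)
  have ftop: "f z < top" for z using f1[of z] by (rule le_less_trans) simp
  have "(\<integral>\<^sup>+w. indicator F (xA w) * indicator G (xB w) * indicator H (xC w) \<partial>P) =
        (\<integral>\<^sup>+w. f (xC w) * indicator G (xB w) * indicator H (xC w) \<partial>P)"
    if G[measurable]: "G \<in> sets (point_measure_algebra MB)" and H[measurable]: "H \<in> sets (point_measure_algebra MC)" for G H
  proof -
    have "(\<integral>\<^sup>+w. (indicator F (xA w) * indicator H (xC w)) * indicator G (xB w) \<partial>P) =
        (\<integral>\<^sup>+w. (f (xC w) * indicator H (xC w)) * indicator G (xB w) \<partial>P)"
    proof (rule laplace_ext[where N=MB])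
      fix g :: "'b \<Rightarrow> ennreal" assume g[measurable]: "g \<in> borel_measurable MB"
      obtain e where e: "version L1 MC Z (\<lambda>y. nexp (g (Y y))) e" and e1: "\<And>z. e z \<le> 1"
        using version_exists_L1[of "\<lambda>y. nexp (g (Y y))"] by auto
      have [measurable]: "e \<in> borel_measurable MC" using e by (rule version_measurable)
      let ?V = "cexp (\<lambda>y. nexp (g (Y y))) e"
      let ?B = "\<lambda>w. nexp (\<integral>\<^sup>+x. g x \<partial>xB w)"
      have V: "version P (point_measure_algebra MC) xC ?B ?V"
        unfolding xB_def by (rule version_cexp[OF Y g e e1])
      have 1: "(\<integral>\<^sup>+w. ?B w * nexp (\<integral>\<^sup>+x. h x \<partial>xA w) * indicator H (xC w) \<partial>P) =
          (\<integral>\<^sup>+w. ?V (xC w) * nexp (\<integral>\<^sup>+x. h x \<partial>xA w) * indicator H (xC w) \<partial>P)"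
        if h[measurable]: "h \<in> borel_measurable MA" for h
      proof (rule laplace_ext[where N=MC])
        fix k :: "'c \<Rightarrow> ennreal" assume [measurable]: "k \<in> borel_measurable MC"
        have "(\<integral>\<^sup>+w. ?B w * nexp (\<integral>\<^sup>+x. h x \<partial>xA w) * nexp (\<integral>\<^sup>+x. k x \<partial>xC w) \<partial>P) =
            nexp (\<integral>\<^sup>+y. 1 - nexp (h (X y)) * nexp (g (Y y)) * nexp (k (Z y)) \<partial>L)"
          using laplace3[of h g k] by (simp add: mult_ac)
        also have "(\<integral>\<^sup>+y. 1 - nexp (h (X y)) * nexp (g (Y y)) * nexp (k (Z y)) \<partial>L) =
            (\<integral>\<^sup>+y. 1 - nexp (g (Y y)) \<partial>L0) + (\<integral>\<^sup>+y. 1 - nexp (h (X y)) * ext1 e (Z y) * nexp (k (Z y)) \<partial>L)"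
          by (rule exponent_star[OF bc, where u="\<lambda>t. nexp (h t)" and v="\<lambda>t. nexp (g t)" and w="\<lambda>z. nexp (k z)"])
            (use e e1 in auto)
        also have "nexp \<dots> = nexp (\<integral>\<^sup>+y. 1 - nexp (g (Y y)) \<partial>L0) *
            (\<integral>\<^sup>+w. nexp (\<integral>\<^sup>+x. h x \<partial>xA w) * nexp (\<integral>\<^sup>+x. nlog (ext1 e x) + k x \<partial>xC w) \<partial>P)"
          by (subst laplace_AC) (auto simp: nexp_add nexp_nlog ext1_le e1 mult_ac)
        also have "\<dots> = (\<integral>\<^sup>+w. nexp (\<integral>\<^sup>+y. 1 - nexp (g (Y y)) \<partial>L0) *
            (nexp (\<integral>\<^sup>+x. h x \<partial>xA w) * nexp (\<integral>\<^sup>+x. nlog (ext1 e x) + k x \<partial>xC w)) \<partial>P)"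
          by (rule nn_integral_cmult[symmetric]) measurable
        also have "\<dots> = (\<integral>\<^sup>+w. ?V (xC w) * nexp (\<integral>\<^sup>+x. h x \<partial>xA w) * nexp (\<integral>\<^sup>+x. k x \<partial>xC w) \<partial>P)"
        proof (rule nn_integral_cong)
          fix w assume w: "w \<in> space P"
          show "nexp (\<integral>\<^sup>+y. 1 - nexp (g (Y y)) \<partial>L0) *
            (nexp (\<integral>\<^sup>+x. h x \<partial>xA w) * nexp (\<integral>\<^sup>+x. nlog (ext1 e x) + k x \<partial>xC w)) =
            ?V (xC w) * nexp (\<integral>\<^sup>+x. h x \<partial>xA w) * nexp (\<integral>\<^sup>+x. k x \<partial>xC w)"
            using cexp_mult[OF w, of e k "\<lambda>y. nexp (g (Y y))"] by (simp add: mult_ac)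
        qed
        finally show "(\<integral>\<^sup>+w. ?B w * nexp (\<integral>\<^sup>+x. h x \<partial>xA w) * nexp (\<integral>\<^sup>+x. k x \<partial>xC w) \<partial>P) =
          (\<integral>\<^sup>+w. ?V (xC w) * nexp (\<integral>\<^sup>+x. h x \<partial>xA w) * nexp (\<integral>\<^sup>+x. k x \<partial>xC w) \<partial>P)" .
      qed (auto simp: P.prob_space_axioms intro!: mult_le_1_ennreal cexp_le_1)
      have 2: "(\<integral>\<^sup>+w. (?B w * indicator H (xC w)) * indicator F (xA w) \<partial>P) =
          (\<integral>\<^sup>+w. (?V (xC w) * indicator H (xC w)) * indicator F (xA w) \<partial>P)"
      proof (rule laplace_ext[where N=MA])
        fix h :: "'a \<Rightarrow> ennreal" assume "h \<in> borel_measurable MA"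
        from 1[OF this] show "(\<integral>\<^sup>+w. ?B w * indicator H (xC w) * nexp (\<integral>\<^sup>+x. h x \<partial>xA w) \<partial>P) =
          (\<integral>\<^sup>+w. ?V (xC w) * indicator H (xC w) * nexp (\<integral>\<^sup>+x. h x \<partial>xA w) \<partial>P)"
          by (simp add: mult_ac)
      qed (auto simp: P.prob_space_axioms cexp_le_1 indicator_def)
      have "(\<integral>\<^sup>+w. indicator F (xA w) * indicator H (xC w) * ?B w \<partial>P) =
          (\<integral>\<^sup>+w. indicator F (xA w) * (indicator H (xC w) * ?V (xC w)) \<partial>P)"
        using 2 by (simp add: mult_ac)
      also have "\<dots> = (\<integral>\<^sup>+w. f (xC w) * (indicator H (xC w) * ?V (xC w)) \<partial>P)"
        by (rule versionD[OF f, of "\<lambda>m. indicator H m * ?V m"]) measurable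
      also have "\<dots> = (\<integral>\<^sup>+w. ?V (xC w) * (f (xC w) * indicator H (xC w)) \<partial>P)"
        by (simp add: mult_ac)
      also have "\<dots> = (\<integral>\<^sup>+w. ?B w * (f (xC w) * indicator H (xC w)) \<partial>P)"
        by (rule versionD[OF V, of "\<lambda>m. f m * indicator H m", symmetric]) measurable
      finally show "(\<integral>\<^sup>+w. indicator F (xA w) * indicator H (xC w) * ?B w \<partial>P) =
        (\<integral>\<^sup>+w. f (xC w) * indicator H (xC w) * ?B w \<partial>P)"
        by (simp add: mult_ac)
    qed (use f1 in \<open>auto simp: P.prob_space_axioms indicator_def\<close>)
    then show ?thesis by (simp add: mult_ac)
  qed
  with ftop show "\<exists>f\<in>borel_measurable (point_measure_algebra MC). (\<forall>z. f z < (top::ennreal)) \<and>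
      (\<forall>G\<in>sets (point_measure_algebra MB). \<forall>H\<in>sets (point_measure_algebra MC).
        (\<integral>\<^sup>+w. indicator F (xA w) * indicator G (xB w) * indicator H (xC w) \<partial>P) =
        (\<integral>\<^sup>+w. f (xC w) * indicator G (xB w) * indicator H (xC w) \<partial>P))"
    by (intro bexI[of _ f]) auto
qed measurable

text \<open>Under conditional independence the conditional Laplace functionals of \<open>xA\<close>
  and \<open>xB\<close> given \<open>xC\<close> multiply. As all terms are exponentials, injectivity
  of \<open>nexp\<close> turns this into an additive identity between exponents, possibly infinite
  ones.\<close>

lemma process_exponent:
  fixes u v w :: "_ \<Rightarrow> ennreal"
  assumes ci: "ci P (point_measure_algebra MA) xA (point_measure_algebra MB) xB (point_measure_algebra MC) xC"
    and [measurable]: "u \<in> borel_measurable MA" "v \<in> borel_measurable MB" "w \<in> borel_measurable MC"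
    and le: "\<And>t. u t \<le> 1" "\<And>t. v t \<le> 1" "\<And>z. w z \<le> 1"
    and f: "version L1 MC Z (\<lambda>y. u (X y)) f" "\<And>z. f z \<le> 1"
    and e: "version L1 MC Z (\<lambda>y. v (Y y)) e" "\<And>z. e z \<le> 1"
  shows "(\<integral>\<^sup>+y. 1 - u (X y) * v (Y y) * w (Z y) \<partial>L) =
    (\<integral>\<^sup>+y. 1 - u (X y) \<partial>L0) + (\<integral>\<^sup>+y. 1 - v (Y y) \<partial>L0) +
    (\<integral>\<^sup>+y. 1 - ext1 f (Z y) * ext1 e (Z y) * w (Z y) \<partial>L)"
proof (rule nexp_eqD)
  have [measurable]: "f \<in> borel_measurable MC" "e \<in> borel_measurable MC"
    using f(1) e(1) by (auto intro: version_measurable)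
  have [simp]: "nexp (nlog (u t)) = u t" "nexp (nlog (v s)) = v s" "nexp (nlog (w z)) = w z"
    "nexp (nlog (ext1 f z)) = ext1 f z" "nexp (nlog (ext1 e z)) = ext1 e z" for t s z
    using le f(2) e(2) by (auto intro!: nexp_nlog ext1_le)
  let ?A = "\<lambda>m. nexp (\<integral>\<^sup>+x. nlog (u x) \<partial>m)" and ?B = "\<lambda>m. nexp (\<integral>\<^sup>+x. nlog (v x) \<partial>m)"
    and ?C = "\<lambda>m. nexp (\<integral>\<^sup>+x. nlog (w x) \<partial>m)"
  let ?U = "cexp (\<lambda>y. u (X y)) f" and ?V = "cexp (\<lambda>y. v (Y y)) e"
  have U: "version P (point_measure_algebra MC) xC (\<lambda>w. ?A (xA w)) ?U"
    using version_cexp[OF X, of "\<lambda>x. nlog (u x)" f] f by (simp add: xA_def)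
  have V: "version P (point_measure_algebra MC) xC (\<lambda>w. ?B (xB w)) ?V"
    using version_cexp[OF Y, of "\<lambda>x. nlog (v x)" e] e by (simp add: xB_def)
  have "nexp (\<integral>\<^sup>+y. 1 - u (X y) * v (Y y) * w (Z y) \<partial>L) = (\<integral>\<^sup>+\<omega>. ?A (xA \<omega>) * ?B (xB \<omega>) * ?C (xC \<omega>) \<partial>P)"
    using laplace3[of "\<lambda>x. nlog (u x)" "\<lambda>x. nlog (v x)" "\<lambda>x. nlog (w x)"] by simp
  also have "\<dots> = (\<integral>\<^sup>+\<omega>. ?U (xC \<omega>) * ?V (xC \<omega>) * ?C (xC \<omega>) \<partial>P)"
    by (rule ci_product[OF ci _ _ _ _ _ _ U V]) measurable
  also have "\<dots> = (\<integral>\<^sup>+\<omega>. (nexp (\<integral>\<^sup>+y. 1 - u (X y) \<partial>L0) * nexp (\<integral>\<^sup>+y. 1 - v (Y y) \<partial>L0)) *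
      nexp (\<integral>\<^sup>+x. nlog (ext1 f x) + nlog (ext1 e x) + nlog (w x) \<partial>xC \<omega>) \<partial>P)"
  proof (rule nn_integral_cong)
    fix \<omega> assume "\<omega> \<in> space P"
    have [measurable_cong]: "sets (xC \<omega>) = sets MC" by (simp add: xC_def)
    show "?U (xC \<omega>) * ?V (xC \<omega>) * ?C (xC \<omega>) = (nexp (\<integral>\<^sup>+y. 1 - u (X y) \<partial>L0) * nexp (\<integral>\<^sup>+y. 1 - v (Y y) \<partial>L0)) *
      nexp (\<integral>\<^sup>+x. nlog (ext1 f x) + nlog (ext1 e x) + nlog (w x) \<partial>xC \<omega>)"
      unfolding cexp_def by (subst nn_integral_add, measurable, subst nn_integral_add) (auto simp: nexp_add mult_ac)
  qed
  also have "\<dots> = (nexp (\<integral>\<^sup>+y. 1 - u (X y) \<partial>L0) * nexp (\<integral>\<^sup>+y. 1 - v (Y y) \<partial>L0)) *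
      (\<integral>\<^sup>+\<omega>. nexp (\<integral>\<^sup>+x. nlog (ext1 f x) + nlog (ext1 e x) + nlog (w x) \<partial>xC \<omega>) \<partial>P)"
    by (rule nn_integral_cmult) measurable
  also have "\<dots> = nexp ((\<integral>\<^sup>+y. 1 - u (X y) \<partial>L0) + (\<integral>\<^sup>+y. 1 - v (Y y) \<partial>L0) +
    (\<integral>\<^sup>+y. 1 - ext1 f (Z y) * ext1 e (Z y) * w (Z y) \<partial>L))"
    by (subst laplace_C) (auto simp: nexp_add)
  finally show "nexp (\<integral>\<^sup>+y. 1 - u (X y) * v (Y y) * w (Z y) \<partial>L) = nexp ((\<integral>\<^sup>+y. 1 - u (X y) \<partial>L0) + (\<integral>\<^sup>+y. 1 - v (Y y) \<partial>L0) +
    (\<integral>\<^sup>+y. 1 - ext1 f (Z y) * ext1 e (Z y) * w (Z y) \<partial>L))" .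
qed

end

section \<open>From the processes back to the mean measure\<close>

text \<open>The integral form of \<open>finite_measure_eqI_localized\<close>; it removes the
  boundedness of a test set in one block.\<close>

lemma integral_eq_extend:
  fixes \<phi> \<psi> :: "'y \<Rightarrow> ennreal"
  assumes T[measurable]: "T \<in> L \<rightarrow>\<^sub>M N" and [measurable]: "\<phi> \<in> borel_measurable L" "\<psi> \<in> borel_measurable L"
    and K: "\<And>n::nat. K n \<in> sets N" "incseq K" "(\<Union>n. K n) = space N - {x0}"
    and fin: "(\<integral>\<^sup>+y. \<phi> y \<partial>L) < \<infinity>" and top: "(\<integral>\<^sup>+y. \<phi> y \<partial>L) = (\<integral>\<^sup>+y. \<psi> y \<partial>L)"
    and eq: "\<And>n F. F \<in> sets N \<Longrightarrow> F \<subseteq> K n \<Longrightarrow>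
      (\<integral>\<^sup>+y. \<phi> y * indicator F (T y) \<partial>L) = (\<integral>\<^sup>+y. \<psi> y * indicator F (T y) \<partial>L)"
    and F: "F \<in> sets N"
  shows "(\<integral>\<^sup>+y. \<phi> y * indicator F (T y) \<partial>L) = (\<integral>\<^sup>+y. \<psi> y * indicator F (T y) \<partial>L)"
proof -
  have em: "emeasure (distr (density L \<rho>) N T) G = (\<integral>\<^sup>+y. \<rho> y * indicator G (T y) \<partial>L)"
    if [measurable]: "G \<in> sets N" "\<rho> \<in> borel_measurable L" for G \<rho>
    by (subst emeasure_distr, simp, simp, subst emeasure_density)
      (auto intro!: nn_integral_cong simp: indicator_def)
  have sp: "(\<integral>\<^sup>+y. \<rho> y * indicator (space N) (T y) \<partial>L) = (\<integral>\<^sup>+y. \<rho> y \<partial>L)" for \<rho>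
    using measurable_space[OF T] by (auto intro!: nn_integral_cong)
  have "distr (density L \<phi>) N T = distr (density L \<psi>) N T"
    by (rule finite_measure_eqI_localized[where N=N and K=K and ?x0.0=x0])
      (use K fin top eq in \<open>auto simp: em sp\<close>)
  with em[OF F, of \<phi>] em[OF F, of \<psi>] show ?thesis by simp
qed

text \<open>The size of the perturbations of the constant 1 used as test functions. The computations
  rely only on its being positive and at most 1.\<close>

definition half :: ennreal where "half = ennreal (1/2)"

lemma half: "half \<le> 1" "half \<noteq> 0" "half \<noteq> top"
proof -
  have "ennreal (1/2) \<le> ennreal 1" by (rule ennreal_leI) simp
  then show "half \<le> 1" by (simp add: half_def)
  show "half \<noteq> 0" "half \<noteq> top" unfolding half_def by (auto simp: ennreal_eq_0_iff)
qed

lemma one_minus_mult_one_minus: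
  fixes x t :: ennreal
  assumes "x \<le> 1" "t \<le> 1"
  shows "1 - x * (1 - t) = (1 - x) + x * t"
proof -
  obtain a b where ab: "x = ennreal a" "0 \<le> a" "a \<le> 1" "t = ennreal b" "0 \<le> b" "b \<le> 1"
    using assms by (cases x; cases t) (auto simp: top_unique)
  have "a * (1 - b) \<le> 1" using ab mult_mono[of a 1 "1 - b" 1] by simp
  then have "1 - x * (1 - t) = ennreal (1 - a * (1 - b))" "(1 - x) + x * t = ennreal ((1 - a) + a * b)"
    using ab by (simp_all add: ennreal_minus ennreal_mult[symmetric] flip: ennreal_1 ennreal_plus)
  then show ?thesis by (simp add: algebra_simps)
qed

lemma one_minus_one_minus: "x \<le> 1 \<Longrightarrow> 1 - (1 - x) = (x::ennreal)"
  using one_minus_mult_one_minus[of 1 x] by simp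

text \<open>The expansion of \<open>(1 - s) * (1 - t)\<close>, arranged so that subtraction occurs
  only from 1 and is never truncated; everything else is moved to the additive side.\<close>

lemma inclusion_exclusion_1:
  fixes s t :: ennreal
  assumes "s \<le> 1" "t \<le> 1"
  shows "(1 - (1 - s) * (1 - t)) + s * t = s + t"
    and "(1 - s) * (1 - t) + (s + t) = 1 + s * t"
proof -
  obtain a b where ab: "s = ennreal a" "0 \<le> a" "a \<le> 1" "t = ennreal b" "0 \<le> b" "b \<le> 1"
    using assms by (cases s; cases t) (auto simp: top_unique)
  have le: "(1 - a) * (1 - b) \<le> 1" using ab mult_mono[of "1 - a" 1 "1 - b" 1] by simp
  have 1: "(1 - s) * (1 - t) = ennreal ((1 - a) * (1 - b))"
    using ab by (simp add: ennreal_minus ennreal_mult[symmetric] flip: ennreal_1)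
  have "(1 - (1 - s) * (1 - t)) + s * t = ennreal ((1 - (1 - a) * (1 - b)) + a * b)"
    using ab le by (simp add: 1 ennreal_minus ennreal_mult[symmetric] flip: ennreal_1 ennreal_plus)
  then show "(1 - (1 - s) * (1 - t)) + s * t = s + t"
    using ab by (simp add: algebra_simps flip: ennreal_plus)
  have "(1 - s) * (1 - t) + (s + t) = ennreal ((1 - a) * (1 - b) + (a + b))"
    unfolding 1 unfolding ab(1,4) using ab by (simp flip: ennreal_plus)
  also have "(1 - a) * (1 - b) + (a + b) = 1 + a * b" by (simp add: algebra_simps)
  also have "ennreal (1 + a * b) = 1 + s * t"
    using ab by (simp add: ennreal_mult)
  finally show "(1 - s) * (1 - t) + (s + t) = 1 + s * t" .
qed

lemma ennreal_add_cancel: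
  fixes a b c :: ennreal
  shows "a + b = a + c \<Longrightarrow> a < top \<Longrightarrow> b = c"
  by (metis ennreal_add_left_cancel less_irrefl infinity_ennreal_def)

lemma ennreal_mult_cancel_half: "half * b = half * c \<Longrightarrow> b = c"
  using ennreal_mult_cancel_left[of half b c] half by simp

lemma (in punctured_triple) version_exists_X:
  "F \<in> sets MA \<Longrightarrow> \<exists>f. version L1 MC Z (\<lambda>y. indicator F (X y)) f \<and> (\<forall>z. f z \<le> 1)"
  by (rule version_exists_L1) (auto simp: indicator_def)

lemma (in punctured_triple) version_exists_Y:
  "G \<in> sets MB \<Longrightarrow> \<exists>g. version L1 MC Z (\<lambda>y. indicator G (Y y)) g \<and> (\<forall>z. g z \<le> 1)"
  by (rule version_exists_L1) (auto simp: indicator_def)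

context punctured_triple_poisson
begin

context
  assumes ci: "ci P (point_measure_algebra MA) xA (point_measure_algebra MB) xB (point_measure_algebra MC) xC"
begin

context
  fixes F G n m f g
  assumes F[measurable]: "F \<in> sets MA" and Fn: "F \<subseteq> KA n" and G[measurable]: "G \<in> sets MB" and Gm: "G \<subseteq> KB m"
    and f: "version L1 MC Z (\<lambda>y. indicator F (X y)) f" "\<And>z. f z \<le> 1"
    and g: "version L1 MC Z (\<lambda>y. indicator G (Y y)) g" "\<And>z. g z \<le> 1"
begin

private abbreviation (input) "h \<equiv> half"
text \<open>The test functions are \<open>u = 1 - s\<close> and \<open>v = 1 - t\<close>;
  \<open>s'\<close> and \<open>t'\<close> are the conditional counterparts of \<open>s\<close> and
  \<open>t\<close> given \<open>Z\<close> on \<open>L1\<close>.\<close>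

private definition "s y = half * indicator F (X y)"
private definition "t y = half * indicator G (Y y)"
private definition "s' y = half * f (Z y)"
private definition "t' y = half * g (Z y)"

private lemma fg_meas: "f \<in> borel_measurable MC" "g \<in> borel_measurable MC"
  using f(1) g(1) by (auto intro: version_measurable)

private lemma st_meas: "s \<in> borel_measurable L" "t \<in> borel_measurable L"
    "s' \<in> borel_measurable L" "t' \<in> borel_measurable L"
  using fg_meas unfolding s_def[abs_def] t_def[abs_def] s'_def[abs_def] t'_def[abs_def] by measurable

private lemma st_le: "s y \<le> 1" "t y \<le> 1" "s' y \<le> 1" "t' y \<le> 1"
  using mult_le_1_ennreal[OF half(1) f(2)] mult_le_1_ennreal[OF half(1) g(2)] half(1)
  by (auto simp: s_def t_def s'_def t'_def indicator_def)

text \<open>Here the boundedness of \<open>F\<close> and \<open>G\<close> enters: it makes the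
  exponents finite, so that they can be cancelled later.\<close>

private lemma st_fin: "(\<integral>\<^sup>+y. s y + t y \<partial>L) < top"
proof -
  note fg_meas[measurable] st_meas[measurable]
  have "(\<integral>\<^sup>+y. s y + t y \<partial>L) \<le> (\<integral>\<^sup>+y. indicator (KA n) (X y) + indicator (KB m) (Y y) \<partial>L)"
    using Fn Gm st_le half(1)
    by (intro nn_integral_mono add_mono) (auto simp: s_def t_def indicator_def)
  also have "\<dots> < top"
    using KA_fin[of n] KB_fin[of m] by (subst nn_integral_add) auto
  finally show ?thesis .
qed

private lemma uv_le: "1 - (1 - s y) * (1 - t y) \<le> s y + t y"
  using inclusion_exclusion_1(1)[OF st_le(1)[of y] st_le(2)[of y]] by (metis le_iff_add)

text \<open>This is \<open>process_exponent\<close> for \<open>1 - s\<close> and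
  \<open>1 - t\<close>, split along \<open>Z = c0\<close>. Because \<open>w c0 = 1\<close> and
  \<open>ext1\<close> is 1 at \<open>c0\<close>, the last term of \<open>process_exponent\<close>
  vanishes on \<open>L0\<close> and \<open>w\<close> is felt on \<open>L1\<close> only.\<close>

private lemma basic_eq:
  assumes w[measurable]: "w \<in> borel_measurable MC" and w1: "\<And>z. w z \<le> 1" "w c0 = 1"
  shows "(\<integral>\<^sup>+y. 1 - (1 - s y) * (1 - t y) \<partial>L0) + (\<integral>\<^sup>+y. 1 - (1 - s y) * (1 - t y) * w (Z y) \<partial>L1) =
    (\<integral>\<^sup>+y. s y + t y \<partial>L0) + (\<integral>\<^sup>+y. 1 - (1 - s' y) * (1 - t' y) * w (Z y) \<partial>L1)"
proof -
  note fg_meas[measurable] st_meas[measurable]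
  have vs: "version L1 MC Z (\<lambda>y. 1 - s y) (\<lambda>z. 1 - h * f z)"
    unfolding s_def
    by (rule version_compl_L1, rule version_cmult[OF f(1)])
      (use half(1) f(2) in \<open>auto simp: indicator_def intro!: mult_le_1_ennreal\<close>)
  have vt: "version L1 MC Z (\<lambda>y. 1 - t y) (\<lambda>z. 1 - h * g z)"
    unfolding t_def
    by (rule version_compl_L1, rule version_cmult[OF g(1)])
      (use half(1) g(2) in \<open>auto simp: indicator_def intro!: mult_le_1_ennreal\<close>)
  have cs: "1 - (1 - s y) = s y" "1 - (1 - t y) = t y" for y
    using st_le one_minus_one_minus by auto
  let ?e = "\<lambda>y. 1 - (1 - s y) * (1 - t y) * w (Z y)"
  let ?r = "\<lambda>y. 1 - ext1 (\<lambda>z. 1 - h * f z) (Z y) * ext1 (\<lambda>z. 1 - h * g z) (Z y) * w (Z y)"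
  have "(\<integral>\<^sup>+y. ?e y \<partial>L) = (\<integral>\<^sup>+y. 1 - (1 - s y) \<partial>L0) + (\<integral>\<^sup>+y. 1 - (1 - t y) \<partial>L0) + (\<integral>\<^sup>+y. ?r y \<partial>L)"
    unfolding s_def t_def
    by (rule process_exponent[OF ci, where u="\<lambda>x. 1 - h * indicator F x" and v="\<lambda>x. 1 - h * indicator G x"])
      (use vs vt w1 in \<open>auto simp: s_def t_def\<close>)
  also have "(\<integral>\<^sup>+y. ?r y \<partial>L) = (\<integral>\<^sup>+y. ?r y \<partial>L0) + (\<integral>\<^sup>+y. ?r y \<partial>L1)"
    by (rule nn_integral_split) measurable
  also have "(\<integral>\<^sup>+y. ?r y \<partial>L0) = (\<integral>\<^sup>+y. 0 \<partial>L0)"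
    by (rule nn_integral_cong_AE) (use AE_L0 w1(2) in \<open>auto elim!: eventually_mono simp: ext1_def\<close>)
  also have "(\<integral>\<^sup>+y. ?r y \<partial>L1) = (\<integral>\<^sup>+y. 1 - (1 - s' y) * (1 - t' y) * w (Z y) \<partial>L1)"
    by (rule nn_integral_cong_AE) (use AE_L1 in \<open>eventually_elim, simp add: ext1_def s'_def t'_def\<close>)
  also have "(\<integral>\<^sup>+y. ?e y \<partial>L) = (\<integral>\<^sup>+y. ?e y \<partial>L0) + (\<integral>\<^sup>+y. ?e y \<partial>L1)"
    by (rule nn_integral_split) measurable
  also have "(\<integral>\<^sup>+y. ?e y \<partial>L0) = (\<integral>\<^sup>+y. 1 - (1 - s y) * (1 - t y) \<partial>L0)"
    by (rule nn_integral_cong_AE) (use AE_L0 w1(2) in \<open>auto elim!: eventually_mono\<close>)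
  finally show ?thesis by (simp add: cs nn_integral_add)
qed

private lemma fin1: "(\<integral>\<^sup>+y. 1 - (1 - s y) * (1 - t y) \<partial>L0) + (\<integral>\<^sup>+y. 1 - (1 - s y) * (1 - t y) \<partial>L1) < top"
proof -
  note fg_meas[measurable] st_meas[measurable]
  have "(\<integral>\<^sup>+y. 1 - (1 - s y) * (1 - t y) \<partial>L) \<le> (\<integral>\<^sup>+y. s y + t y \<partial>L)"
    by (intro nn_integral_mono uv_le)
  with st_fin have "(\<integral>\<^sup>+y. 1 - (1 - s y) * (1 - t y) \<partial>L) < top" by (rule le_less_trans[rotated])
  then show ?thesis by (simp add: nn_integral_split)
qed

text \<open>\<open>basic_eq\<close> is compared for two weights, the constant 1 and
  \<open>1 - half * indicator D\<close> with \<open>D\<close> bounded. The latter is an admissible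
  weight since a bounded set does not contain \<open>c0\<close>. The exponents differ by
  \<open>half\<close> times the integral over \<open>D\<close>, and the rest is finite by
  \<open>fin1\<close> and cancels.\<close>

private lemma prod_eq:
  assumes H: "H \<in> sets MC"
  shows "(\<integral>\<^sup>+y. ((1 - s y) * (1 - t y)) * indicator H (Z y) \<partial>L1) = (\<integral>\<^sup>+y. ((1 - s' y) * (1 - t' y)) * indicator H (Z y) \<partial>L1)"
proof -
  note fg_meas[measurable] st_meas[measurable]
  show ?thesis
  proof (rule localized_integral_eqI[where K=KC and MC=MC])
  fix k D assume D[measurable]: "D \<in> sets MC" and Dk: "D \<subseteq> KC k"
  define w where "w z = 1 - h * indicator D z" for z
  have wm[measurable]: "w \<in> borel_measurable MC" unfolding w_def by measurable
  have c0D: "c0 \<notin> D" using Dk KC_UN by auto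
  have w1: "w z \<le> 1" "w c0 = 1" for z using c0D by (auto simp: w_def)
  have hD: "h * indicator D z \<le> 1" for z using half(1) by (auto simp: indicator_def)
  have *: "(\<integral>\<^sup>+y. 1 - x y * w (Z y) \<partial>L1) = (\<integral>\<^sup>+y. 1 - x y \<partial>L1) + h * (\<integral>\<^sup>+y. x y * indicator D (Z y) \<partial>L1)"
    if [measurable]: "x \<in> borel_measurable L" and x: "\<And>y. x y \<le> 1" for x
  proof -
    have "(\<integral>\<^sup>+y. 1 - x y * w (Z y) \<partial>L1) = (\<integral>\<^sup>+y. (1 - x y) + h * (x y * indicator D (Z y)) \<partial>L1)"
      unfolding w_def by (intro nn_integral_cong) (subst one_minus_mult_one_minus[OF x hD], simp add: mult_ac)
    then show ?thesis by (simp add: nn_integral_add nn_integral_cmult)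
  qed
  let ?x = "\<lambda>y. (1 - s y) * (1 - t y)" and ?x' = "\<lambda>y. (1 - s' y) * (1 - t' y)"
  have le: "?x y \<le> 1" "?x' y \<le> 1" for y by (auto intro!: mult_le_1_ennreal)
  let ?p = "\<integral>\<^sup>+y. 1 - ?x y \<partial>L0" and ?P = "\<integral>\<^sup>+y. 1 - ?x y \<partial>L1" and ?Q = "\<integral>\<^sup>+y. 1 - ?x' y \<partial>L1"
    and ?I = "\<integral>\<^sup>+y. s y + t y \<partial>L0"
  have e1: "?p + ?P = ?I + ?Q" using basic_eq[of "\<lambda>_. 1"] by simp
  have "?p + (?P + h * (\<integral>\<^sup>+y. ?x y * indicator D (Z y) \<partial>L1)) =
     ?I + (?Q + h * (\<integral>\<^sup>+y. ?x' y * indicator D (Z y) \<partial>L1))"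
    using basic_eq[OF wm w1] *[OF _ le(1)] *[OF _ le(2)] by simp
  then have "(?p + ?P) + h * (\<integral>\<^sup>+y. ?x y * indicator D (Z y) \<partial>L1) =
     (?p + ?P) + h * (\<integral>\<^sup>+y. ?x' y * indicator D (Z y) \<partial>L1)"
    unfolding e1 by (simp add: add.assoc) (simp add: add.assoc[symmetric] e1)
  from ennreal_mult_cancel_half[OF ennreal_add_cancel[OF this fin1]]
  show "(\<integral>\<^sup>+y. ?x y * indicator D (Z y) \<partial>L1) = (\<integral>\<^sup>+y. ?x' y * indicator D (Z y) \<partial>L1)" .
qed (use KC_inc L1_cover H in auto)
qed

text \<open>By \<open>prod_eq\<close> the \<open>L1\<close> parts in \<open>basic_eq\<close> with
  weight 1 agree and cancel, so on \<open>L0\<close> the integrals of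
  \<open>1 - (1 - s) * (1 - t)\<close> and \<open>s + t\<close> coincide. Their difference is the
  integral of \<open>s * t\<close>, which must vanish.\<close>

private lemma null_FG: "(\<integral>\<^sup>+y. indicator F (X y) * indicator G (Y y) \<partial>L0) = 0"
proof -
  note fg_meas[measurable] st_meas[measurable]
  let ?x = "\<lambda>y. (1 - s y) * (1 - t y)" and ?x' = "\<lambda>y. (1 - s' y) * (1 - t' y)"
  let ?p = "\<integral>\<^sup>+y. 1 - ?x y \<partial>L0" and ?P = "\<integral>\<^sup>+y. 1 - ?x y \<partial>L1" and ?Q = "\<integral>\<^sup>+y. 1 - ?x' y \<partial>L1"
    and ?I = "\<integral>\<^sup>+y. s y + t y \<partial>L0"
  have e1: "?p + ?P = ?I + ?Q" using basic_eq[of "\<lambda>_. 1"] by simp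
  have "(\<integral>\<^sup>+y. (1 - ?x y) * 1 \<partial>L1) = (\<integral>\<^sup>+y. (1 - ?x' y) * 1 \<partial>L1)"
    by (rule L1_compl[where w="\<lambda>_. 1"]) (use prod_eq in \<open>auto intro!: mult_le_1_ennreal\<close>)
  then have PQ: "?P = ?Q" by simp
  have fin: "?p < top" "?P < top" using fin1 by auto
  have "?P + ?p = ?P + ?I" using e1 PQ by (simp add: add.commute)
  from ennreal_add_cancel[OF this fin(2)] have pI: "?p = ?I" .
  have "?I = (\<integral>\<^sup>+y. (1 - ?x y) + s y * t y \<partial>L0)"
    by (intro nn_integral_cong) (simp add: inclusion_exclusion_1(1)[OF st_le(1,2)])
  also have "\<dots> = ?p + (\<integral>\<^sup>+y. s y * t y \<partial>L0)" by (rule nn_integral_add) measurable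
  finally have "?p + 0 = ?p + (\<integral>\<^sup>+y. s y * t y \<partial>L0)" using pI by simp
  from ennreal_add_cancel[OF this fin(1)] have "(\<integral>\<^sup>+y. s y * t y \<partial>L0) = 0" by simp
  also have "(\<integral>\<^sup>+y. s y * t y \<partial>L0) = h * (h * (\<integral>\<^sup>+y. indicator F (X y) * indicator G (Y y) \<partial>L0))"
    proof -
    have "s y * t y = h * (h * (indicator F (X y) * indicator G (Y y)))" for y by (simp add: s_def t_def mult_ac)
    then show ?thesis by (simp add: nn_integral_cmult)
  qed
  finally show ?thesis using half(2) by simp
qed

text \<open>Expanding both products in \<open>prod_eq\<close>, the linear terms agree because
  \<open>s'\<close> and \<open>t'\<close> come from versions. The quadratic terms remain after
  cancelling the finite mass of the bounded set \<open>D\<close>, and the factor \<open>half\<close>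
  is removed twice.\<close>

private lemma eq_FG:
  assumes D[measurable]: "D \<in> sets MC" and Dk: "D \<subseteq> KC k"
  shows "(\<integral>\<^sup>+y. indicator F (X y) * indicator G (Y y) * indicator D (Z y) \<partial>L1) =
    (\<integral>\<^sup>+y. f (Z y) * g (Z y) * indicator D (Z y) \<partial>L1)"
proof -
  note fg_meas[measurable] st_meas[measurable]
  let ?D = "\<lambda>y. indicator D (Z y) :: ennreal"
  have Dfin: "(\<integral>\<^sup>+y. ?D y \<partial>L1) < top"
    using Dk by (intro le_less_trans[OF nn_integral_mono L1_fin[of k, unfolded infinity_ennreal_def]]) (auto simp: indicator_def)
  have ss: "(\<integral>\<^sup>+y. s y * ?D y \<partial>L1) = (\<integral>\<^sup>+y. s' y * ?D y \<partial>L1)"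
    using versionD[OF version_cmult[OF f(1), of h], of "indicator D"] by (simp add: s_def s'_def)
  have tt: "(\<integral>\<^sup>+y. t y * ?D y \<partial>L1) = (\<integral>\<^sup>+y. t' y * ?D y \<partial>L1)"
    using versionD[OF version_cmult[OF g(1), of h], of "indicator D"] by (simp add: t_def t'_def)
  have *: "(\<integral>\<^sup>+y. ((1 - a y) * (1 - b y)) * ?D y \<partial>L1) + ((\<integral>\<^sup>+y. a y * ?D y \<partial>L1) + (\<integral>\<^sup>+y. b y * ?D y \<partial>L1)) =
     (\<integral>\<^sup>+y. ?D y \<partial>L1) + (\<integral>\<^sup>+y. a y * b y * ?D y \<partial>L1)"
    if [measurable]: "a \<in> borel_measurable L" "b \<in> borel_measurable L" and le: "\<And>y. a y \<le> 1" "\<And>y. b y \<le> 1" for a b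
  proof -
    have "((1 - a y) * (1 - b y)) * ?D y + (a y * ?D y + b y * ?D y) = ?D y + a y * b y * ?D y" for y
      using inclusion_exclusion_1(2)[OF le(1)[of y] le(2)[of y]] by (simp add: distrib_right[symmetric] indicator_def)
    then have "(\<integral>\<^sup>+y. ((1 - a y) * (1 - b y)) * ?D y + (a y * ?D y + b y * ?D y) \<partial>L1) = (\<integral>\<^sup>+y. ?D y + a y * b y * ?D y \<partial>L1)"
      by simp
    then show ?thesis by (simp add: nn_integral_add)
  qed
  have "(\<integral>\<^sup>+y. ?D y \<partial>L1) + (\<integral>\<^sup>+y. s y * t y * ?D y \<partial>L1) = (\<integral>\<^sup>+y. ?D y \<partial>L1) + (\<integral>\<^sup>+y. s' y * t' y * ?D y \<partial>L1)"
    unfolding *[OF st_meas(1,2) st_le(1) st_le(2), symmetric] *[OF st_meas(3,4) st_le(3) st_le(4), symmetric]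
    by (simp only: ss tt prod_eq[OF D])
  from ennreal_add_cancel[OF this Dfin]
  have "(\<integral>\<^sup>+y. s y * t y * ?D y \<partial>L1) = (\<integral>\<^sup>+y. s' y * t' y * ?D y \<partial>L1)" .
  moreover have "(\<integral>\<^sup>+y. s y * t y * ?D y \<partial>L1) = h * (h * (\<integral>\<^sup>+y. indicator F (X y) * indicator G (Y y) * ?D y \<partial>L1))"
    proof -
    have "s y * t y * ?D y = h * (h * (indicator F (X y) * indicator G (Y y) * ?D y))" for y by (simp add: s_def t_def mult_ac)
    then show ?thesis by (simp add: nn_integral_cmult)
  qed
  moreover have "(\<integral>\<^sup>+y. s' y * t' y * ?D y \<partial>L1) = h * (h * (\<integral>\<^sup>+y. f (Z y) * g (Z y) * ?D y \<partial>L1))"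
    proof -
    have "s' y * t' y * ?D y = h * (h * (f (Z y) * g (Z y) * ?D y))" for y by (simp add: s'_def t'_def mult_ac)
    then show ?thesis by (simp add: nn_integral_cmult)
  qed
  ultimately show ?thesis by (auto dest!: ennreal_mult_cancel_half)
qed

lemmas null_bounded = null_FG and eq_bounded = eq_FG

end

lemma process_imp_star: star
proof -
  let ?N = "\<lambda>n m. {y \<in> space L. X y \<in> KA n \<and> Y y \<in> KB m \<and> Z y = c0}"
  have "?N n m \<in> null_sets L" for n m
  proof -
    obtain f where f: "version L1 MC Z (\<lambda>y. indicator (KA n) (X y)) f" "\<And>z. f z \<le> 1"
      using version_exists_X[OF KA] by blast
    obtain g where g: "version L1 MC Z (\<lambda>y. indicator (KB m) (Y y)) g" "\<And>z. g z \<le> 1"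
      using version_exists_Y[OF KB] by blast
    have [measurable]: "?N n m \<in> sets L" by measurable
    have "emeasure L (?N n m) = (\<integral>\<^sup>+y. indicator (?N n m) y \<partial>L)" by (rule nn_integral_indicator[symmetric]) simp
    also have "\<dots> = (\<integral>\<^sup>+y. indicator (KA n) (X y) * indicator (KB m) (Y y) \<partial>L0)"
      by (subst nn_integral_L0, measurable, rule nn_integral_cong) (auto simp: indicator_def)
    also have "\<dots> = 0"
      by (rule null_bounded[where n=n and m=m and f=f and g=g]) (use f g in auto)
    finally show ?thesis by (auto simp: null_sets_def)
  qed
  then have "(\<Union>n. \<Union>m. ?N n m) \<in> null_sets L" by (intro null_sets_UN)
  moreover have "(\<Union>n. \<Union>m. ?N n m) = {y \<in> space L. X y \<noteq> a0 \<and> Y y \<noteq> b0 \<and> Z y = c0}"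
  proof (rule set_eqI)
    fix y
    have "(\<exists>n. X y \<in> KA n) \<longleftrightarrow> X y \<in> space MA - {a0}" "(\<exists>n. Y y \<in> KB n) \<longleftrightarrow> Y y \<in> space MB - {b0}"
      unfolding KA_UN[symmetric] KB_UN[symmetric] by simp_all
    then show "y \<in> (\<Union>n. \<Union>m. ?N n m) \<longleftrightarrow> y \<in> {y \<in> space L. X y \<noteq> a0 \<and> Y y \<noteq> b0 \<and> Z y = c0}"
      using X_sp[of y] Y_sp[of y] by auto
  qed
  ultimately show ?thesis by (auto simp: star_def)
qed

lemma L1_Z_fin: "D \<subseteq> KC k \<Longrightarrow> (\<And>y. \<phi> y \<le> 1) \<Longrightarrow> (\<integral>\<^sup>+y. \<phi> y * indicator D (Z y) \<partial>L1) < \<infinity>"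
  by (rule le_less_trans[OF nn_integral_mono L1_fin[of k]]) (auto simp: indicator_def)

text \<open>For bounded \<open>G\<close>, \<open>eq_bounded\<close> produces \<open>f * g\<close>,
  and \<open>g\<close> is turned back into the indicator of \<open>G\<close>. In this form both
  sides are measures in \<open>G\<close>; their total masses agree since \<open>f\<close> is a
  version, so \<open>G\<close> may become arbitrary.\<close>

lemma process_imp_ci_bounded:
  assumes Fn: "F \<subseteq> KA n" and F[measurable]: "F \<in> sets MA" and G[measurable]: "G \<in> sets MB"
    and D[measurable]: "D \<in> sets MC" and Dk: "D \<subseteq> KC k"
    and f: "version L1 MC Z (\<lambda>y. indicator F (X y)) f" "\<And>z. f z \<le> 1"
  shows "(\<integral>\<^sup>+y. (indicator F (X y) * indicator D (Z y)) * indicator G (Y y) \<partial>L1) =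
        (\<integral>\<^sup>+y. (f (Z y) * indicator D (Z y)) * indicator G (Y y) \<partial>L1)"
proof -
  have [measurable]: "f \<in> borel_measurable MC" using f(1) by (rule version_measurable)
  have eq: "(\<integral>\<^sup>+y. indicator F (X y) * indicator D (Z y) * indicator G (Y y) \<partial>L1) =
          (\<integral>\<^sup>+y. f (Z y) * indicator D (Z y) * indicator G (Y y) \<partial>L1)"
    if G[measurable]: "G \<in> sets MB" and Gm: "G \<subseteq> KB m" for G m
  proof -
    obtain g where g: "version L1 MC Z (\<lambda>y. indicator G (Y y)) g" "\<And>z. g z \<le> 1"
      using version_exists_Y[OF G] by blast
    have "(\<integral>\<^sup>+y. indicator F (X y) * indicator D (Z y) * indicator G (Y y) \<partial>L1) =
        (\<integral>\<^sup>+y. indicator F (X y) * indicator G (Y y) * indicator D (Z y) \<partial>L1)" by (simp add: mult_ac)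
    also have "\<dots> = (\<integral>\<^sup>+y. f (Z y) * g (Z y) * indicator D (Z y) \<partial>L1)"
      by (rule eq_bounded[OF F Fn G Gm f g D Dk])
    also have "\<dots> = (\<integral>\<^sup>+y. g (Z y) * (f (Z y) * indicator D (Z y)) \<partial>L1)" by (simp add: mult_ac)
    also have "\<dots> = (\<integral>\<^sup>+y. indicator G (Y y) * (f (Z y) * indicator D (Z y)) \<partial>L1)"
      by (rule versionD[OF g(1), of "\<lambda>z. f z * indicator D z", symmetric]) measurable
    finally show ?thesis by (simp add: mult_ac)
  qed
  have m: "(\<lambda>y. indicator F (X y) * indicator D (Z y) :: ennreal) \<in> borel_measurable L1"
    "(\<lambda>y. f (Z y) * indicator D (Z y)) \<in> borel_measurable L1" "Y \<in> L1 \<rightarrow>\<^sub>M MB" by measurable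
  have fin: "(\<integral>\<^sup>+y. indicator F (X y) * indicator D (Z y) \<partial>L1) < \<infinity>"
    by (rule L1_Z_fin[OF Dk]) (simp add: indicator_def)
  show ?thesis
    by (rule integral_eq_extend[OF m(3,1,2) KB KB_inc KB_UN fin _ eq G])
      (rule versionD[OF f(1), of "indicator D"], simp_all)
qed

text \<open>Second extension, from bounded to arbitrary \<open>F\<close>. The version
  \<open>f\<close> varies with \<open>F\<close>, so the identity is first rewritten with the fixed
  version \<open>g\<close> of the indicator of \<open>G\<close>; then both sides are measures in
  \<open>F\<close> and extend as before.\<close>

lemma process_imp_ci_local:
  assumes F[measurable]: "F \<in> sets MA" and G[measurable]: "G \<in> sets MB"
    and D[measurable]: "D \<in> sets MC" and Dk: "D \<subseteq> KC k"
    and f: "version L1 MC Z (\<lambda>y. indicator F (X y)) f" "\<And>z. f z \<le> 1"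
  shows "(\<integral>\<^sup>+y. indicator F (X y) * indicator G (Y y) * indicator D (Z y) \<partial>L1) =
      (\<integral>\<^sup>+y. f (Z y) * indicator G (Y y) * indicator D (Z y) \<partial>L1)"
proof -
  obtain g where g: "version L1 MC Z (\<lambda>y. indicator G (Y y)) g" "\<And>z. g z \<le> 1"
    using version_exists_Y[OF G] by blast
  have [measurable]: "g \<in> borel_measurable MC" "f \<in> borel_measurable MC"
    using g(1) f(1) by (auto intro: version_measurable)
  have eq: "(\<integral>\<^sup>+y. indicator G (Y y) * indicator D (Z y) * indicator F (X y) \<partial>L1) =
          (\<integral>\<^sup>+y. g (Z y) * indicator D (Z y) * indicator F (X y) \<partial>L1)"
    if F[measurable]: "F \<in> sets MA" and Fn: "F \<subseteq> KA n" for F n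
  proof -
    obtain f where f: "version L1 MC Z (\<lambda>y. indicator F (X y)) f" "\<And>z. f z \<le> 1"
      using version_exists_X[OF F] by blast
    have [measurable]: "f \<in> borel_measurable MC" using f(1) by (rule version_measurable)
    have "(\<integral>\<^sup>+y. indicator G (Y y) * indicator D (Z y) * indicator F (X y) \<partial>L1) =
        (\<integral>\<^sup>+y. indicator G (Y y) * (f (Z y) * indicator D (Z y)) \<partial>L1)"
      using process_imp_ci_bounded[OF Fn F G D Dk f] by (simp add: mult_ac)
    also have "\<dots> = (\<integral>\<^sup>+y. g (Z y) * (f (Z y) * indicator D (Z y)) \<partial>L1)"
      by (rule versionD[OF g(1), of "\<lambda>z. f z * indicator D z"]) measurable
    also have "\<dots> = (\<integral>\<^sup>+y. f (Z y) * (g (Z y) * indicator D (Z y)) \<partial>L1)" by (simp add: mult_ac)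
    also have "\<dots> = (\<integral>\<^sup>+y. indicator F (X y) * (g (Z y) * indicator D (Z y)) \<partial>L1)"
      by (rule versionD[OF f(1), of "\<lambda>z. g z * indicator D z", symmetric]) measurable
    finally show ?thesis by (simp add: mult_ac)
  qed
  have m: "(\<lambda>y. indicator G (Y y) * indicator D (Z y) :: ennreal) \<in> borel_measurable L1"
    "(\<lambda>y. g (Z y) * indicator D (Z y)) \<in> borel_measurable L1" "X \<in> L1 \<rightarrow>\<^sub>M MA" by measurable
  have fin: "(\<integral>\<^sup>+y. indicator G (Y y) * indicator D (Z y) \<partial>L1) < \<infinity>"
    by (rule L1_Z_fin[OF Dk]) (simp add: indicator_def)
  have "(\<integral>\<^sup>+y. (indicator G (Y y) * indicator D (Z y)) * indicator F (X y) \<partial>L1) =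
      (\<integral>\<^sup>+y. (g (Z y) * indicator D (Z y)) * indicator F (X y) \<partial>L1)"
    by (rule integral_eq_extend[OF m(3,1,2) KA KA_inc KA_UN fin _ eq F])
      (rule versionD[OF g(1), of "indicator D"], simp_all)
  then have "(\<integral>\<^sup>+y. indicator F (X y) * indicator G (Y y) * indicator D (Z y) \<partial>L1) =
      (\<integral>\<^sup>+y. indicator F (X y) * (g (Z y) * indicator D (Z y)) \<partial>L1)" by (simp add: mult_ac)
  also have "\<dots> = (\<integral>\<^sup>+y. f (Z y) * (g (Z y) * indicator D (Z y)) \<partial>L1)"
    by (rule versionD[OF f(1), of "\<lambda>z. g z * indicator D z"]) measurable
  also have "\<dots> = (\<integral>\<^sup>+y. g (Z y) * (f (Z y) * indicator D (Z y)) \<partial>L1)" by (simp add: mult_ac)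
  also have "\<dots> = (\<integral>\<^sup>+y. indicator G (Y y) * (f (Z y) * indicator D (Z y)) \<partial>L1)"
    by (rule versionD[OF g(1), of "\<lambda>z. f z * indicator D z", symmetric]) measurable
  finally show ?thesis by (simp add: mult_ac)
qed

lemma process_imp_ci: "ci L1 MA X MB Y MC Z"
proof (rule ciI)
  fix F assume F[measurable]: "F \<in> sets MA"
  obtain f where f: "version L1 MC Z (\<lambda>y. indicator F (X y)) f" "\<And>z. f z \<le> 1"
    using version_exists_X[OF F] by blast
  have fm[measurable]: "f \<in> borel_measurable MC" using f(1) by (rule version_measurable)
  have ftop: "f z < top" for z using f(2)[of z] by (rule le_less_trans) simp
  have "(\<integral>\<^sup>+y. indicator F (X y) * indicator G (Y y) * indicator H (Z y) \<partial>L1) =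
      (\<integral>\<^sup>+y. f (Z y) * indicator G (Y y) * indicator H (Z y) \<partial>L1)"
    if G[measurable]: "G \<in> sets MB" and H: "H \<in> sets MC" for G H
  proof -
    have m: "(\<lambda>y. indicator F (X y) * indicator G (Y y) :: ennreal) \<in> borel_measurable L1"
      "(\<lambda>y. f (Z y) * indicator G (Y y)) \<in> borel_measurable L1" "Z \<in> L1 \<rightarrow>\<^sub>M MC" by measurable
    show ?thesis
      by (rule localized_integral_eqI[OF m(3,1,2) KC KC_inc L1_cover process_imp_ci_local[OF F G _ _ f] H])
  qed
  with ftop fm show "\<exists>f\<in>borel_measurable MC. (\<forall>z. f z < (top::ennreal)) \<and>
      (\<forall>G\<in>sets MB. \<forall>H\<in>sets MC.
        (\<integral>\<^sup>+y. indicator F (X y) * indicator G (Y y) * indicator H (Z y) \<partial>L1) =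
        (\<integral>\<^sup>+y. f (Z y) * indicator G (Y y) * indicator H (Z y) \<partial>L1))"
    by blast
qed measurable

end

theorem block_ci_iff_process:
  "block_ci \<longleftrightarrow> ci P (point_measure_algebra MA) xA (point_measure_algebra MB) xB (point_measure_algebra MC) xC"
proof
  assume block_ci
  then show "ci P (point_measure_algebra MA) xA (point_measure_algebra MB) xB (point_measure_algebra MC) xC"
    by (rule block_ci_imp_process)
next
  assume c: "ci P (point_measure_algebra MA) xA (point_measure_algebra MB) xB (point_measure_algebra MC) xC"
  show block_ci
    unfolding block_ci_def using process_imp_ci[OF c] process_imp_star[OF c] by (rule conjI)
qed

end

subsection \<open>Product spaces\<close>

lemma ci_null:
  assumes "emeasure Q (space Q) = 0"
  shows "ci Q MX X MY Y MZ Z"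
proof -
  have "(\<integral>\<^sup>+x. g x \<partial>Q) = 0" for g
  proof -
    have "AE x in Q. False" using assms by (intro AE_I[where N="space Q"]) auto
    then have "(\<integral>\<^sup>+x. g x \<partial>Q) = (\<integral>\<^sup>+x. 0 \<partial>Q)" by (intro nn_integral_cong_AE) auto
    then show ?thesis by simp
  qed
  then show ?thesis unfolding ci_def by (auto intro!: bexI[of _ "\<lambda>_. 0"])
qed

lemma ci_const_left:
  assumes "AE x in Q. X x = a"
  shows "ci Q MX X MY Y MZ Z"
  unfolding ci_def
proof
  fix F assume "F \<in> sets MX"
  have "(\<integral>\<^sup>+x. indicator F (X x) * indicator G (Y x) * w (Z x) \<partial>Q) =
        (\<integral>\<^sup>+x. indicator F a * indicator G (Y x) * w (Z x) \<partial>Q)" for G and w :: "_ \<Rightarrow> ennreal"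
    by (rule nn_integral_cong_AE) (use assms in \<open>eventually_elim, simp\<close>)
  then show "\<exists>f\<in>borel_measurable MZ. (\<forall>z. f z < (top::ennreal)) \<and>
      (\<forall>G\<in>sets MY. \<forall>w\<in>borel_measurable MZ.
        (\<integral>\<^sup>+x. indicator F (X x) * indicator G (Y x) * w (Z x) \<partial>Q) =
        (\<integral>\<^sup>+x. f (Z x) * indicator G (Y x) * w (Z x) \<partial>Q))"
    by (intro bexI[of _ "\<lambda>_. indicator F a"]) (auto simp: indicator_def)
qed

text \<open>With \<open>Y\<close> and \<open>Z\<close> constant, the witness is the constant
  normalized mass of \<open>F\<close>, for which finiteness of \<open>Q\<close> is used. The
  difference from \<open>ci_const_left\<close>, where the witness is just an indicator value,
  reflects the one-sided form of \<open>ci\<close>.\<close>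

lemma ci_const_right:
  assumes [measurable]: "X \<in> Q \<rightarrow>\<^sub>M MX" and "finite_measure Q" and Y: "AE x in Q. Y x = b" and Z: "AE x in Q. Z x = c"
  shows "ci Q MX X MY Y MZ Z"
  unfolding ci_def
proof
  interpret finite_measure Q by fact
  fix F assume [measurable]: "F \<in> sets MX"
  let ?q = "\<integral>\<^sup>+x. indicator F (X x) \<partial>Q" and ?e = "emeasure Q (space Q)"
  define p where "p = ?q / ?e"
  have le: "?q \<le> ?e"
  proof -
    have "?q \<le> (\<integral>\<^sup>+x. 1 \<partial>Q)" by (rule nn_integral_mono) (auto simp: indicator_def)
    then show ?thesis by simp
  qed
  have e: "?e < top" by (simp add: less_top[symmetric])
  then have q: "?q < top" using le by (rule le_less_trans[rotated])
  have p: "p < top" "p * ?e = ?q"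
  proof -
    show "p < top" using q le unfolding p_def by (cases "?e = 0") (auto simp: ennreal_divide_eq_top_iff less_top[symmetric])
    show "p * ?e = ?q"
    proof (cases "?e = 0")
      case True
      then show ?thesis using le by simp
    next
      case False
      then show ?thesis using e unfolding p_def by (simp add: ennreal_divide_times ennreal_mult_divide_eq less_top)
    qed
  qed
  have "(\<integral>\<^sup>+x. indicator F (X x) * indicator G (Y x) * w (Z x) \<partial>Q) =
        (\<integral>\<^sup>+x. p * indicator G (Y x) * w (Z x) \<partial>Q)" for G and w :: "_ \<Rightarrow> ennreal"
  proof -
    have "(\<integral>\<^sup>+x. indicator F (X x) * indicator G (Y x) * w (Z x) \<partial>Q) =
        (\<integral>\<^sup>+x. indicator F (X x) * (indicator G b * w c) \<partial>Q)"
      by (rule nn_integral_cong_AE) (use Y Z in \<open>eventually_elim, simp add: mult.assoc\<close>)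
    also have "\<dots> = p * ?e * (indicator G b * w c)" by (simp add: nn_integral_multc p)
    also have "\<dots> = (\<integral>\<^sup>+x. p * (indicator G b * w c) \<partial>Q)" by (simp add: mult_ac)
    also have "\<dots> = (\<integral>\<^sup>+x. p * indicator G (Y x) * w (Z x) \<partial>Q)"
      by (rule nn_integral_cong_AE) (use Y Z in \<open>eventually_elim, simp add: mult.assoc\<close>)
    finally show ?thesis .
  qed
  then show "\<exists>f\<in>borel_measurable MZ. (\<forall>z. f z < (top::ennreal)) \<and>
      (\<forall>G\<in>sets MY. \<forall>w\<in>borel_measurable MZ.
        (\<integral>\<^sup>+x. indicator F (X x) * indicator G (Y x) * w (Z x) \<partial>Q) =
        (\<integral>\<^sup>+x. f (Z x) * indicator G (Y x) * w (Z x) \<partial>Q))"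
    using p(1) by (intro bexI[of _ "\<lambda>_. p"]) auto
qed

lemma borel_isomorphic_singleton:
  assumes "borel_isomorphic N" "x \<in> space N"
  shows "{x} \<in> sets N"
proof -
  from assms(1) obtain S :: "real set" and f g where
    f: "f \<in> N \<rightarrow>\<^sub>M restrict_space borel S" and S: "S \<in> sets borel" and bij: "bij_betw f (space N) S"
    unfolding borel_isomorphic_def by blast
  have "f x \<in> S" using bij assms(2) by (auto simp: bij_betw_def)
  then have "{f x} \<in> sets (restrict_space borel S)" using S by (simp add: sets_restrict_space_iff)
  then have "f -` {f x} \<inter> space N \<in> sets N" by (rule measurable_sets[OF f])
  also have "f -` {f x} \<inter> space N = {x}"
    using bij assms(2) by (auto simp: bij_betw_def dest: inj_onD)
  finally show ?thesis .
qed

locale punctured_product =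
  fixes V A B C :: "nat set" and M :: "nat \<Rightarrow> 'a measure" and pt :: "nat \<Rightarrow> 'a"
    and L :: "nat \<Rightarrow> nat \<Rightarrow> 'a set" and \<Lambda> :: "(nat \<Rightarrow> 'a) measure"
  assumes finV: "finite V"
    and borel: "\<And>v. v \<in> V \<Longrightarrow> borel_isomorphic (M v)"
    and pt: "\<And>v. v \<in> V \<Longrightarrow> pt v \<in> space (M v)"
    and sets_\<Lambda>: "sets \<Lambda> = sets (punctured M pt V)"
    and loc1: "\<And>v. v \<in> V \<Longrightarrow> localized (restrict_space (M v) (space (M v) - {pt v})) (\<lambda>h. L h v)"
    and loc: "\<And>I. I \<subseteq> V \<Longrightarrow> I \<noteq> {} \<Longrightarrow> localized (punctured M pt I) (prod_loc M L I)"
    and fin: "\<And>h. h \<ge> 1 \<Longrightarrow> emeasure \<Lambda> (prod_loc M L V h) < \<infinity>"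
    and zero_inf: "\<And>I J. I \<subseteq> V \<Longrightarrow> J \<subseteq> V \<Longrightarrow> I \<inter> J = {} \<Longrightarrow> I \<noteq> {} \<Longrightarrow>
      emeasure \<Lambda> {y \<in> space \<Lambda>. restrict y I \<noteq> restrict pt I \<and> restrict y J = restrict pt J} \<in> {0, \<infinity>}"
    and part: "A \<union> B \<union> C = V" "A \<inter> B = {}" "A \<inter> C = {}" "B \<inter> C = {}"
    and neA: "A \<noteq> {}" and neB: "B \<noteq> {}"
begin

lemma sub: "A \<subseteq> V" "B \<subseteq> V" "C \<subseteq> V" and finABC: "finite A" "finite B" "finite C"
  using part finV by (auto intro: finite_subset)

lemma pt_sets: "v \<in> V \<Longrightarrow> {pt v} \<in> sets (M v)"
  using borel_isomorphic_singleton[OF borel pt] by simp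

lemma pt_space: "I \<subseteq> V \<Longrightarrow> restrict pt I \<in> space (PiM I M)"
  using pt by (auto simp: space_PiM)

lemma pt_PiM:
  assumes I: "I \<subseteq> V"
  shows "{restrict pt I} \<in> sets (PiM I M)"
proof -
  have "{restrict pt I} = PiE I (\<lambda>v. {pt v})"
    by (auto simp: PiE_iff extensional_def fun_eq_iff) 
  also have "\<dots> \<in> sets (PiM I M)"
    using I pt_sets finite_subset[OF I finV] by (intro sets_PiM_I_finite) auto
  finally show ?thesis .
qed

lemma space_punctured: "space (punctured M pt I) = space (PiM I M) - {restrict pt I}"
  by (auto simp: punctured_def space_restrict_space)

lemma sets_punctured:
  "I \<subseteq> V \<Longrightarrow> S \<in> sets (punctured M pt I) \<longleftrightarrow> S \<in> sets (PiM I M) \<and> restrict pt I \<notin> S"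
proof -
  assume I: "I \<subseteq> V"
  have "space (PiM I M) - {restrict pt I} \<in> sets (PiM I M)" using pt_PiM[OF I] by auto
  then show ?thesis
    by (auto simp: punctured_def sets_restrict_space_iff dest: sets.sets_into_space)
qed

lemma space_\<Lambda>: "space \<Lambda> = space (PiM V M) - {restrict pt V}"
  using sets_eq_imp_space_eq[OF sets_\<Lambda>] by (simp add: space_punctured)

lemma sets_\<Lambda>_iff: "S \<in> sets \<Lambda> \<longleftrightarrow> S \<in> sets (PiM V M) \<and> restrict pt V \<notin> S"
  by (simp add: sets_\<Lambda> sets_punctured)

lemma restr_measurable[measurable]: "I \<subseteq> V \<Longrightarrow> (\<lambda>y. restrict y I) \<in> \<Lambda> \<rightarrow>\<^sub>M PiM I M"
proof -
  assume I: "I \<subseteq> V"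
  have "(\<lambda>y. restrict y I) \<in> punctured M pt V \<rightarrow>\<^sub>M PiM I M"
    unfolding punctured_def by (rule measurable_restrict_space1[OF measurable_restrict_subset[OF I]])
  then show ?thesis by (simp cong: measurable_cong_sets add: sets_\<Lambda>)
qed

lemma L_sets: "v \<in> V \<Longrightarrow> h \<ge> 1 \<Longrightarrow> L h v \<in> sets (M v)"
  and L_sub: "v \<in> V \<Longrightarrow> h \<ge> 1 \<Longrightarrow> L h v \<subseteq> space (M v) - {pt v}"
proof -
  assume v: "v \<in> V" and h: "h \<ge> 1"
  have "space (M v) - {pt v} \<in> sets (M v)" using pt_sets[OF v] by auto
  moreover have "L h v \<in> sets (restrict_space (M v) (space (M v) - {pt v}))"
    using loc1[OF v] h by (auto simp: localized_def)
  ultimately show "L h v \<in> sets (M v)" "L h v \<subseteq> space (M v) - {pt v}"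
    by (auto simp: sets_restrict_space_iff)
qed

lemma L_mono: "v \<in> V \<Longrightarrow> 1 \<le> h \<Longrightarrow> h \<le> k \<Longrightarrow> L h v \<subseteq> L k v"
proof -
  assume v: "v \<in> V" and h: "1 \<le> h" "h \<le> k"
  show ?thesis using h(2)
  proof (induction rule: dec_induct)
    case (step n)
    have "L n v \<subseteq> L (n + 1) v" using loc1[OF v] step.hyps(1) h(1) by (simp add: localized_def)
    with step.IH show ?case by auto
  qed simp
qed

lemma L_UN: "v \<in> V \<Longrightarrow> (\<Union>h. L (Suc h) v) = space (M v) - {pt v}"
proof -
  assume v: "v \<in> V"
  have "(\<Union>h\<in>{1..}. L h v) = space (M v) - {pt v}"
    using loc1[OF v] by (auto simp: localized_def space_restrict_space)
  moreover have "(\<Union>h\<in>{1..}. L h v) = (\<Union>h. L (Suc h) v)"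
    by (auto simp: Suc_le_eq gr0_conv_Suc)
  ultimately show ?thesis by simp
qed

text \<open>Localizing sets are meaningful from index 1 on, the abstract sequences start at 0; hence
  the shift. For \<open>I = {}\<close> all sets are empty, which fits because the only point of the
  product is the distinguished one.\<close>

definition KI :: "nat set \<Rightarrow> nat \<Rightarrow> (nat \<Rightarrow> 'a) set" where "KI I n = prod_loc M L I (Suc n)"

lemma KI_sets[measurable]: "I \<subseteq> V \<Longrightarrow> KI I n \<in> sets (PiM I M)"
  using loc[of I] by (cases "I = {}") (auto simp: KI_def prod_loc_def localized_def sets_punctured)

lemma KI_inc: "I \<subseteq> V \<Longrightarrow> incseq (KI I)"
proof (cases "I = {}")
  case True
  then show ?thesis by (simp add: KI_def[abs_def] prod_loc_def incseq_def)
next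
  case False
  assume "I \<subseteq> V"
  from loc[OF this False] have "prod_loc M L I (Suc n) \<subseteq> prod_loc M L I (Suc n + 1)" for n
    by (simp add: localized_def)
  then show ?thesis by (intro incseq_SucI) (simp add: KI_def)
qed

lemma KI_UN: "I \<subseteq> V \<Longrightarrow> (\<Union>n. KI I n) = space (PiM I M) - {restrict pt I}"
proof (cases "I = {}")
  case True
  then show ?thesis by (simp add: KI_def prod_loc_def space_PiM restrict_def)
next
  case False
  assume I: "I \<subseteq> V"
  have "(\<Union>h\<in>{1..}. prod_loc M L I h) = space (PiM I M) - {restrict pt I}"
    using loc[OF I False] by (auto simp: localized_def space_punctured)
  moreover have "(\<Union>h\<in>{1..}. prod_loc M L I h) = (\<Union>n. KI I n)"
    unfolding KI_def by (auto simp: Suc_le_eq gr0_conv_Suc)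
  ultimately show ?thesis by simp
qed

lemma restr_space: "y \<in> space \<Lambda> \<Longrightarrow> I \<subseteq> V \<Longrightarrow> restrict y I \<in> space (PiM I M)"
  by (auto simp: space_\<Lambda> space_PiM)

lemma KI_fin:
  assumes I: "I \<subseteq> V"
  shows "(\<integral>\<^sup>+y. indicator (KI I n) (restrict y I) \<partial>\<Lambda>) < \<infinity>"
proof -
  have V: "KI V n \<in> sets \<Lambda>"
    using KI_sets[of V n] KI_UN[of V] by (auto simp: sets_\<Lambda>_iff)
  have "(\<integral>\<^sup>+y. indicator (KI I n) (restrict y I) \<partial>\<Lambda>) \<le> (\<integral>\<^sup>+y. indicator (KI V n) y \<partial>\<Lambda>)"
  proof (rule nn_integral_mono)
    fix y assume "y \<in> space \<Lambda>"
    then show "(indicator (KI I n) (restrict y I) :: ennreal) \<le> indicator (KI V n) y"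
      using I by (auto simp: indicator_def KI_def prod_loc_def cyl_def space_\<Lambda>)
  qed
  also have "\<dots> < \<infinity>" using V fin[of "Suc n"] by (simp add: KI_def)
  finally show ?thesis .
qed

lemma space_\<Lambda>_ext: "y \<in> space \<Lambda> \<Longrightarrow> y \<in> extensional V \<and> y \<noteq> restrict pt V"
  by (auto simp: space_\<Lambda> space_PiM PiE_iff)

lemma restrict_eq_iff: "restrict y I = restrict z I \<longleftrightarrow> (\<forall>i\<in>I. y i = z i)"
  by (auto simp: restrict_def fun_eq_iff)

lemma never: "y \<in> space \<Lambda> \<Longrightarrow> \<not> (restrict y A = restrict pt A \<and> restrict y B = restrict pt B \<and> restrict y C = restrict pt C)"
proof
  assume y: "y \<in> space \<Lambda>"
    and eq: "restrict y A = restrict pt A \<and> restrict y B = restrict pt B \<and> restrict y C = restrict pt C"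
  then have "restrict y V = restrict pt V" using part(1) by (auto simp: restrict_eq_iff)
  with space_\<Lambda>_ext[OF y] show False by (simp add: extensional_restrict)
qed

sublocale T: punctured_triple \<Lambda> "PiM A M" "\<lambda>y. restrict y A" "restrict pt A" "KI A"
  "PiM B M" "\<lambda>y. restrict y B" "restrict pt B" "KI B"
  "PiM C M" "\<lambda>y. restrict y C" "restrict pt C" "KI C"
proof
  show "emeasure \<Lambda> {y \<in> space \<Lambda>. restrict y C = restrict pt C} \<in> {0, \<infinity>}"
  proof -
    \<comment> \<open>A point of the punctured space that agrees with \<open>pt\<close> on
      \<open>C\<close> differs from it on \<open>A \<union> B\<close>, so the zero-infinity
      hypothesis applies to this set as well.\<close>
    have "{y \<in> space \<Lambda>. restrict y C = restrict pt C} =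
        {y \<in> space \<Lambda>. restrict y (A \<union> B) \<noteq> restrict pt (A \<union> B) \<and> restrict y C = restrict pt C}"
      using never by (auto simp: restrict_eq_iff)
    then show ?thesis using zero_inf[of "A \<union> B" C] part neA by auto
  qed
  show "emeasure \<Lambda> {y \<in> space \<Lambda>. restrict y A \<noteq> restrict pt A \<and> restrict y B = restrict pt B \<and> restrict y C = restrict pt C} \<in> {0, \<infinity>}"
  proof -
    have "{y \<in> space \<Lambda>. restrict y A \<noteq> restrict pt A \<and> restrict y B = restrict pt B \<and> restrict y C = restrict pt C} =
        {y \<in> space \<Lambda>. restrict y A \<noteq> restrict pt A \<and> restrict y (B \<union> C) = restrict pt (B \<union> C)}"
      by (auto simp: restrict_eq_iff)
    then show ?thesis using zero_inf[of A "B \<union> C"] part neA by auto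
  qed
  show "emeasure \<Lambda> {y \<in> space \<Lambda>. restrict y A = restrict pt A \<and> restrict y B \<noteq> restrict pt B \<and> restrict y C = restrict pt C} \<in> {0, \<infinity>}"
  proof -
    have "{y \<in> space \<Lambda>. restrict y A = restrict pt A \<and> restrict y B \<noteq> restrict pt B \<and> restrict y C = restrict pt C} =
        {y \<in> space \<Lambda>. restrict y B \<noteq> restrict pt B \<and> restrict y (A \<union> C) = restrict pt (A \<union> C)}"
      by (auto simp: restrict_eq_iff)
    then show ?thesis using zero_inf[of B "A \<union> C"] part neB by auto
  qed
qed (use sub restr_measurable KI_sets KI_inc KI_UN KI_fin pt_space never in auto)

abbreviation ci_on :: "(nat \<Rightarrow> 'a) set \<Rightarrow> bool" where
  "ci_on S \<equiv> ci (density \<Lambda> (indicator S)) (PiM A M) (\<lambda>y. restrict y A) (PiM B M) (\<lambda>y. restrict y B) (PiM C M) (\<lambda>y. restrict y C)"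

text \<open>\<open>ci\<close> is invariant under scaling, so the conditional law and the restricted
  measure are interchangeable. For \<open>C = {}\<close> the conditioning variable has a single
  value, and \<open>indep_var_iff_ci\<close> covers unconditional independence.\<close>

lemma coord_cond_indep_iff:
  assumes S[measurable]: "S \<in> sets \<Lambda>" and pos: "emeasure \<Lambda> S > 0" and "emeasure \<Lambda> S < \<infinity>"
  shows "coord_cond_indep M A B C (cond_law \<Lambda> S) \<longleftrightarrow> ci_on S"
proof -
  let ?Q = "cond_law \<Lambda> S" and ?e = "emeasure \<Lambda> S"
  have e: "?e \<noteq> 0" "?e \<noteq> top" using assms by auto
  have em: "emeasure (restrict_space \<Lambda> S) S = ?e" by (subst emeasure_restrict_space) auto
  have S': "S \<in> sets (restrict_space \<Lambda> S)" by (simp add: sets_restrict_space_iff)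
  interpret Q: prob_space ?Q
    unfolding cond_law_def by (rule prob_space_uniform_measure) (use em e in auto)
  have idem: "x * indicator S y * indicator S y = (x * indicator S y :: ennreal)" for x y
    by (simp add: indicator_def)
  have int: "(\<integral>\<^sup>+y. g y \<partial>?Q) = (\<integral>\<^sup>+y. g y * indicator S y \<partial>\<Lambda>) / ?e"
    if [measurable]: "g \<in> borel_measurable \<Lambda>" for g
  proof -
    have "(\<integral>\<^sup>+y. g y \<partial>?Q) = (\<integral>\<^sup>+y. g y * indicator S y \<partial>restrict_space \<Lambda> S) / ?e"
      unfolding cond_law_def em[symmetric] by (rule nn_integral_uniform_measure) (use S' in \<open>auto intro: measurable_restrict_space1\<close>)
    also have "(\<integral>\<^sup>+y. g y * indicator S y \<partial>restrict_space \<Lambda> S) = (\<integral>\<^sup>+y. g y * indicator S y * indicator S y \<partial>\<Lambda>)"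
      by (rule nn_integral_restrict_space) simp
    finally show ?thesis by (simp add: idem)
  qed
  have intS: "(\<integral>\<^sup>+y. g y \<partial>density \<Lambda> (indicator S)) = (\<integral>\<^sup>+y. g y * indicator S y \<partial>\<Lambda>)"
    if [measurable]: "g \<in> borel_measurable \<Lambda>" for g
    by (simp add: nn_integral_density mult.commute)
  have meas: "(\<lambda>y. restrict y I) \<in> ?Q \<rightarrow>\<^sub>M PiM I M" if "I \<subseteq> V" for I
    unfolding cond_law_def measurable_cong_sets[OF sets_uniform_measure refl]
    using restr_measurable[OF that] by (rule measurable_restrict_space1)
  have 1: "ci_on S \<Longrightarrow> ci ?Q (PiM A M) (\<lambda>y. restrict y A) (PiM B M) (\<lambda>y. restrict y B) (PiM C M) (\<lambda>y. restrict y C)"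
    by (rule ci_scale[where c="1 / ?e"])
      (use sub in \<open>auto simp: int intS divide_ennreal_def mult.commute intro: restr_measurable\<close>)
  \<comment> \<open>Here \<open>g\<close> is measurable only for the trace on \<open>S\<close>; it
    becomes measurable for \<Lambda> after multiplication with the indicator of
    \<open>S\<close>.\<close>
  have Q\<Lambda>: "(\<integral>\<^sup>+y. g y \<partial>density \<Lambda> (indicator S)) = ?e * (\<integral>\<^sup>+y. g y \<partial>?Q)" if "g \<in> borel_measurable ?Q" for g
  proof -
    have gm: "g \<in> borel_measurable (restrict_space \<Lambda> S)" using that unfolding cond_law_def by simp
    have "(\<integral>\<^sup>+y. g y \<partial>?Q) = (\<integral>\<^sup>+y. g y * indicator S y \<partial>restrict_space \<Lambda> S) / ?e"
      unfolding cond_law_def em[symmetric] by (rule nn_integral_uniform_measure) (use S' gm in auto)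
    also have "(\<integral>\<^sup>+y. g y * indicator S y \<partial>restrict_space \<Lambda> S) = (\<integral>\<^sup>+y. g y * indicator S y * indicator S y \<partial>\<Lambda>)"
      by (rule nn_integral_restrict_space) simp
    also have "\<dots> = (\<integral>\<^sup>+y. g y * indicator S y \<partial>\<Lambda>)" by (simp add: idem)
    finally have Qg: "(\<integral>\<^sup>+y. g y \<partial>?Q) = (\<integral>\<^sup>+y. g y * indicator S y \<partial>\<Lambda>) / ?e" .
    have gS: "(\<lambda>y. g y * indicator S y) \<in> borel_measurable \<Lambda>"
      using gm by (subst (asm) borel_measurable_restrict_space_iff_ennreal) auto
    have "(\<integral>\<^sup>+y. g y \<partial>density \<Lambda> (indicator S)) = (\<integral>\<^sup>+y. g y * indicator S y \<partial>density \<Lambda> (indicator S))"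
      by (rule nn_integral_cong_AE) (subst AE_density, auto simp: indicator_def)
    also have "\<dots> = (\<integral>\<^sup>+y. g y * indicator S y \<partial>\<Lambda>)"
      by (subst nn_integral_density) (use gS in \<open>auto intro!: nn_integral_cong simp: indicator_def\<close>)
    finally show ?thesis unfolding Qg ennreal_times_divide mult.commute[of ?e] using e by (simp add: ennreal_mult_divide_eq)
  qed
  have 2: "ci ?Q (PiM A M) (\<lambda>y. restrict y A) (PiM B M) (\<lambda>y. restrict y B) (PiM C M) (\<lambda>y. restrict y C) \<Longrightarrow> ci_on S"
    by (rule ci_scale[where c="?e", OF _ _ _ Q\<Lambda>]) (use sub meas in auto)
  have "coord_cond_indep M A B C ?Q \<longleftrightarrow> ci ?Q (PiM A M) (\<lambda>y. restrict y A) (PiM B M) (\<lambda>y. restrict y B) (PiM C M) (\<lambda>y. restrict y C)"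
  proof (cases "C = {}")
    case True
    have "space (PiM C M) = {\<lambda>_. undefined}" using True by (simp add: space_PiM)
    then have H: "H = {} \<or> (\<lambda>_. undefined) \<in> H" if "H \<in> sets (PiM C M)" for H
      using sets.sets_into_space[OF that] by auto
    have "restrict y C = (\<lambda>_. undefined)" for y :: "nat \<Rightarrow> 'a" using True by (simp add: restrict_def)
    then show ?thesis
      using True H unfolding coord_cond_indep_def
      by (subst Q.indep_var_iff_ci[OF meas[OF sub(1)] meas[OF sub(2)] meas[OF sub(3)]]) auto
  next
    case False
    then show ?thesis unfolding coord_cond_indep_def
      by (simp add: Q.cond_indep_var_iff_ci[OF meas[OF sub(1)] meas[OF sub(2)] meas[OF sub(3)]])
  qed
  with 1 2 show ?thesis by blast
qed

end

section \<open>Test sets and cylinders\<close>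

context punctured_product
begin

lemma null_ci_on:
  assumes "S \<in> sets \<Lambda>" "emeasure \<Lambda> S = 0"
  shows "ci_on S"
  by (rule ci_null) (use assms sets.sets_into_space[OF assms(1)] in \<open>simp add: emeasure_density Int_absorb1 nn_integral_indicator\<close>)

lemma ci_on_Z_restrict:
  assumes S[measurable]: "S \<in> sets \<Lambda>" and ci: "ci_on S" and D[measurable]: "D \<in> sets (PiM C M)"
  shows "ci_on {y \<in> S. restrict y C \<in> D}"
proof -
  have "ci (density (density \<Lambda> (indicator S)) (\<lambda>y. indicator (space (PiM A M)) (restrict y A) * indicator (space (PiM B M)) (restrict y B) * indicator D (restrict y C)))
     (PiM A M) (\<lambda>y. restrict y A) (PiM B M) (\<lambda>y. restrict y B) (PiM C M) (\<lambda>y. restrict y C)"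
    by (rule ci_restrict[OF _ _ _ _ _ _ ci]) (use sub in measurable)
  also have "density (density \<Lambda> (indicator S)) (\<lambda>y. indicator (space (PiM A M)) (restrict y A) * indicator (space (PiM B M)) (restrict y B) * indicator D (restrict y C)) =
      density \<Lambda> (\<lambda>y. indicator S y * (indicator (space (PiM A M)) (restrict y A) * indicator (space (PiM B M)) (restrict y B) * indicator D (restrict y C)))"
    by (rule density_density_eq) measurable
  also have "\<dots> = density \<Lambda> (indicator {y \<in> S. restrict y C \<in> D})"
  proof (rule density_cong)
    have "{y \<in> S. restrict y C \<in> D} = S \<inter> {y \<in> space \<Lambda>. restrict y C \<in> D}"
      using sets.sets_into_space[OF S] by auto
    also have "\<dots> \<in> sets \<Lambda>" by measurable
    finally show "indicator {y \<in> S. restrict y C \<in> D} \<in> borel_measurable \<Lambda>" by simp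
    show "AE y in \<Lambda>. indicator S y * (indicator (space (PiM A M)) (restrict y A) * indicator (space (PiM B M)) (restrict y B) * indicator D (restrict y C)) = (indicator {y \<in> S. restrict y C \<in> D} y :: ennreal)"
      by (rule AE_I2) (use restr_space sub in \<open>auto simp: indicator_def\<close>)
  qed measurable
  finally show ?thesis .
qed

lemma ci_on_glue:
  assumes S[measurable]: "S \<in> sets \<Lambda>" and D[measurable]: "\<And>n::nat. D n \<in> sets (PiM C M)" and disj: "disjoint_family D"
    and cover: "\<And>y. y \<in> S \<Longrightarrow> restrict y C \<in> (\<Union>n. D n)"
    and ci: "\<And>n. ci_on {y \<in> S. restrict y C \<in> D n}"
  shows "ci_on S"
proof (rule ci_glue[where D=D])
  show "AE y in density \<Lambda> (indicator S). restrict y C \<in> (\<Union>n. D n)"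
    by (subst AE_density) (use cover in \<open>auto simp: indicator_def\<close>)
  fix n
  have "density (density \<Lambda> (indicator S)) (\<lambda>y. indicator (D n) (restrict y C)) =
      density \<Lambda> (\<lambda>y. indicator S y * indicator (D n) (restrict y C))"
    by (rule density_density_eq) measurable
  also have "(\<lambda>y. indicator S y * indicator (D n) (restrict y C)) = (indicator {y \<in> S. restrict y C \<in> D n} :: _ \<Rightarrow> ennreal)"
    by (auto simp: indicator_def fun_eq_iff)
  finally have eq: "density (density \<Lambda> (indicator S)) (\<lambda>y. indicator (D n) (restrict y C)) =
    density \<Lambda> (indicator {y \<in> S. restrict y C \<in> D n})" .
  show "ci (density (density \<Lambda> (indicator S)) (\<lambda>y. indicator (D n) (restrict y C))) (PiM A M) (\<lambda>y. restrict y A)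
    (PiM B M) (\<lambda>y. restrict y B) (PiM C M) (\<lambda>y. restrict y C)"
    unfolding eq by (rule ci)
qed (use sub disj in measurable)

lemma L1_eq: "T.L1 = density \<Lambda> (indicator {y \<in> space \<Lambda>. restrict y C \<noteq> restrict pt C})"
  unfolding T.L1_def by (rule density_cong) (use restr_space sub in \<open>auto simp: indicator_def\<close>)

lemma C_punct_sets[measurable]: "{y \<in> space \<Lambda>. restrict y C \<noteq> restrict pt C} \<in> sets \<Lambda>"
  by (measurable, simp_all add: sub)

lemma PiE_blocks:
  assumes "y \<in> space \<Lambda>"
  shows "y \<in> PiE V R \<longleftrightarrow> restrict y A \<in> PiE A R \<and> restrict y B \<in> PiE B R \<and> restrict y C \<in> PiE C R"
proof -
  have "y \<in> extensional V" using space_\<Lambda>_ext[OF assms] by simp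
  then show ?thesis using part(1) by (auto simp: PiE_iff)
qed

text \<open>A test set is cut along \<open>y_C = o_C\<close>. Off \<open>o_C\<close> it is a product
  subset, and \<open>ci_restrict\<close> applies. On \<open>o_C\<close>, since the test set misses
  the distinguished point of the whole product, one of its factors over \<open>A\<close> and
  \<open>B\<close> misses the distinguished point of its block. By \<open>star\<close> the other
  block is then almost surely constant, and conditional independence is trivial.\<close>

lemma block_ci_imp_admits:
  assumes bc: "T.block_ci"
  shows "admits_cond_indep M L V \<Lambda> A B C"
  unfolding admits_cond_indep_def
proof
  have ci1: "ci_on {y \<in> space \<Lambda>. restrict y C \<noteq> restrict pt C}" and star: "T.star"
    using bc by (auto simp: T.block_ci_def L1_eq)
  fix S assume "S \<in> test_sets M L V \<Lambda>"
  then obtain R h where S: "S = PiE V R" and R: "\<And>v. v \<in> V \<Longrightarrow> R v \<in> sets (M v)" and pos: "emeasure \<Lambda> S > 0"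
    and h: "h \<ge> 1" "S \<subseteq> prod_loc M L V h"
    unfolding test_sets_def by blast
  have Sm[measurable]: "S \<in> sets \<Lambda>" using pos emeasure_notin_sets[of S \<Lambda>] by (metis less_irrefl)
  have KV: "prod_loc M L V h = KI V (h - 1)" using h by (simp add: KI_def)
  have KVm: "KI V n \<in> sets \<Lambda>" for n
    using KI_sets[of V n] KI_UN[of V] by (auto simp: sets_\<Lambda>_iff)
  have Sfin: "emeasure \<Lambda> S < \<infinity>"
    using h fin[OF h(1)] KVm[of "h - 1"] by (intro le_less_trans[OF emeasure_mono[OF h(2)]]) (auto simp: KV)
  have Ssub: "y \<in> space \<Lambda>" if "y \<in> S" for y using sets.sets_into_space[OF Sm] that by auto
  have RI[measurable]: "PiE I R \<in> sets (PiM I M)" if "I \<subseteq> V" for I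
    using that R finite_subset[OF that finV] by (intro sets_PiM_I_finite) auto
  \<comment> \<open>Two pieces, padded by empty sets because the gluing lemma takes a
    sequence.\<close>
  let ?D = "\<lambda>n::nat. if n = 0 then {restrict pt C} else if n = 1 then space (PiM C M) - {restrict pt C} else {}"
  have "ci_on S"
  proof (rule ci_on_glue[where D="?D"])
    show "disjoint_family ?D" by (auto simp: disjoint_family_on_def)
    show "restrict y C \<in> (\<Union>n. ?D n)" if "y \<in> S" for y
      using restr_space[OF Ssub[OF that] sub(3)] by (auto intro: exI[of _ 0] exI[of _ 1])
    have z0: "ci_on {y \<in> S. restrict y C = restrict pt C}"
    proof (cases "restrict pt C \<in> PiE C R")
      case False
      have "restrict y C \<noteq> restrict pt C" if "y \<in> S" for y
      proof -
        have "restrict y C \<in> PiE C R" using PiE_blocks[OF Ssub[OF that], of R] that by (simp add: S)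
        with False show ?thesis by metis
      qed
      then have e: "{y \<in> S. restrict y C = restrict pt C} = {}" by blast
      show ?thesis unfolding e by (rule null_ci_on) simp_all
    next
      case True
      let ?S0 = "{y \<in> S. restrict y C = restrict pt C}"
      have S0: "?S0 = S \<inter> {y \<in> space \<Lambda>. restrict y C = restrict pt C}" using Ssub by auto
      have S0m[measurable]: "?S0 \<in> sets \<Lambda>" unfolding S0 using sub by measurable
      have S0fin: "emeasure \<Lambda> ?S0 < \<infinity>"
        using Sfin by (intro le_less_trans[OF emeasure_mono[of ?S0 S]]) auto
      have "restrict pt V \<notin> S" using Sm by (simp add: sets_\<Lambda>_iff)
      then have "\<not> (restrict pt A \<in> PiE A R \<and> restrict pt B \<in> PiE B R)"
        using True part(1) unfolding S by (auto simp: PiE_iff)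
      then consider "restrict pt A \<notin> PiE A R" | "restrict pt B \<notin> PiE B R" by blast
      moreover have ae: "AE y in density \<Lambda> (indicator ?S0). restrict y A = restrict pt A \<or> restrict y B = restrict pt B"
      proof -
        have "AE y in \<Lambda>. \<not> (restrict y A \<noteq> restrict pt A \<and> restrict y B \<noteq> restrict pt B \<and> restrict y C = restrict pt C)"
          using star unfolding T.star_def by (subst AE_iff_measurable[OF _ refl]) (use sub in auto)
        then show ?thesis by (subst AE_density) (auto simp: indicator_def elim!: eventually_mono)
      qed
      moreover have inS: "AE y in density \<Lambda> (indicator ?S0). y \<in> ?S0"
        by (subst AE_density) (auto simp: indicator_def)
      ultimately show ?thesis
      proof cases
        \<comment> \<open>All points of the slice have \<open>y_A \<noteq> o_A\<close>, so
          \<open>star\<close> forces \<open>y_B = o_B\<close>.\<close>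
        case 1
        have "AE y in density \<Lambda> (indicator ?S0). restrict y B = restrict pt B"
          using ae inS
        proof eventually_elim
          case (elim y)
          then have "restrict y A \<in> PiE A R" using PiE_blocks[of y R] Ssub[of y] S by auto
          with elim(1) 1 show ?case by metis
        qed
        moreover have "AE y in density \<Lambda> (indicator ?S0). restrict y C = restrict pt C"
          using inS by eventually_elim simp
        moreover have "finite_measure (density \<Lambda> (indicator ?S0))"
          using S0fin sets.sets_into_space[OF S0m]
          by (intro finite_measureI) (simp add: emeasure_density Int_absorb1 nn_integral_indicator)
        ultimately show ?thesis using sub by (intro ci_const_right) auto
      next
        case 2
        have "AE y in density \<Lambda> (indicator ?S0). restrict y A = restrict pt A"
          using ae inS
        proof eventually_elim
          case (elim y)
          then have "restrict y B \<in> PiE B R" using PiE_blocks[of y R] Ssub[of y] S by auto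
          with elim(1) 2 show ?case by metis
        qed
        then show ?thesis by (rule ci_const_left)
      qed
    qed
    have z1: "ci_on {y \<in> S. restrict y C \<noteq> restrict pt C}"
    proof -
      let ?P = "{y \<in> space \<Lambda>. restrict y C \<noteq> restrict pt C}"
      let ?r = "\<lambda>y. indicator (PiE A R) (restrict y A) * indicator (PiE B R) (restrict y B) * indicator (PiE C R) (restrict y C) :: ennreal"
      have "ci (density (density \<Lambda> (indicator ?P)) ?r)
          (PiM A M) (\<lambda>y. restrict y A) (PiM B M) (\<lambda>y. restrict y B) (PiM C M) (\<lambda>y. restrict y C)"
        by (rule ci_restrict[OF _ _ _ _ _ _ ci1]) (use sub in measurable)
      also have "density (density \<Lambda> (indicator ?P)) ?r = density \<Lambda> (\<lambda>y. indicator ?P y * ?r y)"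
        by (rule density_density_eq) (use sub in measurable)
      also have "\<dots> = density \<Lambda> (indicator {y \<in> S. restrict y C \<noteq> restrict pt C})"
      proof (rule density_cong)
        have "{y \<in> S. restrict y C \<noteq> restrict pt C} = S \<inter> ?P" using Ssub by auto
        then show "indicator {y \<in> S. restrict y C \<noteq> restrict pt C} \<in> borel_measurable \<Lambda>" by simp
        show "AE y in \<Lambda>. indicator ?P y * ?r y = indicator {y \<in> S. restrict y C \<noteq> restrict pt C} y"
          by (rule AE_I2) (use PiE_blocks[of _ R] in \<open>auto simp: indicator_def S\<close>)
      qed (use sub in measurable)
      finally show ?thesis .
    qed
    have e: "{y \<in> S. restrict y C \<in> space (PiM C M) - {restrict pt C}} = {y \<in> S. restrict y C \<noteq> restrict pt C}"
      using restr_space[OF Ssub sub(3)] by auto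
    show "ci_on {y \<in> S. restrict y C \<in> ?D n}" for n
      using z0 z1 null_ci_on[of "{}"] e by auto
  qed auto
  then show "coord_cond_indep M A B C (cond_law \<Lambda> S)"
    by (simp add: coord_cond_indep_iff[OF Sm pos Sfin])
qed

lemma cyl_sets:
  assumes "I \<subseteq> V" "v \<in> I" "h \<ge> 1"
  shows "cyl M L I h v \<in> sets (PiM I M)" "cyl M L I h v = PiE I (\<lambda>u. if u = v then L h v else space (M u))"
proof -
  have Lv: "L h v \<in> sets (M v)" using assms by (intro L_sets) auto
  show e: "cyl M L I h v = PiE I (\<lambda>u. if u = v then L h v else space (M u))"
  proof (intro set_eqI iffI)
    fix y assume "y \<in> cyl M L I h v"
    then show "y \<in> PiE I (\<lambda>u. if u = v then L h v else space (M u))"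
      by (auto simp: cyl_def space_PiM PiE_iff)
  next
    fix y assume y: "y \<in> PiE I (\<lambda>u. if u = v then L h v else space (M u))"
    have yv: "y v \<in> L h v" using PiE_mem[OF y assms(2)] by simp
    have "y i \<in> space (M i)" if "i \<in> I" for i
      using PiE_mem[OF y that] sets.sets_into_space[OF Lv] by (auto split: if_splits)
    moreover have "y \<in> extensional I" using y by (simp add: PiE_iff)
    ultimately show "y \<in> cyl M L I h v" using yv by (simp add: cyl_def space_PiM PiE_iff)
  qed
  show "cyl M L I h v \<in> sets (PiM I M)"
    unfolding e using assms Lv finite_subset[OF assms(1) finV] by (intro sets_PiM_I_finite) auto
qed

lemma cyl_sub: "v \<in> V \<Longrightarrow> h \<ge> 1 \<Longrightarrow> cyl M L V h v \<subseteq> prod_loc M L V h"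
  by (auto simp: prod_loc_def)

lemma cyl_\<Lambda>[measurable]:
  assumes "v \<in> V" "h \<ge> 1"
  shows "cyl M L V h v \<in> sets \<Lambda>"
proof -
  have "restrict pt V \<notin> cyl M L V h v" using L_sub[OF assms] assms by (auto simp: cyl_def)
  then show ?thesis unfolding sets_\<Lambda>_iff using cyl_sets(1)[OF _ assms] by simp
qed

lemma cyl_fin: "v \<in> V \<Longrightarrow> h \<ge> 1 \<Longrightarrow> emeasure \<Lambda> (cyl M L V h v) < \<infinity>"
proof -
  assume v: "v \<in> V" "h \<ge> 1"
  have "KI V (h - 1) \<in> sets \<Lambda>"
    using KI_sets[of V "h - 1"] KI_UN[of V] by (auto simp: sets_\<Lambda>_iff)
  then have "prod_loc M L V h \<in> sets \<Lambda>" using v by (simp add: KI_def)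
  from emeasure_mono[OF cyl_sub[OF v] this] fin[OF v(2)] show ?thesis by (rule le_less_trans)
qed

lemma admits_imp_cyl:
  assumes adm: "admits_cond_indep M L V \<Lambda> A B C" and v: "v \<in> V" "h \<ge> 1" and pos: "emeasure \<Lambda> (cyl M L V h v) > 0"
  shows "coord_cond_indep M A B C (cond_law \<Lambda> (cyl M L V h v))"
proof -
  have "cyl M L V h v \<in> test_sets M L V \<Lambda>"
    unfolding test_sets_def mem_Collect_eq
    using cyl_sets(2)[of V v h] v pos cyl_sub[OF v] L_sets[OF v]
    by (intro exI[of _ "\<lambda>u. if u = v then L h v else space (M u)"]) auto
  with adm show ?thesis by (auto simp: admits_cond_indep_def)
qed

lemma cyl_ci_on:
  assumes v: "v \<in> V" "h \<ge> 1"
    and ci: "emeasure \<Lambda> (cyl M L V h v) > 0 \<Longrightarrow> coord_cond_indep M A B C (cond_law \<Lambda> (cyl M L V h v))"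
  shows "ci_on (cyl M L V h v)"
proof (cases "emeasure \<Lambda> (cyl M L V h v) = 0")
  case True
  with v show ?thesis by (intro null_ci_on) auto
next
  case False
  then have pos: "emeasure \<Lambda> (cyl M L V h v) > 0" by (simp add: zero_less_iff_neq_zero)
  with ci show ?thesis using coord_cond_indep_iff[OF cyl_\<Lambda>[OF v] pos cyl_fin[OF v]] by simp
qed

text \<open>The cylinders over coordinates in \<open>C\<close> depend on \<open>y_C\<close> only and
  cover \<open>y_C \<noteq> o_C\<close>. Made disjoint they remain sets of values of
  \<open>y_C\<close>, so conditional independence restricts to the pieces and can be glued.\<close>

lemma cyl_imp_ci_L1:
  assumes ci: "\<And>c h. c \<in> C \<Longrightarrow> h \<ge> 1 \<Longrightarrow> emeasure \<Lambda> (cyl M L V h c) > 0 \<Longrightarrow>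
      coord_cond_indep M A B C (cond_law \<Lambda> (cyl M L V h c))"
  shows "ci T.L1 (PiM A M) (\<lambda>y. restrict y A) (PiM B M) (\<lambda>y. restrict y B) (PiM C M) (\<lambda>y. restrict y C)"
  unfolding L1_eq
proof -
  let ?S = "{y \<in> space \<Lambda>. restrict y C \<noteq> restrict pt C}"
  \<comment> \<open>An enumeration of all pairs of a coordinate and a level; coordinates outside
    \<open>C\<close> contribute the empty set, and \<open>Suc h\<close> skips the level 0.\<close>
  define E where "E n = (case prod_decode n of (c, h) \<Rightarrow> if c \<in> C then cyl M L C (Suc h) c else {})" for n
  have E[measurable]: "E n \<in> sets (PiM C M)" for n
    using cyl_sets[OF sub(3)] by (auto simp: E_def split: prod.split)
  have E_UN: "(\<Union>n. E n) = space (PiM C M) - {restrict pt C}"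
  proof -
    have "(\<Union>n. E n) = (\<Union>h. \<Union>c\<in>C. cyl M L C (Suc h) c)"
    proof (intro set_eqI iffI)
      fix z assume "z \<in> (\<Union>n. E n)"
      then obtain n where n: "z \<in> E n" by blast
      obtain c h where "prod_decode n = (c, h)" by force
      with n show "z \<in> (\<Union>h. \<Union>c\<in>C. cyl M L C (Suc h) c)" by (auto simp: E_def split: if_splits)
    next
      fix z assume "z \<in> (\<Union>h. \<Union>c\<in>C. cyl M L C (Suc h) c)"
      then obtain h c where "c \<in> C" "z \<in> cyl M L C (Suc h) c" by auto
      then have "z \<in> E (prod_encode (c, h))" by (simp add: E_def)
      then show "z \<in> (\<Union>n. E n)" by blast
    qed
    then show ?thesis using KI_UN[OF sub(3)] by (simp add: KI_def prod_loc_def)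
  qed
  show "ci_on ?S"
  proof (rule ci_on_glue[where D="disjointed E"])
    show "disjoint_family (disjointed E)" by (rule disjoint_family_disjointed)
    show "disjointed E n \<in> sets (PiM C M)" for n
      using sets.range_disjointed_sets[of E "PiM C M"] E by (simp add: image_subset_iff)
    show "restrict y C \<in> (\<Union>n. disjointed E n)" if "y \<in> ?S" for y
      using that restr_space[of y C] sub unfolding UN_disjointed_eq E_UN by auto
    fix n
    obtain c h where ch: "prod_decode n = (c, h)" by force
    show "ci_on {y \<in> ?S. restrict y C \<in> disjointed E n}"
    proof (cases "c \<in> C")
      case False
      then have "E n = {}" by (simp add: E_def ch)
      then have "disjointed E n = {}" using disjointed_subset[of E n] by simp
      then show ?thesis using null_ci_on[of "{}"] by simp
    next
      case True
      then have c: "c \<in> V" using sub by auto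
      have En: "E n = cyl M L C (Suc h) c" using True by (simp add: E_def ch)
      have "{y \<in> ?S. restrict y C \<in> disjointed E n} = {y \<in> cyl M L V (Suc h) c. restrict y C \<in> disjointed E n}"
      proof (intro Collect_cong iffI)
        fix y assume y: "y \<in> ?S \<and> restrict y C \<in> disjointed E n"
        then have "restrict y C \<in> E n" using disjointed_subset[of E n] by auto
        then show "y \<in> cyl M L V (Suc h) c \<and> restrict y C \<in> disjointed E n"
          using y True by (auto simp: En cyl_def space_\<Lambda>)
      next
        fix y assume y: "y \<in> cyl M L V (Suc h) c \<and> restrict y C \<in> disjointed E n"
        then have "restrict y C \<in> (\<Union>n. E n)" using disjointed_subset[of E n] by auto
        then have "restrict y C \<noteq> restrict pt C" by (simp add: E_UN)
        moreover have "y \<in> space \<Lambda>" using y sets.sets_into_space[OF cyl_\<Lambda>[OF c, of "Suc h"]] by auto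
        ultimately show "y \<in> ?S \<and> restrict y C \<in> disjointed E n" using y by auto
      qed
      moreover have "ci_on {y \<in> cyl M L V (Suc h) c. restrict y C \<in> disjointed E n}"
      proof (rule ci_on_Z_restrict)
        show "ci_on (cyl M L V (Suc h) c)" by (rule cyl_ci_on[OF c]) (use ci True in auto)
        show "disjointed E n \<in> sets (PiM C M)" using sets.range_disjointed_sets[of E "PiM C M"] E by (simp add: image_subset_iff)
      qed (use c in simp)
      ultimately show ?thesis by simp
    qed
  qed measurable
qed

text \<open>On a cylinder at \<open>b\<close> of level \<open>k + j\<close>, conditional
  independence at \<open>y_C = o_C\<close> says that a bounded \<open>A\<close>-event takes the same
  fraction of every \<open>B\<close>-slice inside the cylinder. Comparing the slices of levels
  \<open>k\<close> and \<open>k + j\<close> bounds the product of the masses of \<open>?S j\<close>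
  and \<open>?N n b k\<close> independently of \<open>j\<close>. If the latter mass were positive,
  the limit \<open>?U\<close> would have finite mass, hence mass 0, although it contains
  \<open>?N n b k\<close>.\<close>

lemma cyl_imp_star:
  assumes ci: "\<And>b h. b \<in> B \<Longrightarrow> h \<ge> 1 \<Longrightarrow> emeasure \<Lambda> (cyl M L V h b) > 0 \<Longrightarrow>
      coord_cond_indep M A B C (cond_law \<Lambda> (cyl M L V h b))"
  shows T.star
proof -
  let ?c0 = "restrict pt C"
  let ?N = "\<lambda>n b k. {y \<in> space \<Lambda>. restrict y A \<in> KI A n \<and> restrict y B \<in> cyl M L B (Suc k) b \<and> restrict y C = ?c0}"
  note T.X[measurable] T.Y[measurable] T.Z[measurable] T.KA[measurable]
  have cylB[measurable]: "cyl M L B (Suc k) b \<in> sets (PiM B M)" if "b \<in> B" for k b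
    using cyl_sets(1)[OF sub(2) that] by simp
  have null: "?N n b k \<in> null_sets \<Lambda>" if b: "b \<in> B" for n b k
  proof (rule ccontr)
    have bV: "b \<in> V" using b sub by auto
    let ?F = "KI A n" and ?G = "cyl M L B (Suc k) b"
    let ?S = "\<lambda>j. {y \<in> space \<Lambda>. restrict y B \<in> cyl M L B (Suc (k + j)) b \<and> restrict y C = ?c0}"
    note cylB[OF b, measurable]
    have [measurable]: "?N n b k \<in> sets \<Lambda>" "?S j \<in> sets \<Lambda>" for j by measurable
    have cyl_iff: "y \<in> cyl M L V (Suc j) b \<longleftrightarrow> restrict y B \<in> cyl M L B (Suc j) b" if "y \<in> space \<Lambda>" for y j
      using that b restr_space[OF that sub(2)] by (auto simp: cyl_def space_\<Lambda>)
    have mono: "cyl M L B (Suc k) b \<subseteq> cyl M L B (Suc (k + j)) b" for j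
      using L_mono[OF bV, of "Suc k" "Suc (k + j)"] by (auto simp: cyl_def)
    assume "?N n b k \<notin> null_sets \<Lambda>"
    then have pos: "emeasure \<Lambda> (?N n b k) \<noteq> 0" by (auto simp: null_sets_def)
    \<comment> \<open>Both are masses of bounded sets, hence finite, and neither depends on
      \<open>j\<close>.\<close>
    let ?\<gamma> = "\<integral>\<^sup>+y. indicator ?F (restrict y A) \<partial>\<Lambda>" and ?\<beta> = "emeasure \<Lambda> (?S 0)"
    have \<beta>: "?\<beta> < \<infinity>"
    proof -
      have "?S 0 \<subseteq> cyl M L V (Suc k) b" using cyl_iff by auto
      from emeasure_mono[OF this cyl_\<Lambda>[OF bV]] cyl_fin[OF bV, of "Suc k"] show ?thesis by (auto intro: le_less_trans)
    qed
    have bound: "emeasure \<Lambda> (?S j) * emeasure \<Lambda> (?N n b k) \<le> ?\<gamma> * ?\<beta>" for j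
    proof -
      let ?C = "cyl M L V (Suc (k + j)) b"
      have Cm[measurable]: "?C \<in> sets \<Lambda>" using cyl_\<Lambda>[OF bV] by simp
      have "ci_on ?C" by (rule cyl_ci_on[OF bV]) (use ci b in auto)
      moreover have "?F \<in> sets (PiM A M)" by measurable
      ultimately obtain f where f[measurable]: "f \<in> borel_measurable (PiM C M)"
        and eq: "\<And>G w. G \<in> sets (PiM B M) \<Longrightarrow> w \<in> borel_measurable (PiM C M) \<Longrightarrow>
          (\<integral>\<^sup>+y. indicator ?F (restrict y A) * indicator G (restrict y B) * w (restrict y C) \<partial>density \<Lambda> (indicator ?C)) =
          (\<integral>\<^sup>+y. f (restrict y C) * indicator G (restrict y B) * w (restrict y C) \<partial>density \<Lambda> (indicator ?C))"
        unfolding ci_def by blast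
      have key: "emeasure \<Lambda> {y \<in> space \<Lambda>. restrict y A \<in> ?F \<and> restrict y B \<in> G \<and> restrict y C = ?c0} =
          f ?c0 * emeasure \<Lambda> {y \<in> space \<Lambda>. restrict y B \<in> G \<and> restrict y C = ?c0}"
        if G[measurable]: "G \<in> sets (PiM B M)" and GC: "G \<subseteq> cyl M L B (Suc (k + j)) b" for G
      proof -
        have inC: "y \<in> ?C" if "y \<in> space \<Lambda>" "restrict y B \<in> G" for y
          using cyl_iff[OF that(1), of "k + j"] that(2) GC by blast
        have "emeasure \<Lambda> {y \<in> space \<Lambda>. restrict y A \<in> ?F \<and> restrict y B \<in> G \<and> restrict y C = ?c0} =
            (\<integral>\<^sup>+y. indicator {y \<in> space \<Lambda>. restrict y A \<in> ?F \<and> restrict y B \<in> G \<and> restrict y C = ?c0} y \<partial>\<Lambda>)"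
          by (rule nn_integral_indicator[symmetric]) measurable
        also have "\<dots> = (\<integral>\<^sup>+y. indicator ?F (restrict y A) * indicator G (restrict y B) * indicator {?c0} (restrict y C) \<partial>density \<Lambda> (indicator ?C))"
          by (subst nn_integral_density, measurable, rule nn_integral_cong)
            (use inC in \<open>auto simp: indicator_def split: if_splits\<close>)
        also have "\<dots> = (\<integral>\<^sup>+y. f (restrict y C) * indicator G (restrict y B) * indicator {?c0} (restrict y C) \<partial>density \<Lambda> (indicator ?C))"
          by (rule eq) measurable
        also have "\<dots> = (\<integral>\<^sup>+y. f ?c0 * indicator {y \<in> space \<Lambda>. restrict y B \<in> G \<and> restrict y C = ?c0} y \<partial>\<Lambda>)"
          by (subst nn_integral_density, measurable, rule nn_integral_cong)
            (use inC in \<open>auto simp: indicator_def split: if_splits\<close>)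
        also have "\<dots> = f ?c0 * emeasure \<Lambda> {y \<in> space \<Lambda>. restrict y B \<in> G \<and> restrict y C = ?c0}"
          by (rule nn_integral_cmult_indicator) measurable
        finally show ?thesis .
      qed
      \<comment> \<open>The witness \<open>f\<close> belongs to the large cylinder and is common to
        the small slice here and the full slice in the next estimate.\<close>
      have 1: "emeasure \<Lambda> (?N n b k) = f ?c0 * ?\<beta>"
        using key[of ?G] mono[of j] by simp
      have 2: "f ?c0 * emeasure \<Lambda> (?S j) \<le> ?\<gamma>"
      proof -
        have "f ?c0 * emeasure \<Lambda> (?S j) = emeasure \<Lambda> (?N n b (k + j))"
          using key[of "cyl M L B (Suc (k + j)) b"] by simp
        also have "\<dots> = (\<integral>\<^sup>+y. indicator (?N n b (k + j)) y \<partial>\<Lambda>)"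
          by (rule nn_integral_indicator[symmetric]) measurable
        also have "\<dots> \<le> ?\<gamma>" by (rule nn_integral_mono) (auto simp: indicator_def)
        finally show ?thesis .
      qed
      have "emeasure \<Lambda> (?S j) * emeasure \<Lambda> (?N n b k) = (f ?c0 * emeasure \<Lambda> (?S j)) * ?\<beta>"
        unfolding 1 by (simp add: mult_ac)
      also have "\<dots> \<le> ?\<gamma> * ?\<beta>" using 2 by (rule mult_right_mono) simp
      finally show ?thesis .
    qed
    let ?U = "{y \<in> space \<Lambda>. restrict y {b} \<noteq> restrict pt {b} \<and> restrict y C = ?c0}"
    have U: "(\<Union>j. ?S j) = ?U"
    proof (rule set_eqI)
      fix y
      show "y \<in> (\<Union>j. ?S j) \<longleftrightarrow> y \<in> ?U"
      proof (cases "y \<in> space \<Lambda>")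
        case True
        then have yb: "y b \<in> space (M b)" using bV by (auto simp: space_\<Lambda> space_PiM)
        have ex: "(\<exists>j. y b \<in> L (Suc (k + j)) b) \<longleftrightarrow> (\<exists>h. y b \<in> L (Suc h) b)"
        proof
          assume "\<exists>h. y b \<in> L (Suc h) b"
          then obtain h where "y b \<in> L (Suc h) b" ..
          then have "y b \<in> L (Suc (k + h)) b" using L_mono[OF bV, of "Suc h" "Suc (k + h)"] by auto
          then show "\<exists>j. y b \<in> L (Suc (k + j)) b" ..
        qed blast
        also have "\<dots> \<longleftrightarrow> y b \<in> (\<Union>h. L (Suc h) b)" by simp
        also have "\<dots> \<longleftrightarrow> y b \<noteq> pt b" unfolding L_UN[OF bV] using yb by simp
        finally show ?thesis using True b restr_space[OF True sub(2)] by (auto simp: cyl_def restrict_eq_iff)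
      qed simp
    qed
    have "incseq ?S"
    proof (rule incseq_SucI)
      show "?S j \<subseteq> ?S (Suc j)" for j
        using L_mono[OF bV, of "Suc (k + j)" "Suc (k + Suc j)"] by (auto simp: cyl_def)
    qed
    then have "emeasure \<Lambda> ?U = (SUP j. emeasure \<Lambda> (?S j))"
      unfolding U[symmetric] by (intro SUP_emeasure_incseq[symmetric]) auto
    then have "emeasure \<Lambda> ?U * emeasure \<Lambda> (?N n b k) = (SUP j. emeasure \<Lambda> (?S j) * emeasure \<Lambda> (?N n b k))"
      by (simp add: SUP_mult_right_ennreal)
    also have "\<dots> \<le> ?\<gamma> * ?\<beta>" by (rule SUP_least) (rule bound)
    also have "\<dots> < \<infinity>" using \<beta> KI_fin[OF sub(1), of n] by (simp add: ennreal_mult_less_top)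
    finally have "emeasure \<Lambda> ?U * emeasure \<Lambda> (?N n b k) < \<infinity>" .
    with pos have "emeasure \<Lambda> ?U \<noteq> \<infinity>" by (auto simp: ennreal_mult_eq_top_iff less_top[symmetric])
    moreover have "emeasure \<Lambda> ?U \<in> {0, \<infinity>}"
    proof (rule zero_inf)
      show "{b} \<inter> C = {}" using part(4) b by blast
    qed (use bV sub in auto)
    ultimately have U0: "emeasure \<Lambda> ?U = 0" by auto
    have "?N n b k \<subseteq> ?U" unfolding U[symmetric] by (rule subsetI, rule UN_I[of 0]) auto
    moreover have "?U \<in> sets \<Lambda>" unfolding U[symmetric] by measurable
    ultimately have "emeasure \<Lambda> (?N n b k) \<le> emeasure \<Lambda> ?U" by (rule emeasure_mono)
    with U0 pos show False by simp
  qed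
  have "(\<Union>n. \<Union>k. \<Union>b\<in>B. ?N n b k) \<in> null_sets \<Lambda>"
    using null finABC(2) by (intro null_sets_UN null_sets.finite_UN) auto
  moreover have "(\<Union>n. \<Union>k. \<Union>b\<in>B. ?N n b k) =
      {y \<in> space \<Lambda>. restrict y A \<noteq> restrict pt A \<and> restrict y B \<noteq> restrict pt B \<and> restrict y C = restrict pt C}"
  proof (rule set_eqI)
    fix y
    have "(\<exists>n. restrict y A \<in> KI A n) \<longleftrightarrow> restrict y A \<in> space (PiM A M) - {restrict pt A}"
      unfolding KI_UN[OF sub(1), symmetric] by simp
    moreover have "(\<exists>k. \<exists>b\<in>B. restrict y B \<in> cyl M L B (Suc k) b) \<longleftrightarrow> restrict y B \<in> space (PiM B M) - {restrict pt B}"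
      unfolding KI_UN[OF sub(2), symmetric] by (simp add: KI_def prod_loc_def)
    ultimately show "y \<in> (\<Union>n. \<Union>k. \<Union>b\<in>B. ?N n b k) \<longleftrightarrow>
      y \<in> {y \<in> space \<Lambda>. restrict y A \<noteq> restrict pt A \<and> restrict y B \<noteq> restrict pt B \<and> restrict y C = restrict pt C}"
      using restr_space[of y A] restr_space[of y B] sub by auto
  qed
  ultimately show ?thesis by (auto simp: T.star_def)
qed

lemma admits_iff_block_ci: "admits_cond_indep M L V \<Lambda> A B C \<longleftrightarrow> T.block_ci"
proof
  assume "admits_cond_indep M L V \<Lambda> A B C"
  from admits_imp_cyl[OF this] show T.block_ci
    unfolding T.block_ci_def using sub by (intro conjI cyl_imp_ci_L1 cyl_imp_star) auto
qed (rule block_ci_imp_admits)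

lemma admits_iff_cyl: "admits_cond_indep M L V \<Lambda> A B C \<longleftrightarrow>
    (\<forall>v\<in>V. \<forall>h\<ge>1. emeasure \<Lambda> (cyl M L V h v) > 0 \<longrightarrow> coord_cond_indep M A B C (cond_law \<Lambda> (cyl M L V h v)))"
proof
  assume "\<forall>v\<in>V. \<forall>h\<ge>1. emeasure \<Lambda> (cyl M L V h v) > 0 \<longrightarrow> coord_cond_indep M A B C (cond_law \<Lambda> (cyl M L V h v))"
  then have "T.block_ci"
    unfolding T.block_ci_def using sub by (intro conjI cyl_imp_ci_L1 cyl_imp_star) auto
  then show "admits_cond_indep M L V \<Lambda> A B C" by (rule block_ci_imp_admits)
qed (use admits_imp_cyl in auto)

lemma admits_iff_cyl_C: "admits_cond_indep M L V \<Lambda> A B C \<longleftrightarrow>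
    (\<forall>c\<in>C. \<forall>h\<ge>1. emeasure \<Lambda> (cyl M L V h c) > 0 \<longrightarrow> coord_cond_indep M A B C (cond_law \<Lambda> (cyl M L V h c))) \<and> T.star"
proof
  assume "(\<forall>c\<in>C. \<forall>h\<ge>1. emeasure \<Lambda> (cyl M L V h c) > 0 \<longrightarrow> coord_cond_indep M A B C (cond_law \<Lambda> (cyl M L V h c))) \<and> T.star"
  then have "T.block_ci"
    unfolding T.block_ci_def by (intro conjI cyl_imp_ci_L1) auto
  then show "admits_cond_indep M L V \<Lambda> A B C" by (rule block_ci_imp_admits)
next
  assume a: "admits_cond_indep M L V \<Lambda> A B C"
  then have "T.star" by (simp add: admits_iff_block_ci T.block_ci_def)
  with admits_imp_cyl[OF a] sub show "(\<forall>c\<in>C. \<forall>h\<ge>1. emeasure \<Lambda> (cyl M L V h c) > 0 \<longrightarrow> coord_cond_indep M A B C (cond_law \<Lambda> (cyl M L V h c))) \<and> T.star"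
    by auto
qed

end

subsection \<open>Disintegration\<close>

text \<open>The generator consists of the preimages of half-lines with rational endpoints. It
  suffices because the inverse \<open>g\<close> is measurable: every measurable set is the preimage
  under \<open>f\<close> of a Borel set of reals.\<close>

lemma borel_isomorphic_generator:
  assumes "borel_isomorphic N"
  shows "\<exists>E. countable E \<and> E \<subseteq> Pow (space N) \<and> space N \<in> E \<and> Int_stable E \<and> sets N = sigma_sets (space N) E"
proof -
  from assms obtain S :: "real set" and f g where S: "S \<in> sets borel"
    and f: "f \<in> N \<rightarrow>\<^sub>M restrict_space borel S" and g: "g \<in> restrict_space borel S \<rightarrow>\<^sub>M N"
    and gf: "\<And>x. x \<in> space N \<Longrightarrow> g (f x) = x"
    unfolding borel_isomorphic_def by blast
  have fS: "f x \<in> S" if "x \<in> space N" for x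
    using measurable_space[OF f that] by (simp add: space_restrict_space)
  have fb: "f \<in> borel_measurable N" using f by (simp add: measurable_restrict_space2_iff)
  define H where "H q = {x \<in> space N. f x \<le> q}" for q :: real
  define E where "E = insert (space N) (H ` \<rat>)"
  have EN: "E \<subseteq> sets N" using fb by (auto simp: E_def H_def)
  then have E: "E \<subseteq> Pow (space N)" using sets.sets_into_space by blast
  have "countable E" by (simp add: E_def countable_rat)
  have HH: "H p \<inter> H q = H (min p q)" for p q by (auto simp: H_def)
  have "Int_stable E"
  proof (rule Int_stableI)
    fix a b assume "a \<in> E" "b \<in> E"
    moreover have "H p \<inter> space N = H p" "space N \<inter> H p = H p" for p by (auto simp: H_def)
    ultimately show "a \<inter> b \<in> E"
      unfolding E_def by (auto simp: HH min_def)
  qed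
  let ?T = "sigma (space N) E"
  have T: "sets ?T = sigma_sets (space N) E" "space ?T = space N" using E by auto
  have "f \<in> borel_measurable ?T"
    unfolding borel_measurable_iff_le
  proof
    fix a
    have "{x \<in> space ?T. f x \<le> a} = (\<Inter>q\<in>{q\<in>\<rat>. a < q}. H q)"
    proof (rule set_eqI)
      fix x
      have "\<exists>q\<in>\<rat>. a < q" using Rats_dense_in_real[of a "a + 1"] by auto
      moreover have "f x \<le> a" if "\<And>q. q \<in> \<rat> \<Longrightarrow> a < q \<Longrightarrow> f x \<le> q"
      proof (rule ccontr)
        assume "\<not> f x \<le> a"
        then obtain q where "q \<in> \<rat>" "a < q" "q < f x" using Rats_dense_in_real[of a "f x"] by auto
        with that show False by force
      qed
      ultimately show "x \<in> {x \<in> space ?T. f x \<le> a} \<longleftrightarrow> x \<in> (\<Inter>q\<in>{q\<in>\<rat>. a < q}. H q)"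
        by (auto simp: H_def T(2)) 
    qed
    also have "\<dots> \<in> sets ?T"
    proof (rule sets.countable_INT')
      show "countable {q \<in> \<rat>. a < q}" by (rule countable_subset[OF _ countable_rat]) auto
      show "{q \<in> \<rat>. a < q} \<noteq> {}" using Rats_dense_in_real[of a "a + 1"] by auto
      show "H ` {q \<in> \<rat>. a < q} \<subseteq> sets ?T" unfolding T(1) by (auto simp: E_def)
    qed
    finally show "{x \<in> space ?T. f x \<le> a} \<in> sets ?T" .
  qed
  then have fT: "f \<in> borel_measurable ?T" .
  have "sets N \<subseteq> sigma_sets (space N) E"
  proof
    fix X assume X: "X \<in> sets N"
    have "g -` X \<inter> S \<in> sets (restrict_space borel S)"
      using measurable_sets[OF g X] by (simp add: space_restrict_space)
    then have B: "g -` X \<inter> S \<in> sets borel" using S by (auto simp: sets_restrict_space_iff)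
    have "X = f -` (g -` X \<inter> S) \<inter> space N"
      using sets.sets_into_space[OF X] fS gf by auto
    also have "\<dots> \<in> sigma_sets (space N) E" using measurable_sets[OF fT B] by (simp only: T)
    finally show "X \<in> sigma_sets (space N) E" .
  qed
  moreover have "sigma_sets (space N) E \<subseteq> sets N" using EN by (rule sets.sigma_sets_subset)
  ultimately have "sets N = sigma_sets (space N) E" by (rule equalityI)
  with \<open>countable E\<close> E \<open>Int_stable E\<close> show ?thesis by (intro exI[of _ E]) (auto simp: E_def)
qed

text \<open>A countable family of rectangles determines finite measures on the product. Countability
  lets almost sure identities for single rectangles be combined into an almost sure identity of
  kernels.\<close>

lemma borel_product_generator:
  assumes I: "finite I" and iso: "\<And>i. i \<in> I \<Longrightarrow> borel_isomorphic (M i)"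
  obtains \<R> where "countable \<R>" "\<And>R i. R \<in> \<R> \<Longrightarrow> i \<in> I \<Longrightarrow> R i \<in> sets (M i)"
    "\<forall>\<mu> \<nu>. sets \<mu> = sets (PiM I M) \<and> sets \<nu> = sets (PiM I M) \<and> finite_measure \<mu> \<and>
      (\<forall>R\<in>\<R>. emeasure \<mu> (PiE I R) = emeasure \<nu> (PiE I R)) \<longrightarrow> \<mu> = \<nu>"
proof -
  have "\<forall>i\<in>I. \<exists>E. countable E \<and> E \<subseteq> Pow (space (M i)) \<and> space (M i) \<in> E \<and> Int_stable E \<and> sets (M i) = sigma_sets (space (M i)) E"
    using borel_isomorphic_generator[OF iso] by blast
  from bchoice[OF this] obtain E where "\<forall>i\<in>I. countable (E i) \<and> E i \<subseteq> Pow (space (M i)) \<and> space (M i) \<in> E i \<and> Int_stable (E i) \<and> sets (M i) = sigma_sets (space (M i)) (E i)" ..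
  then have E: "\<And>i. i \<in> I \<Longrightarrow> countable (E i)" "\<And>i. i \<in> I \<Longrightarrow> E i \<subseteq> Pow (space (M i))" "\<And>i. i \<in> I \<Longrightarrow> space (M i) \<in> E i"
    "\<And>i. i \<in> I \<Longrightarrow> Int_stable (E i)" "\<And>i. i \<in> I \<Longrightarrow> sets (M i) = sigma_sets (space (M i)) (E i)" by blast+
  let ?P = "{PiE I F | F. \<forall>i\<in>I. F i \<in> E i}"
  have sets_P: "sets (PiM I M) = sigma_sets (space (PiM I M)) ?P"
  proof
    have P_sets: "?P \<subseteq> sets (PiM I M)"
      using I E(5) by (auto intro!: sets_PiM_I_finite)
    then show "sigma_sets (space (PiM I M)) ?P \<subseteq> sets (PiM I M)" by (rule sets.sigma_sets_subset)
    define N where "N = sigma (space (PiM I M)) ?P"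
    have P_sub: "?P \<subseteq> Pow (space (PiM I M))" using P_sets sets.sets_into_space by blast
    have N: "space N = space (PiM I M)" "sets N = sigma_sets (space (PiM I M)) ?P"
      unfolding N_def using P_sub by (rule space_measure_of, rule sets_measure_of)
    have "sets (PiM I M) \<subseteq> sets N"
    proof (rule sets_PiM_in_sets)
      show "space N = (\<Pi>\<^sub>E i\<in>I. space (M i))" by (simp add: N space_PiM)
      fix i X assume i: "i \<in> I" and X: "X \<in> sets (M i)"
      have "(\<lambda>x. x i) \<in> N \<rightarrow>\<^sub>M M i"
      proof (rule measurable_sigma_sets[OF E(5)[OF i] E(2)[OF i]])
        show "(\<lambda>x. x i) \<in> space N \<rightarrow> space (M i)" using i by (auto simp: N space_PiM)
        fix e assume e: "e \<in> E i"
        let ?F = "\<lambda>j. if j = i then e else space (M j)"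
        have "(\<lambda>x. x i) -` e \<inter> space N = PiE I ?F"
        proof (intro set_eqI iffI)
          fix x assume "x \<in> (\<lambda>x. x i) -` e \<inter> space N"
          then show "x \<in> PiE I ?F" by (auto simp: N space_PiM PiE_iff)
        next
          fix x assume x: "x \<in> PiE I ?F"
          have xi: "x i \<in> e" using PiE_mem[OF x i] by simp
          have "x j \<in> space (M j)" if "j \<in> I" for j
            using PiE_mem[OF x that] E(2)[OF i] e by (auto split: if_splits)
          moreover have "x \<in> extensional I" using x by (simp add: PiE_iff)
          ultimately show "x \<in> (\<lambda>x. x i) -` e \<inter> space N" using xi by (simp add: N space_PiM PiE_iff)
        qed
        moreover have "PiE I ?F \<in> ?P" using E(3) e by (auto intro!: exI[of _ ?F])
        ultimately show "(\<lambda>x. x i) -` e \<inter> space N \<in> sets N" unfolding N(2) by (metis (no_types, lifting) sigma_sets.Basic)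
      qed
      from measurable_sets[OF this X] show "{x \<in> space N. x i \<in> X} \<in> sets N"
        by (simp add: vimage_def Int_def conj_commute)
    qed
    then show "sets (PiM I M) \<subseteq> sigma_sets (space (PiM I M)) ?P" by (simp only: N(2))
  qed
  show thesis
  proof (rule that[of "PiE I E"])
    show "countable (PiE I E)" using I E by (intro countable_PiE) auto
    show "R i \<in> sets (M i)" if "R \<in> PiE I E" "i \<in> I" for R i
      using that E(5)[of i] by (auto simp: PiE_iff)
    show "\<forall>\<mu> \<nu>. sets \<mu> = sets (PiM I M) \<and> sets \<nu> = sets (PiM I M) \<and> finite_measure \<mu> \<and>
      (\<forall>R\<in>PiE I E. emeasure \<mu> (PiE I R) = emeasure \<nu> (PiE I R)) \<longrightarrow> \<mu> = \<nu>"
    proof (intro allI impI, elim conjE)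
    fix \<mu> \<nu> assume \<mu>: "sets \<mu> = sets (PiM I M)" and \<nu>: "sets \<nu> = sets (PiM I M)" and "finite_measure \<mu>"
      and eq: "\<forall>R\<in>PiE I E. emeasure \<mu> (PiE I R) = emeasure \<nu> (PiE I R)"
    interpret finite_measure \<mu> by fact
    show "\<mu> = \<nu>"
    proof (rule measure_eqI_generator_eq[where E="?P" and \<Omega>="space (PiM I M)" and A="\<lambda>_. space (PiM I M)"])
      show "Int_stable ?P"
      proof (rule Int_stableI)
        fix a b assume "a \<in> ?P" "b \<in> ?P"
        then obtain F F' where F: "a = PiE I F" "\<forall>i\<in>I. F i \<in> E i" "b = PiE I F'" "\<forall>i\<in>I. F' i \<in> E i" by blast
        have "a \<inter> b = PiE I (\<lambda>i. F i \<inter> F' i)" using F by (simp add: PiE_Int)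
        moreover have "\<forall>i\<in>I. F i \<inter> F' i \<in> E i" using F E(4) by (auto dest: Int_stableD)
        ultimately show "a \<inter> b \<in> ?P" by blast
      qed
      show "?P \<subseteq> Pow (space (PiM I M))"
      proof
        fix X assume "X \<in> ?P"
        then have "X \<in> sigma_sets (space (PiM I M)) ?P" by (rule sigma_sets.Basic)
        then show "X \<in> Pow (space (PiM I M))" using sets_P sets.sets_into_space by blast
      qed
      show "emeasure \<mu> X = emeasure \<nu> X" if "X \<in> ?P" for X
      proof -
        from that obtain F where F: "X = PiE I F" "\<forall>i\<in>I. F i \<in> E i" by blast
        \<comment> \<open>The families in \<open>PiE I E\<close> are extensional, so
          \<open>F\<close> is cut down to \<open>I\<close> without changing the rectangle.\<close>
        then have "X = PiE I (restrict F I)" "restrict F I \<in> PiE I E" by (auto cong: PiE_cong)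
        with eq show ?thesis by simp
      qed
      show "range (\<lambda>_. space (PiM I M)) \<subseteq> ?P"
        using E(3) by (auto simp: space_PiM intro!: exI[of _ "\<lambda>i. space (M i)"])
    qed (use \<mu> \<nu> sets_P in auto)
    qed
  qed
qed

context punctured_triple
begin

text \<open>The image of \<open>L1\<close> under \<open>Z\<close> is sigma-finite, again after
  adding \<open>c0\<close> to the sets \<open>KC n\<close>, and densities with respect to a
  sigma-finite measure are unique almost everywhere.\<close>

lemma L1_version_unique:
  assumes f: "version L1 MC Z \<phi> f" and g: "version L1 MC Z \<phi> g"
  shows "AE y in L1. f (Z y) = g (Z y)"
proof -
  have [measurable]: "f \<in> borel_measurable MC" "g \<in> borel_measurable MC"
    using f g by (auto intro: version_measurable)
  let ?m = "distr L1 MC Z"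
  have ins[measurable]: "insert c0 (KC n) \<in> sets MC" for n using sets.Un[OF c0_sets KC[of n]] by simp
  have fin: "emeasure ?m (insert c0 (KC n)) < \<infinity>" for n
  proof -
    have "emeasure ?m (insert c0 (KC n)) = (\<integral>\<^sup>+z. indicator (insert c0 (KC n)) z \<partial>?m)" by simp
    also have "\<dots> = (\<integral>\<^sup>+y. indicator (insert c0 (KC n)) (Z y) \<partial>L1)" by (rule nn_integral_distr) auto
    also have "\<dots> = (\<integral>\<^sup>+y. indicator (KC n) (Z y) \<partial>L1)"
      by (rule nn_integral_cong_AE) (use AE_L1 in \<open>eventually_elim, auto simp: indicator_def\<close>)
    finally show ?thesis using L1_fin[of n] by simp
  qed
  interpret m: sigma_finite_measure ?m
  proof
    show "\<exists>A. countable A \<and> A \<subseteq> sets ?m \<and> \<Union> A = space ?m \<and> (\<forall>a\<in>A. emeasure ?m a \<noteq> \<infinity>)"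
      using fin[THEN less_imp_neq] KC_UN c0 ins by (intro exI[of _ "range (\<lambda>n. insert c0 (KC n))"]) auto
  qed
  have em: "emeasure (density ?m r) H = (\<integral>\<^sup>+y. r (Z y) * indicator H (Z y) \<partial>L1)"
    if [measurable]: "H \<in> sets MC" "r \<in> borel_measurable MC" for H r
    by (simp add: emeasure_density nn_integral_distr)
  have "density ?m f = density ?m g"
    by (rule measure_eqI) (auto simp: em versionD[OF f, symmetric] versionD[OF g, symmetric])
  then have "AE z in ?m. f z = g z"
    by (subst (asm) m.density_unique_iff) auto
  then show ?thesis by (rule AE_distrD[rotated]) simp
qed

end

section \<open>The disintegrating kernel read as a family of versions\<close>

context punctured_product
begin

context
  fixes K
  assumes K: "disintegrating_kernel M pt \<Lambda> A B C K"
begin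

private abbreviation "N \<equiv> PiM (A \<union> B) M"
private abbreviation "PC \<equiv> punctured M pt C"
private abbreviation "LC \<equiv> punctured_marginal M pt \<Lambda> C"
private abbreviation "SC \<equiv> {y \<in> space \<Lambda>. restrict y C \<noteq> restrict pt C}"

private lemma K_meas: "K \<in> PC \<rightarrow>\<^sub>M prob_algebra N"
  using K by (simp add: disintegrating_kernel_def)

private lemma K_prob: "z \<in> space PC \<Longrightarrow> prob_space (K z)" and K_sets: "z \<in> space PC \<Longrightarrow> sets (K z) = sets N"
  using measurable_space[OF K_meas] by (auto simp: space_prob_algebra)

private lemma \<kappa>_meas: "E \<in> sets N \<Longrightarrow> (\<lambda>z. emeasure (K z) E) \<in> borel_measurable PC"
  by (rule measurable_emeasure_kernel[OF measurable_prob_algebraD[OF K_meas]])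

private lemma Z_PC: "(\<lambda>y. restrict y C) \<in> restrict_space \<Lambda> SC \<rightarrow>\<^sub>M PC"
  unfolding punctured_def
  by (rule measurable_restrict_space2)
    (use restr_space sub(3) in \<open>auto simp: space_restrict_space intro: measurable_restrict_space1[OF restr_measurable]\<close>)

text \<open>Kernels live on the punctured product over \<open>C\<close>, versions on the full one.
  Extension by 0 to the distinguished point is harmless, as \<open>L1\<close> does not charge
  it.\<close>

private lemma ext_meas:
  assumes "h \<in> borel_measurable PC"
  shows "(\<lambda>z. h z * indicator (space PC) z :: ennreal) \<in> borel_measurable (PiM C M)"
proof -
  have "space (PiM C M) - {restrict pt C} \<in> sets (PiM C M)" using pt_PiM[OF sub(3)] by auto
  then show ?thesis
    using assms unfolding punctured_def
    by (subst (asm) borel_measurable_restrict_space_iff_ennreal) (auto simp: space_restrict_space Int_absorb2)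
qed

private lemma int_LC:
  assumes h: "h \<in> borel_measurable PC"
  shows "(\<integral>\<^sup>+z. h z \<partial>LC) = (\<integral>\<^sup>+y. h (restrict y C) * indicator (space PC) (restrict y C) \<partial>T.L1)"
proof -
  have "(\<integral>\<^sup>+z. h z \<partial>LC) = (\<integral>\<^sup>+y. h (restrict y C) \<partial>restrict_space \<Lambda> SC)"
    unfolding punctured_marginal_def by (rule nn_integral_distr[OF Z_PC]) (use h in simp)
  also have "\<dots> = (\<integral>\<^sup>+y. h (restrict y C) * indicator SC y \<partial>\<Lambda>)"
    by (rule nn_integral_restrict_space) measurable
  also have "\<dots> = (\<integral>\<^sup>+y. h (restrict y C) * indicator (space PC) (restrict y C) \<partial>T.L1)"
  proof (subst T.nn_integral_L1)
    show "(\<lambda>y. h (restrict y C) * indicator (space PC) (restrict y C)) \<in> borel_measurable \<Lambda>"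
      using measurable_compose[OF restr_measurable[OF sub(3)] ext_meas[OF h]] .
  qed (auto intro!: nn_integral_cong simp: space_punctured indicator_def restr_space sub)
  finally show ?thesis .
qed

private lemma AE_LC:
  assumes "AE z in LC. Q z"
  shows "AE y in T.L1. Q (restrict y C)"
proof -
  have "AE y in restrict_space \<Lambda> SC. Q (restrict y C)"
    using assms unfolding punctured_marginal_def by (rule AE_distrD[OF Z_PC])
  then show ?thesis
    unfolding L1_eq by (subst (asm) AE_restrict_space_iff) (auto simp: AE_density indicator_def elim!: eventually_mono)
qed

private lemma AE_LC_I:
  assumes "AE y in T.L1. Q (restrict y C)" and "{z \<in> space PC. Q z} \<in> sets PC"
  shows "AE z in LC. Q z"
proof -
  have "AE y in restrict_space \<Lambda> SC. Q (restrict y C)"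
    using assms(1) unfolding L1_eq by (subst AE_restrict_space_iff) (auto simp: AE_density indicator_def elim!: eventually_mono)
  then show ?thesis
    unfolding punctured_marginal_def using assms(2) by (subst AE_distr_iff[OF Z_PC]) auto
qed

private lemma AB_meas: "(\<lambda>y. restrict y (A \<union> B)) \<in> \<Lambda> \<rightarrow>\<^sub>M N"
  using sub by (intro restr_measurable) auto

private definition "\<kappa> E z = emeasure (K z) E * indicator (space PC) z"

private lemma \<kappa>_measC: "E \<in> sets N \<Longrightarrow> \<kappa> E \<in> borel_measurable (PiM C M)"
  unfolding \<kappa>_def[abs_def] by (rule ext_meas[OF \<kappa>_meas])

private lemma \<kappa>_top: "\<kappa> E z < top"
proof (cases "z \<in> space PC")
  case True
  interpret prob_space "K z" by (rule K_prob[OF True])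
  show ?thesis by (simp add: \<kappa>_def True less_top[symmetric])
qed (simp add: \<kappa>_def)

text \<open>The disintegration formula for the sets \<open>?G\<close>, whose indicator factorizes
  after undoing \<open>merge\<close>, says that kernel values are conditional probabilities given
  \<open>y_C\<close>. Statements about \<open>K\<close> thereby become statements about versions on
  \<open>L1\<close>.\<close>

private lemma version_\<kappa>:
  assumes E: "E \<in> sets N"
  shows "version T.L1 (PiM C M) (\<lambda>y. restrict y C) (\<lambda>y. indicator E (restrict y (A \<union> B))) (\<kappa> E)"
proof (rule versionI)
  note [measurable] = AB_meas \<kappa>_measC[OF E] E T.Z
  show "\<kappa> E \<in> borel_measurable (PiM C M)" by measurable
  fix H assume H[measurable]: "H \<in> sets (PiM C M)"
  let ?G = "{y \<in> space \<Lambda>. restrict y (A \<union> B) \<in> E \<and> restrict y C \<in> H \<and> restrict y C \<noteq> restrict pt C}"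
  have G: "?G \<in> sets \<Lambda>" by measurable
  have disj: "(A \<union> B) \<inter> C = {}" using part by auto
  have HPC: "(\<lambda>z. emeasure (K z) E * indicator H z) \<in> borel_measurable PC"
  proof -
    have "H \<inter> space PC \<in> sets PC"
      using H pt_PiM[OF sub(3)] by (auto simp: sets_punctured[OF sub(3)] space_punctured)
    then have "(\<lambda>z. emeasure (K z) E * indicator (H \<inter> space PC) z) \<in> borel_measurable PC"
      using \<kappa>_meas[OF E] by measurable
    then show ?thesis
      by (rule measurable_cong[THEN iffD1, rotated]) (auto simp: indicator_def)
  qed
  have "(\<integral>\<^sup>+y. indicator E (restrict y (A \<union> B)) * indicator H (restrict y C) \<partial>T.L1) = (\<integral>\<^sup>+y. indicator ?G y \<partial>\<Lambda>)"
    by (subst T.nn_integral_L1, measurable, rule nn_integral_cong)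
      (auto simp: indicator_def restr_space sub)
  also have "\<dots> = emeasure \<Lambda> ?G" using G by simp
  also have "\<dots> = (\<integral>\<^sup>+z. (\<integral>\<^sup>+x. indicator ?G (merge (A \<union> B) C (x, z)) \<partial>K z) \<partial>LC)"
    by (rule K[unfolded disintegrating_kernel_def, THEN conjunct2, rule_format, OF G]) auto
  also have "\<dots> = (\<integral>\<^sup>+z. emeasure (K z) E * indicator H z \<partial>LC)"
  proof (rule nn_integral_cong)
    fix z assume "z \<in> space LC"
    then have z: "z \<in> space PC" by (simp add: punctured_marginal_def)
    then have zC: "z \<in> space (PiM C M)" "z \<noteq> restrict pt C" by (auto simp: space_punctured)
    have sK: "sets (K z) = sets N" "space (K z) = space N"
      using K_sets[OF z] by (auto dest: sets_eq_imp_space_eq)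
    have "(\<integral>\<^sup>+x. indicator ?G (merge (A \<union> B) C (x, z)) \<partial>K z) = (\<integral>\<^sup>+x. indicator E x * indicator H z \<partial>K z)"
    proof (rule nn_integral_cong)
      fix x assume "x \<in> space (K z)"
      then have x: "x \<in> space N" by (simp add: sK)
      have r: "restrict (merge (A \<union> B) C (x, z)) (A \<union> B) = x" "restrict (merge (A \<union> B) C (x, z)) C = z"
        using disj x zC by (auto simp: space_PiM PiE_iff extensional_restrict)
      have "merge (A \<union> B) C (x, z) \<in> space (PiM V M)"
        using x zC disj part(1) by (auto simp: space_PiM PiE_iff merge_def extensional_def)
      moreover have "merge (A \<union> B) C (x, z) \<noteq> restrict pt V"
      proof
        assume "merge (A \<union> B) C (x, z) = restrict pt V"
        then have "restrict (merge (A \<union> B) C (x, z)) C = restrict (restrict pt V) C" by simp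
        also have "\<dots> = restrict pt C" using sub(3) by (simp add: Int_absorb1)
        finally show False using r(2) zC(2) by metis
      qed
      ultimately have "merge (A \<union> B) C (x, z) \<in> space \<Lambda>" by (simp add: space_\<Lambda>)
      then show "indicator ?G (merge (A \<union> B) C (x, z)) = (indicator E x * indicator H z :: ennreal)"
        unfolding indicator_def mem_Collect_eq r using zC by auto
    qed
    also have "\<dots> = emeasure (K z) E * indicator H z"
      using E sK by (simp add: nn_integral_multc)
    finally show "(\<integral>\<^sup>+x. indicator ?G (merge (A \<union> B) C (x, z)) \<partial>K z) = emeasure (K z) E * indicator H z" .
  qed
  also have "\<dots> = (\<integral>\<^sup>+y. emeasure (K (restrict y C)) E * indicator H (restrict y C) * indicator (space PC) (restrict y C) \<partial>T.L1)"
    by (rule int_LC[OF HPC])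
  also have "\<dots> = (\<integral>\<^sup>+y. \<kappa> E (restrict y C) * indicator H (restrict y C) \<partial>T.L1)"
    by (simp add: \<kappa>_def mult_ac)
  finally show "(\<integral>\<^sup>+y. indicator E (restrict y (A \<union> B)) * indicator H (restrict y C) \<partial>T.L1) =
     (\<integral>\<^sup>+y. \<kappa> E (restrict y C) * indicator H (restrict y C) \<partial>T.L1)" .
next
  note [measurable] = AB_meas E T.Z
  show "(\<lambda>y. indicator E (restrict y (A \<union> B)) :: ennreal) \<in> borel_measurable T.L1" by measurable
  show "(\<lambda>y. restrict y C) \<in> T.L1 \<rightarrow>\<^sub>M PiM C M" by measurable
qed

private definition "rect F G = {x \<in> space N. restrict x A \<in> F \<and> restrict x B \<in> G}"

private lemma rA: "(\<lambda>x. restrict x A) \<in> N \<rightarrow>\<^sub>M PiM A M" and rB: "(\<lambda>x. restrict x B) \<in> N \<rightarrow>\<^sub>M PiM B M"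
  by (auto intro: measurable_restrict_subset)

private lemma rect_sets: "F \<in> sets (PiM A M) \<Longrightarrow> G \<in> sets (PiM B M) \<Longrightarrow> rect F G \<in> sets N"
proof -
  assume F: "F \<in> sets (PiM A M)" and G: "G \<in> sets (PiM B M)"
  have "rect F G = ((\<lambda>x. restrict x A) -` F \<inter> space N) \<inter> ((\<lambda>x. restrict x B) -` G \<inter> space N)"
    by (auto simp: rect_def)
  with measurable_sets[OF rA F] measurable_sets[OF rB G] show ?thesis by simp
qed

private lemma rect_ind: "y \<in> space \<Lambda> \<Longrightarrow> restrict y (A \<union> B) \<in> rect F G \<longleftrightarrow> restrict y A \<in> F \<and> restrict y B \<in> G"
  using restr_space[of y "A \<union> B"] sub by (auto simp: rect_def Int_absorb1 Int_absorb2)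

private abbreviation "\<kappa>A F \<equiv> \<kappa> (rect F (space (PiM B M)))"
private abbreviation "\<kappa>B G \<equiv> \<kappa> (rect (space (PiM A M)) G)"

private lemma version_cong:
  assumes "version P MZ Z \<phi> f" "\<And>y. y \<in> space P \<Longrightarrow> \<phi> y = \<phi>' y"
  shows "version P MZ Z \<phi>' f"
proof -
  have "(\<integral>\<^sup>+x. \<phi> x * w (Z x) \<partial>P) = (\<integral>\<^sup>+x. \<phi>' x * w (Z x) \<partial>P)" for w
    by (rule nn_integral_cong) (simp add: assms(2))
  then show ?thesis using assms(1) unfolding version_def by simp
qed

private lemma version_rect:
  assumes "F \<in> sets (PiM A M)" "G \<in> sets (PiM B M)"
  shows "version T.L1 (PiM C M) (\<lambda>y. restrict y C) (\<lambda>y. indicator F (restrict y A) * indicator G (restrict y B)) (\<kappa> (rect F G))"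
  by (rule version_cong[OF version_\<kappa>[OF rect_sets[OF assms]]]) (auto simp: indicator_def rect_ind)

private lemma version_A: "F \<in> sets (PiM A M) \<Longrightarrow> version T.L1 (PiM C M) (\<lambda>y. restrict y C) (\<lambda>y. indicator F (restrict y A)) (\<kappa>A F)"
  by (rule version_cong[OF version_rect[of F "space (PiM B M)"]]) (auto simp: restr_space sub)

private lemma version_B: "G \<in> sets (PiM B M) \<Longrightarrow> version T.L1 (PiM C M) (\<lambda>y. restrict y C) (\<lambda>y. indicator G (restrict y B)) (\<kappa>B G)"
  by (rule version_cong[OF version_rect[of "space (PiM A M)" G]]) (auto simp: restr_space sub)

text \<open>The product of the marginal kernels, carried by \<open>merge\<close> from pairs to
  functions on \<open>A \<union> B\<close>.\<close>

private abbreviation "KP z \<equiv> distr (marginal_kernel M A K z \<Otimes>\<^sub>M marginal_kernel M B K z) N (merge A B)"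

private lemma KP_rect:
  assumes z: "z \<in> space PC" and F: "F \<in> sets (PiM A M)" and G: "G \<in> sets (PiM B M)"
  shows "emeasure (KP z) (rect F G) = \<kappa>A F z * \<kappa>B G z"
proof -
  have sK: "sets (K z) = sets N" "space (K z) = space N"
    using K_sets[OF z] by (auto dest: sets_eq_imp_space_eq)
  interpret K: prob_space "K z" by (rule K_prob[OF z])
  have rK: "(\<lambda>x. restrict x A) \<in> K z \<rightarrow>\<^sub>M PiM A M" "(\<lambda>x. restrict x B) \<in> K z \<rightarrow>\<^sub>M PiM B M"
    using rA rB by (auto cong: measurable_cong_sets simp: sK)
  interpret A: prob_space "marginal_kernel M A K z" unfolding marginal_kernel_def by (rule K.prob_space_distr[OF rK(1)])
  interpret B: prob_space "marginal_kernel M B K z" unfolding marginal_kernel_def by (rule K.prob_space_distr[OF rK(2)])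
  let ?A = "marginal_kernel M A K z" and ?B = "marginal_kernel M B K z"
  have sAB: "sets ?A = sets (PiM A M)" "sets ?B = sets (PiM B M)" "space ?A = space (PiM A M)" "space ?B = space (PiM B M)"
    by (auto simp: marginal_kernel_def)
  have mm: "merge A B \<in> ?A \<Otimes>\<^sub>M ?B \<rightarrow>\<^sub>M N"
    using measurable_merge[of A B M] by (simp cong: measurable_cong_sets sets_pair_measure_cong add: sAB)
  have "merge A B -` rect F G \<inter> space (?A \<Otimes>\<^sub>M ?B) = F \<times> G"
  proof (rule set_eqI)
    fix p :: "(nat \<Rightarrow> 'a) \<times> (nat \<Rightarrow> 'a)"
    obtain x y where p: "p = (x, y)" by force
    show "p \<in> merge A B -` rect F G \<inter> space (?A \<Otimes>\<^sub>M ?B) \<longleftrightarrow> p \<in> F \<times> G"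
    proof (cases "x \<in> space (PiM A M) \<and> y \<in> space (PiM B M)")
      case True
      then have "merge A B (x, y) \<in> space N"
        using part(2) by (auto simp: space_PiM PiE_iff merge_def extensional_def)
      moreover have "restrict (merge A B (x, y)) A = x" "restrict (merge A B (x, y)) B = y"
        using True part(2) by (auto simp: space_PiM PiE_iff extensional_restrict)
      ultimately show ?thesis using True by (auto simp: p rect_def space_pair_measure sAB)
    next
      case False
      then show ?thesis using sets.sets_into_space[OF F] sets.sets_into_space[OF G]
        by (auto simp: p space_pair_measure sAB)
    qed
  qed
  then have "emeasure (KP z) (rect F G) = emeasure (?A \<Otimes>\<^sub>M ?B) (F \<times> G)"
    using mm rect_sets[OF F G] by (simp add: emeasure_distr)
  also have "\<dots> = emeasure ?A F * emeasure ?B G"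
    by (rule B.emeasure_pair_measure_Times) (use F G sAB in auto)
  also have "emeasure ?A F = emeasure (K z) (rect F (space (PiM B M)))"
    unfolding marginal_kernel_def using F rK measurable_space[OF rB]
    by (subst emeasure_distr) (auto simp: sK rect_def intro!: arg_cong[where f="emeasure (K z)"])
  also have "emeasure ?B G = emeasure (K z) (rect (space (PiM A M)) G)"
    unfolding marginal_kernel_def using G rK measurable_space[OF rA]
    by (subst emeasure_distr) (auto simp: sK rect_def intro!: arg_cong[where f="emeasure (K z)"])
  finally show ?thesis using z by (simp add: \<kappa>_def)
qed

text \<open>The witness for \<open>F\<close> is \<open>\<kappa>A F\<close>: on rectangles the kernel
  factorizes into \<open>\<kappa>A F\<close> and \<open>\<kappa>B G\<close>, and the latter is a
  version of the indicator of \<open>G\<close> and can be turned back into it.\<close>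

lemma kernel_prod_imp_ci:
  assumes "AE z in LC. K z = KP z"
  shows "ci T.L1 (PiM A M) (\<lambda>y. restrict y A) (PiM B M) (\<lambda>y. restrict y B) (PiM C M) (\<lambda>y. restrict y C)"
proof (rule ciI)
  note [measurable] = T.X T.Y T.Z
  show "(\<lambda>y. restrict y A) \<in> T.L1 \<rightarrow>\<^sub>M PiM A M" "(\<lambda>y. restrict y B) \<in> T.L1 \<rightarrow>\<^sub>M PiM B M"
    "(\<lambda>y. restrict y C) \<in> T.L1 \<rightarrow>\<^sub>M PiM C M" by measurable
  fix F assume F: "F \<in> sets (PiM A M)"
  have \<kappa>F: "\<kappa>A F \<in> borel_measurable (PiM C M)" by (rule \<kappa>_measC[OF rect_sets[OF F sets.top]])
  have "(\<integral>\<^sup>+y. indicator F (restrict y A) * indicator G (restrict y B) * indicator H (restrict y C) \<partial>T.L1) =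
        (\<integral>\<^sup>+y. \<kappa>A F (restrict y C) * indicator G (restrict y B) * indicator H (restrict y C) \<partial>T.L1)"
    if G: "G \<in> sets (PiM B M)" and H: "H \<in> sets (PiM C M)" for G H
  proof -
    have "(\<integral>\<^sup>+y. indicator F (restrict y A) * indicator G (restrict y B) * indicator H (restrict y C) \<partial>T.L1) =
        (\<integral>\<^sup>+y. \<kappa> (rect F G) (restrict y C) * indicator H (restrict y C) \<partial>T.L1)"
      by (rule versionD[OF version_rect[OF F G], of "indicator H"]) (use H in simp)
    also have "\<dots> = (\<integral>\<^sup>+y. \<kappa>B G (restrict y C) * (\<kappa>A F (restrict y C) * indicator H (restrict y C)) \<partial>T.L1)"
    proof (rule nn_integral_cong_AE)
      show "AE y in T.L1. \<kappa> (rect F G) (restrict y C) * indicator H (restrict y C) =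
          \<kappa>B G (restrict y C) * (\<kappa>A F (restrict y C) * indicator H (restrict y C))"
        using AE_LC[OF assms] T.AE_L1 AE_space
      proof eventually_elim
        case (elim y)
        then have z: "restrict y C \<in> space PC" using restr_space[of y C] sub by (auto simp: space_punctured)
        have "\<kappa> (rect F G) (restrict y C) = emeasure (KP (restrict y C)) (rect F G)"
          using z elim(1) by (simp add: \<kappa>_def)
        then show ?case by (simp add: KP_rect[OF z F G] mult_ac)
      qed
    qed
    also have "\<dots> = (\<integral>\<^sup>+y. indicator G (restrict y B) * (\<kappa>A F (restrict y C) * indicator H (restrict y C)) \<partial>T.L1)"
      by (rule versionD[OF version_B[OF G], of "\<lambda>z. \<kappa>A F z * indicator H z", symmetric]) (use \<kappa>F H in measurable)
    finally show ?thesis by (simp add: mult_ac)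
  qed
  then show "\<exists>f\<in>borel_measurable (PiM C M). (\<forall>z. f z < (top::ennreal)) \<and>
      (\<forall>G\<in>sets (PiM B M). \<forall>H\<in>sets (PiM C M).
        (\<integral>\<^sup>+y. indicator F (restrict y A) * indicator G (restrict y B) * indicator H (restrict y C) \<partial>T.L1) =
        (\<integral>\<^sup>+y. f (restrict y C) * indicator G (restrict y B) * indicator H (restrict y C) \<partial>T.L1))"
    using \<kappa>F \<kappa>_top by (intro bexI[of _ "\<kappa>A F"]) auto
qed

text \<open>For each rectangle, the kernel value and the product of its marginals are versions of
  the same function, hence equal almost everywhere. The exceptional set depends on the rectangle;
  over the countable determining family these sets have a common null set, outside of which the two
  kernels coincide.\<close>

lemma ci_imp_kernel_prod:
  assumes ci: "ci T.L1 (PiM A M) (\<lambda>y. restrict y A) (PiM B M) (\<lambda>y. restrict y B) (PiM C M) (\<lambda>y. restrict y C)"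
  shows "AE z in LC. K z = KP z"
proof -
  have iso: "borel_isomorphic (M i)" if "i \<in> A \<union> B" for i using that sub borel by blast
  obtain \<R> where \<R>: "countable \<R>" "\<And>R i. R \<in> \<R> \<Longrightarrow> i \<in> A \<union> B \<Longrightarrow> R i \<in> sets (M i)"
    and "\<forall>\<mu> \<nu>. sets \<mu> = sets N \<and> sets \<nu> = sets N \<and> finite_measure \<mu> \<and>
      (\<forall>R\<in>\<R>. emeasure \<mu> (PiE (A \<union> B) R) = emeasure \<nu> (PiE (A \<union> B) R)) \<longrightarrow> \<mu> = \<nu>"
    by (rule borel_product_generator[OF finite_UnI[OF finABC(1,2)], of M]) (erule iso, rule that, assumption+)
  then have eqI: "\<mu> = \<nu>" if "sets \<mu> = sets N" "sets \<nu> = sets N" "finite_measure \<mu>"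
      "\<And>R. R \<in> \<R> \<Longrightarrow> emeasure \<mu> (PiE (A \<union> B) R) = emeasure \<nu> (PiE (A \<union> B) R)" for \<mu> \<nu>
    using that by blast
  have RA: "PiE A R \<in> sets (PiM A M)" and RB: "PiE B R \<in> sets (PiM B M)" if "R \<in> \<R>" for R
    using \<R>(2)[OF that] finABC by (auto intro!: sets_PiM_I_finite)
  have Rrect: "PiE (A \<union> B) R = rect (PiE A R) (PiE B R)" if "R \<in> \<R>" for R
  proof -
    have "R i \<subseteq> space (M i)" if "i \<in> A \<union> B" for i using sets.sets_into_space[OF \<R>(2)[OF \<open>R \<in> \<R>\<close> that]] .
    then show ?thesis by (auto simp: rect_def space_PiM PiE_iff extensional_def)
  qed
  have "AE z in LC. \<kappa> (rect F G) z = \<kappa>A F z * \<kappa>B G z" if F: "F \<in> sets (PiM A M)" and G: "G \<in> sets (PiM B M)" for F G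
  proof (rule AE_LC_I)
    note [measurable] = T.X T.Y T.Z F G
    have m: "\<kappa>A F \<in> borel_measurable (PiM C M)" "\<kappa>B G \<in> borel_measurable (PiM C M)" "\<kappa> (rect F G) \<in> borel_measurable (PiM C M)"
      using F G by (auto intro!: \<kappa>_measC rect_sets)
    have "version T.L1 (PiM C M) (\<lambda>y. restrict y C) (\<lambda>y. indicator F (restrict y A) * indicator G (restrict y B)) (\<lambda>z. \<kappa>A F z * \<kappa>B G z)"
    proof (rule versionI)
      fix H assume H[measurable]: "H \<in> sets (PiM C M)"
      show "(\<integral>\<^sup>+y. indicator F (restrict y A) * indicator G (restrict y B) * indicator H (restrict y C) \<partial>T.L1) =
          (\<integral>\<^sup>+y. \<kappa>A F (restrict y C) * \<kappa>B G (restrict y C) * indicator H (restrict y C) \<partial>T.L1)"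
        by (rule ci_product[OF ci, where u="indicator F" and v="indicator G" and w="indicator H"])
          (measurable, rule version_A[OF F], rule version_B[OF G])
    next
      show "(\<lambda>z. \<kappa>A F z * \<kappa>B G z) \<in> borel_measurable (PiM C M)" using m by measurable
    qed measurable
    from T.L1_version_unique[OF version_rect[OF F G] this]
    show "AE y in T.L1. \<kappa> (rect F G) (restrict y C) = \<kappa>A F (restrict y C) * \<kappa>B G (restrict y C)" .
    have "{z \<in> space (PiM C M). \<kappa> (rect F G) z = \<kappa>A F z * \<kappa>B G z} \<in> sets (PiM C M)" using m by measurable
    moreover have "{z \<in> space PC. \<kappa> (rect F G) z = \<kappa>A F z * \<kappa>B G z} =
        {z \<in> space (PiM C M). \<kappa> (rect F G) z = \<kappa>A F z * \<kappa>B G z} - {restrict pt C}"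
      by (auto simp: space_punctured)
    ultimately show "{z \<in> space PC. \<kappa> (rect F G) z = \<kappa>A F z * \<kappa>B G z} \<in> sets PC"
      using pt_PiM[OF sub(3)] by (auto simp: sets_punctured[OF sub(3)])
  qed
  then have "AE z in LC. \<forall>R\<in>\<R>. \<kappa> (rect (PiE A R) (PiE B R)) z = \<kappa>A (PiE A R) z * \<kappa>B (PiE B R) z"
    using RA RB by (subst AE_ball_countable[OF \<R>(1)]) blast
  then show ?thesis
    using AE_space
  proof eventually_elim
    case (elim z)
    then have z: "z \<in> space PC" by (simp add: punctured_marginal_def)
    interpret prob_space "K z" by (rule K_prob[OF z])
    show "K z = KP z"
    proof (rule eqI)
      fix R assume R: "R \<in> \<R>"
      have "emeasure (K z) (PiE (A \<union> B) R) = \<kappa> (rect (PiE A R) (PiE B R)) z"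
        using z by (simp add: Rrect[OF R] \<kappa>_def)
      also have "\<dots> = emeasure (KP z) (rect (PiE A R) (PiE B R))"
        using elim(1) R by (simp add: KP_rect[OF z RA[OF R] RB[OF R]])
      finally show "emeasure (K z) (PiE (A \<union> B) R) = emeasure (KP z) (PiE (A \<union> B) R)" by (simp add: Rrect[OF R])
    qed (use K_sets[OF z] finite_measure_axioms in auto)
  qed
qed

end

end

section \<open>The process statement, including the empty conditioning block\<close>

context punctured_triple_poisson
begin

text \<open>A Poisson count with mean 0 or \<infinity> is almost surely constant. The events of
  probability 0 or 1 are closed under complements and countable unions, so it is enough to look at
  generators, which prescribe finitely many counts.\<close>

lemma xC_trivial:
  assumes triv: "\<And>G. G \<in> sets MC \<Longrightarrow> emeasure L (Z -` G \<inter> space L) \<in> {0, \<infinity>}"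
    and H: "H \<in> sets (point_measure_algebra MC)"
  shows "(AE w in P. xC w \<in> H) \<or> (AE w in P. xC w \<notin> H)"
proof -
  have const: "\<exists>c. AE w in P. emeasure (xC w) G = c" if G: "G \<in> sets MC" for G
  proof -
    have GZ: "Z -` G \<inter> space L \<in> sets L" by (rule measurable_sets[OF Z G])
    have eq: "emeasure (xC w) G = emeasure (\<xi> w) (Z -` G \<inter> space L)" if "w \<in> space P" for w
    proof -
      have s: "sets (\<xi> w) = sets L" by (rule sets_point_measure[OF measurable_space[OF \<xi> that]])
      show ?thesis
        unfolding xC_def using Z G
        by (subst emeasure_distr) (auto simp: sets_eq_imp_space_eq[OF s] measurable_cong_sets[OF s refl])
    qed
    obtain c where "AE w in P. emeasure (\<xi> w) (Z -` G \<inter> space L) = c"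
      using triv[OF G] pp GZ unfolding poisson_process_def by blast
    then have "AE w in P. emeasure (xC w) G = c"
      using AE_space by eventually_elim (simp add: eq)
    then show ?thesis ..
  qed
  define E where "E = (\<lambda>l :: ('c set \<times> nat) list. {m \<in> point_measures MC. \<forall>(G, k)\<in>set l. emeasure m G = of_nat k})"
  have sp: "xC w \<in> point_measures MC" if "w \<in> space P" for w
    using measurable_space[OF xC that] by (simp add: space_point_measure_algebra)
  have "H \<in> sigma_sets (point_measures MC) {E l | l. fst ` set l \<subseteq> sets MC}"
    using H unfolding point_measure_algebra_generator E_def .
  then show ?thesis
  proof induction
    case (Basic a)
    then obtain l where l: "a = E l" "fst ` set l \<subseteq> sets MC" by blast
    have "\<forall>p\<in>set l. \<exists>c. AE w in P. emeasure (xC w) (fst p) = c" using const l(2) by auto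
    then obtain c where c: "\<And>p. p \<in> set l \<Longrightarrow> AE w in P. emeasure (xC w) (fst p) = c p" by metis
    then have "AE w in P. \<forall>p\<in>set l. emeasure (xC w) (fst p) = c p"
      by (intro AE_finite_allI) auto
    then have ae: "AE w in P. xC w \<in> E l \<longleftrightarrow> (\<forall>p\<in>set l. c p = of_nat (snd p))"
      using AE_space by eventually_elim (use sp in \<open>auto simp: E_def split_beta\<close>)
    show ?case
    proof (cases "\<forall>p\<in>set l. c p = of_nat (snd p)")
      case True
      have "AE w in P. xC w \<in> E l" using ae by eventually_elim (use True in blast)
      then show ?thesis unfolding l(1) ..
    next
      case False
      have "AE w in P. xC w \<notin> E l" using ae by eventually_elim (use False in blast)
      then show ?thesis unfolding l(1) ..
    qed
  next
    case (Compl a)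
    from Compl.IH show ?case
    proof
      assume "AE w in P. xC w \<in> a"
      then have "AE w in P. xC w \<notin> point_measures MC - a" by eventually_elim simp
      then show ?thesis ..
    next
      assume "AE w in P. xC w \<notin> a"
      then have "AE w in P. xC w \<in> point_measures MC - a"
        using AE_space by eventually_elim (use sp in simp)
      then show ?thesis ..
    qed
  next
    case (Union a)
    show ?case
    proof (cases "\<exists>i. AE w in P. xC w \<in> a i")
      case True
      then obtain i where "AE w in P. xC w \<in> a i" ..
      then have "AE w in P. xC w \<in> (\<Union>i. a i)" by eventually_elim blast
      then show ?thesis ..
    next
      case False
      then have "\<And>i. AE w in P. xC w \<notin> a i" using Union.IH by blast
      then have "AE w in P. \<forall>i. xC w \<notin> a i" by (simp add: AE_all_countable)
      then have "AE w in P. xC w \<notin> (\<Union>i. a i)" by eventually_elim blast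
      then show ?thesis ..
    qed
  qed simp
qed

end

context punctured_product
begin

text \<open>For \<open>C = {}\<close> the process over \<open>C\<close> merely counts all points. It
  is almost surely trivial, so that unconditional independence is the degenerate case of
  \<open>block_ci_iff_process\<close>.\<close>

lemma block_ci_iff_process_cond_indep:
  assumes pp: "poisson_process P \<Lambda> \<xi>"
  shows "T.block_ci \<longleftrightarrow> process_cond_indep M A B C P \<xi>"
proof -
  interpret TP: punctured_triple_poisson \<Lambda> "PiM A M" "\<lambda>y. restrict y A" "restrict pt A" "KI A"
    "PiM B M" "\<lambda>y. restrict y B" "restrict pt B" "KI B"
    "PiM C M" "\<lambda>y. restrict y C" "restrict pt C" "KI C" P \<xi>
    by unfold_locales (rule pp)
  have x: "proj_process M \<xi> A = TP.xA" "proj_process M \<xi> B = TP.xB" "proj_process M \<xi> C = TP.xC"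
    by (auto simp: fun_eq_iff proj_process_def TP.xA_def TP.xB_def TP.xC_def)
  have "process_cond_indep M A B C P \<xi> \<longleftrightarrow>
    ci P (point_measure_algebra (PiM A M)) TP.xA (point_measure_algebra (PiM B M)) TP.xB (point_measure_algebra (PiM C M)) TP.xC"
  proof (cases "C = {}")
    case True
    have sp: "space (PiM C M) = {\<lambda>_. undefined}" using True by (simp add: space_PiM)
    have r: "restrict y C = (\<lambda>_. undefined)" for y :: "nat \<Rightarrow> 'a" using True by (simp add: restrict_def)
    \<comment> \<open>With a single value of \<open>y_C\<close>, each preimage is empty or the whole
      space, and the whole space is the set \<open>y_C = o_C\<close>, of mass 0 or
      \<infinity>.\<close>
    have triv: "emeasure \<Lambda> ((\<lambda>y. restrict y C) -` G \<inter> space \<Lambda>) \<in> {0, \<infinity>}" if G: "G \<in> sets (PiM C M)" for G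
    proof (cases "(\<lambda>_. undefined) \<in> G")
      case True
      then have "(\<lambda>y. restrict y C) -` G \<inter> space \<Lambda> = {y \<in> space \<Lambda>. restrict y C = restrict pt C}"
        by (auto simp: r)
      then show ?thesis using T.inf_C by simp
    next
      case False
      then have "(\<lambda>y. restrict y C) -` G \<inter> space \<Lambda> = {}" by (auto simp: r)
      then show ?thesis by simp
    qed
    from TP.P.indep_var_iff_ci[OF TP.xA TP.xB TP.xC TP.xC_trivial[OF triv]]
    show ?thesis using True by (simp add: process_cond_indep_def x)
  next
    case False
    from TP.P.cond_indep_var_iff_ci[OF TP.xA TP.xB TP.xC]
    show ?thesis using False by (simp add: process_cond_indep_def x)
  qed
  then show ?thesis by (simp add: TP.block_ci_iff_process)
qed

lemma star_iff:
  "T.star \<longleftrightarrow> emeasure \<Lambda> {y \<in> space \<Lambda>. restrict y A \<noteq> restrict pt A \<and> restrict y B \<noteq> restrict pt B \<and>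
    restrict y C = restrict pt C} = 0"
  by (simp add: T.star_def)

lemma star_iff_empty:
  "C = {} \<Longrightarrow> T.star \<longleftrightarrow> emeasure \<Lambda> {y \<in> space \<Lambda>. restrict y A \<noteq> restrict pt A \<and> restrict y B \<noteq> restrict pt B} = 0"
proof -
  assume "C = {}"
  then have "restrict y C = restrict pt C" for y by (simp add: restrict_eq_iff)
  then show ?thesis unfolding star_iff by (simp only: simp_thms)
qed

text \<open>There are no coordinates \<open>c\<close> to quantify over, so the cylinder condition is
  vacuous.\<close>

lemma admits_iff_star: "C = {} \<Longrightarrow> admits_cond_indep M L V \<Lambda> A B C \<longleftrightarrow> T.star"
  unfolding admits_iff_cyl_C by blast

lemma admits_iff_kernel:
  assumes K: "disintegrating_kernel M pt \<Lambda> A B C K"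
  shows "admits_cond_indep M L V \<Lambda> A B C \<longleftrightarrow>
    (AE yC in punctured_marginal M pt \<Lambda> C. K yC = distr (marginal_kernel M A K yC \<Otimes>\<^sub>M marginal_kernel M B K yC)
               (PiM (A \<union> B) M) (merge A B)) \<and> T.star"
  unfolding admits_iff_block_ci T.block_ci_def
  using kernel_prod_imp_ci[OF K] ci_imp_kernel_prod[OF K] by blast

end

theorem theorem4p5:
  fixes d :: nat and V A B C :: "nat set"
    and M :: "nat \<Rightarrow> 'a measure" and pt :: "nat \<Rightarrow> 'a" and L :: "nat \<Rightarrow> nat \<Rightarrow> 'a set"
    and \<Lambda> :: "(nat \<Rightarrow> 'a) measure"
  assumes "d \<ge> 1" and "V = {1..d}"
    and "\<And>v. v \<in> V \<Longrightarrow> borel_isomorphic (M v)"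
    and "\<And>v. v \<in> V \<Longrightarrow> pt v \<in> space (M v)"
    and "sets \<Lambda> = sets (punctured M pt V)"
    and "\<And>v. v \<in> V \<Longrightarrow>
      localized (restrict_space (M v) (space (M v) - {pt v})) (\<lambda>h. L h v)"
    and "\<And>I. I \<subseteq> V \<Longrightarrow> I \<noteq> {} \<Longrightarrow> localized (punctured M pt I) (prod_loc M L I)"
    and "\<And>h. h \<ge> 1 \<Longrightarrow> emeasure \<Lambda> (prod_loc M L V h) < \<infinity>"
    and "\<And>I J. I \<subseteq> V \<Longrightarrow> J \<subseteq> V \<Longrightarrow> I \<inter> J = {} \<Longrightarrow> I \<noteq> {} \<Longrightarrow>
      emeasure \<Lambda> {y \<in> space \<Lambda>. restrict y I \<noteq> restrict pt I \<and> restrict y J = restrict pt J} \<in> {0, \<infinity>}"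
    and "A \<union> B \<union> C = V" and "A \<inter> B = {}" and "A \<inter> C = {}" and "B \<inter> C = {}"
    and "A \<noteq> {}" and "B \<noteq> {}"
  shows
    "(admits_cond_indep M L V \<Lambda> A B C \<longleftrightarrow>
       (\<forall>v\<in>V. \<forall>h\<ge>1. emeasure \<Lambda> (cyl M L V h v) > 0 \<longrightarrow>
         coord_cond_indep M A B C (cond_law \<Lambda> (cyl M L V h v)))) \<and>
     (admits_cond_indep M L V \<Lambda> A B C \<longleftrightarrow>
       (if C \<noteq> {} then
         (\<forall>c\<in>C. \<forall>h\<ge>1. emeasure \<Lambda> (cyl M L V h c) > 0 \<longrightarrow>
           coord_cond_indep M A B C (cond_law \<Lambda> (cyl M L V h c))) \<and>
         emeasure \<Lambda> {y \<in> space \<Lambda>. restrict y A \<noteq> restrict pt A \<and> restrict y B \<noteq> restrict pt B \<and>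
           restrict y C = restrict pt C} = 0
        else
         emeasure \<Lambda> {y \<in> space \<Lambda>. restrict y A \<noteq> restrict pt A \<and> restrict y B \<noteq> restrict pt B} = 0)) \<and>
     (\<forall>K. (C \<noteq> {} \<longrightarrow> disintegrating_kernel M pt \<Lambda> A B C K) \<longrightarrow>
       (admits_cond_indep M L V \<Lambda> A B C \<longleftrightarrow>
         (if C \<noteq> {} then
           (AE yC in punctured_marginal M pt \<Lambda> C.
             K yC = distr (marginal_kernel M A K yC \<Otimes>\<^sub>M marginal_kernel M B K yC)
               (PiM (A \<union> B) M) (merge A B)) \<and>
           emeasure \<Lambda> {y \<in> space \<Lambda>. restrict y A \<noteq> restrict pt A \<and> restrict y B \<noteq> restrict pt B \<and>
             restrict y C = restrict pt C} = 0
          else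
           emeasure \<Lambda> {y \<in> space \<Lambda>. restrict y A \<noteq> restrict pt A \<and> restrict y B \<noteq> restrict pt B} = 0))) \<and>
     (\<forall>(P :: 'w measure) \<xi>. poisson_process P \<Lambda> \<xi> \<longrightarrow>
       (admits_cond_indep M L V \<Lambda> A B C \<longleftrightarrow> process_cond_indep M A B C P \<xi>))"
proof -
  interpret punctured_product V A B C M pt L \<Lambda>
  proof
    show "finite V" by (simp add: \<open>V = {1..d}\<close>)
  qed (fact assms)+
  \<comment> \<open>The branches are proved under their own conditions, since a disintegrating
    kernel is available only in the branch \<open>C \<noteq> {}\<close>.\<close>
  have if_iff: "a \<longleftrightarrow> (if c then x else y)" if "c \<Longrightarrow> a \<longleftrightarrow> x" "\<not> c \<Longrightarrow> a \<longleftrightarrow> y" for a c x y :: bool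
    using that by simp
  have empty: "admits_cond_indep M L V \<Lambda> A B C \<longleftrightarrow>
      emeasure \<Lambda> {y \<in> space \<Lambda>. restrict y A \<noteq> restrict pt A \<and> restrict y B \<noteq> restrict pt B} = 0" if "\<not> C \<noteq> {}"
    using admits_iff_star star_iff_empty that by blast
  show ?thesis
  proof (intro conjI allI impI)
    show "admits_cond_indep M L V \<Lambda> A B C \<longleftrightarrow>
       (\<forall>v\<in>V. \<forall>h\<ge>1. emeasure \<Lambda> (cyl M L V h v) > 0 \<longrightarrow>
         coord_cond_indep M A B C (cond_law \<Lambda> (cyl M L V h v)))"
      by (rule admits_iff_cyl)
    show "admits_cond_indep M L V \<Lambda> A B C \<longleftrightarrow>
       (if C \<noteq> {} then
         (\<forall>c\<in>C. \<forall>h\<ge>1. emeasure \<Lambda> (cyl M L V h c) > 0 \<longrightarrow>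
           coord_cond_indep M A B C (cond_law \<Lambda> (cyl M L V h c))) \<and>
         emeasure \<Lambda> {y \<in> space \<Lambda>. restrict y A \<noteq> restrict pt A \<and> restrict y B \<noteq> restrict pt B \<and>
           restrict y C = restrict pt C} = 0
        else
         emeasure \<Lambda> {y \<in> space \<Lambda>. restrict y A \<noteq> restrict pt A \<and> restrict y B \<noteq> restrict pt B} = 0)"
      by (rule if_iff[OF admits_iff_cyl_C[unfolded star_iff] empty])
    show "admits_cond_indep M L V \<Lambda> A B C \<longleftrightarrow>
         (if C \<noteq> {} then
           (AE yC in punctured_marginal M pt \<Lambda> C.
             K yC = distr (marginal_kernel M A K yC \<Otimes>\<^sub>M marginal_kernel M B K yC)
               (PiM (A \<union> B) M) (merge A B)) \<and>
           emeasure \<Lambda> {y \<in> space \<Lambda>. restrict y A \<noteq> restrict pt A \<and> restrict y B \<noteq> restrict pt B \<and>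
             restrict y C = restrict pt C} = 0
          else
           emeasure \<Lambda> {y \<in> space \<Lambda>. restrict y A \<noteq> restrict pt A \<and> restrict y B \<noteq> restrict pt B} = 0)"
      if "C \<noteq> {} \<longrightarrow> disintegrating_kernel M pt \<Lambda> A B C K" for K
      by (rule if_iff[OF admits_iff_kernel[OF that[rule_format], unfolded star_iff] empty])
    show "admits_cond_indep M L V \<Lambda> A B C \<longleftrightarrow> process_cond_indep M A B C P \<xi>"
      if "poisson_process P \<Lambda> \<xi>" for P :: "'w measure" and \<xi>
      using block_ci_iff_process_cond_indep[OF that] by (simp add: admits_iff_block_ci)
  qed
qed

end
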